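(* Let $v\in W^{n,1}(\mathbb{R}^n)$. Then for each $\varepsilon>0$ there exists $\delta>0$ such that for any set $E\subset\mathbb{R}^n$: if $\mathcal{H}^1_\infty(E)<\delta$, then $\mathcal{H}^1(v(E))<\varepsilon$. In particular, $\mathcal{H}^1(v(E))=0$ whenever $\mathcal{H}^1(E)=0$.
   Context: $W^{n,1}(\mathbb{R}^n)$ is the space of real-valued functions in $L^1(\mathbb{R}^n)$ all of whose distributional partial derivatives of order at most $n$ belong to $L^1(\mathbb{R}^n)$. The precise representative of $v$ is always used: $v(x)=\lim_{r\to0}\frac{1}{\mathcal{L}^n(B(x,r))}\int_{B(x,r)}v(z)\,dz$ if the limit exists and is finite, and $0$ otherwise; for $v\in W^{n,1}(\mathbb{R}^n)$ this representative is continuous. For $F\subset\mathbb{R}^m$ and $0<\alpha\le\infty$, $\mathcal{H}^k_\alpha(F)=\inf\{\sum_{i=1}^\infty(\operatorname{diam}F_i)^k:\ \operatorname{diam}F_i\le\alpha,\ F\subset\bigcup_{i=1}^\infty F_i\}$; $\mathcal{H}^k_\infty$ is the $k$-dimensional Hausdorff content, and $\mathcal{H}^k(F)=\lim_{\alpha\searrow0}\mathcal{H}^k_\alpha(F)$ is the $k$-dimensional Hausdorff measure. *)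

theory Defs
  imports "HOL-Analysis.Analysis"
begin

definition partial_deriv :: "'n::finite \<Rightarrow> (real^'n \<Rightarrow> real) \<Rightarrow> real^'n \<Rightarrow> real" where
  "partial_deriv i f x = frechet_derivative f (at x) (axis i 1)"

text \<open>A partial derivative of order \<open>k\<close> is indexed by the list of the \<open>k\<close> coordinate directions
  in which one differentiates.  On smooth functions the order of the list is irrelevant, so lists
  represent exactly the multi-indices of order \<open>k\<close>.\<close>

definition partial_derivs :: "'n::finite list \<Rightarrow> (real^'n \<Rightarrow> real) \<Rightarrow> real^'n \<Rightarrow> real" where
  "partial_derivs is f = foldr partial_deriv is f"

text \<open>Smoothness: all iterated partial derivatives are (Frechet) differentiable everywhere, hence
  exist and are continuous.\<close>

definition smooth :: "(real^'n::finite \<Rightarrow> real) \<Rightarrow> bool" where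
  "smooth f \<longleftrightarrow> (\<forall>is x. partial_derivs is f differentiable (at x))"

definition test_function :: "(real^'n::finite \<Rightarrow> real) \<Rightarrow> bool" where
  "test_function \<phi> \<longleftrightarrow> smooth \<phi> \<and> compact (closure {x. \<phi> x \<noteq> 0})"

definition has_weak_deriv ::
    "(real^'n::finite \<Rightarrow> real) \<Rightarrow> 'n list \<Rightarrow> (real^'n \<Rightarrow> real) \<Rightarrow> bool" where
  "has_weak_deriv v is g \<longleftrightarrow>
    (\<forall>\<phi>. test_function \<phi> \<longrightarrow>
      (LINT x|lebesgue. v x * partial_derivs is \<phi> x)
        = (- 1) ^ length is * (LINT x|lebesgue. g x * \<phi> x))"

text \<open>The Sobolev space \<open>W\<^sup>k\<^sup>,\<^sup>1\<close>.  Its members are individual functions, not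
  almost-everywhere equivalence classes.\<close>

definition sobolev_W1 :: "nat \<Rightarrow> (real^'n::finite \<Rightarrow> real) set" where
  "sobolev_W1 k = {v. integrable lebesgue v \<and>
     (\<forall>is. length is \<le> k \<longrightarrow> (\<exists>g. integrable lebesgue g \<and> has_weak_deriv v is g))}"

definition ball_average :: "('a::euclidean_space \<Rightarrow> real) \<Rightarrow> 'a \<Rightarrow> real \<Rightarrow> real" where
  "ball_average v x r = (1 / measure lebesgue (ball x r)) * (LINT z:ball x r|lebesgue. v z)"

definition precise_rep :: "('a::euclidean_space \<Rightarrow> real) \<Rightarrow> 'a \<Rightarrow> real" where
  "precise_rep v x =
    (if \<exists>l. (ball_average v x \<longlongrightarrow> l) (at_right 0) then Lim (at_right 0) (ball_average v x) else 0)"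

text \<open>The library's \<^const>\<open>diameter\<close> is real-valued and meaningless on unbounded sets; here the
  diameter of an unbounded set is \<open>\<infinity>\<close>, and that of the empty set is \<open>0\<close>.\<close>

definition ediam :: "'a::metric_space set \<Rightarrow> ennreal" where
  "ediam S = (SUP x\<in>S. SUP y\<in>S. ennreal (dist x y))"

text \<open>Coverings are sequences of sets, some of which may be empty.  The definition is meant for
  \<open>k \<ge> 1\<close>: for \<open>k = 0\<close> the empty sets would contribute \<open>0 ^ 0 = 1\<close>.\<close>

definition hausdorff_pre :: "nat \<Rightarrow> ennreal \<Rightarrow> 'a::metric_space set \<Rightarrow> ennreal" where
  "hausdorff_pre k \<alpha> F =
    (INF A\<in>{A :: nat \<Rightarrow> 'a set. (\<forall>i. ediam (A i) \<le> \<alpha>) \<and> F \<subseteq> (\<Union>i. A i)}. \<Sum>i. ediam (A i) ^ k)"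

definition hausdorff_content :: "nat \<Rightarrow> 'a::metric_space set \<Rightarrow> ennreal" where
  "hausdorff_content k F = hausdorff_pre k \<infinity> F"

definition hausdorff_measure :: "nat \<Rightarrow> 'a::metric_space set \<Rightarrow> ennreal" where
  "hausdorff_measure k F = Lim (at_right 0) (\<lambda>\<alpha>::real. hausdorff_pre k (ennreal \<alpha>) F)"

lemma hausdorff_pre_antimono:
  assumes "\<alpha> \<le> \<beta>"
  shows "hausdorff_pre k \<beta> F \<le> hausdorff_pre k \<alpha> F"
  unfolding hausdorff_pre_def
  by (rule INF_superset_mono) (use assms order_trans in blast)+

text \<open>The limit defining \<^const>\<open>hausdorff_measure\<close> always exists.\<close>

lemma hausdorff_pre_tendsto_SUP:
  "((\<lambda>\<alpha>::real. hausdorff_pre k (ennreal \<alpha>) F) \<longlongrightarrow> (SUP \<alpha>\<in>{0<..}. hausdorff_pre k (ennreal \<alpha>) F))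
    (at_right 0)" (is "(?f \<longlongrightarrow> ?S) _")
proof (rule order_tendstoI)
  fix a assume "a < ?S"
  then obtain \<beta> where \<beta>: "\<beta> > 0" "a < ?f \<beta>"
    by (auto simp: less_SUP_iff)
  have "a < ?f \<alpha>" if "0 < \<alpha>" "\<alpha> < \<beta>" for \<alpha>
    using \<beta>(2) hausdorff_pre_antimono[of "ennreal \<alpha>" "ennreal \<beta>" k F] that
    by (meson ennreal_leI less_imp_le order_less_le_trans)
  then show "eventually (\<lambda>\<alpha>. a < ?f \<alpha>) (at_right 0)"
    using \<beta>(1) unfolding eventually_at_right_field by blast
next
  fix a assume a: "?S < a"
  have "?f \<alpha> < a" if "0 < \<alpha>" for \<alpha>
    using that by (intro order_le_less_trans[OF SUP_upper a]) auto
  then show "eventually (\<lambda>\<alpha>. ?f \<alpha> < a) (at_right 0)"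
    unfolding eventually_at_right_field by (intro exI[of _ 1]) auto
qed

lemma hausdorff_measure_eq_SUP:
  "hausdorff_measure k F = (SUP \<alpha>\<in>{0::real<..}. hausdorff_pre k (ennreal \<alpha>) F)"
  unfolding hausdorff_measure_def
  by (rule tendsto_Lim[OF _ hausdorff_pre_tendsto_SUP]) simp

end

theory Submission
  imports Defs
begin

text \<open>
  Sample mollified averages of \<open>v\<close> on the lattices of mesh \<open>2^-m\<close>. With smooth B-splines as kernels,
  finite differences of the samples are averages of the weak derivatives of \<open>v\<close>, so that after
  rescaling the differences of order up to \<open>n\<close> are bounded in \<open>L\<^sup>1\<close> and uniformly integrable,
  uniformly in \<open>m\<close>. Everything else is combinatorics of dyadic cubes.

  A set of small content is covered by disjoint dyadic cubes of small total side length, chosen so that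
  the side lengths inside any larger dyadic cube \<open>Q\<close> add up to at most a constant times that of \<open>Q\<close>.
  Joining two points in each cube by a lattice path bounds the sum of the oscillations by the
  integral of the first differences against a measure \<open>\<mu>\<close> with \<open>\<mu>(Q) \<le> C l(Q)\<close>. Dyadic
  potentials trade one order of differentiation for one power of \<open>l(Q)\<close> until the order is \<open>n - 1\<close>
  and \<open>\<mu>(Q) \<le> C l(Q)^(n-1)\<close>. There the potential diverges logarithmically and is replaced by Maz'ya's
  inequality, which follows from the coarea formula and a covering of level sets by cubes that
  they fill partially. Truncation together with uniform integrability makes the final bound small
  when the total mass of \<open>\<mu>\<close> is small. The same estimate for a single pair of points gives
  equicontinuity, hence convergence of the samples to the precise representative.
\<close>

subsection \<open>Dyadic cubes and discrete potentials\<close>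

text \<open>On a lattice, coarea, boxing and duality become statements about finite sums; analysis
  enters only through one fixed integrable function per weak derivative, tested against kernels. The
  price is uniformity: every constant and every smallness threshold must be independent of the mesh
  2^-m.

  The L^1 endpoint shapes the argument. If \<mu> has density at most K, the L^1 bound gives only K
  times the norm of the top derivative, which does not become small with the mass of \<mu>; this is
  why uniform integrability is carried along with the bounds. At growth exponent n - 1 every dyadic
  scale contributes the same amount to a potential, so its bound would grow with the number m of
  scales.

  Smallness is proved from order n down to order 1, while measures travel the other way: paths have
  growth 1 and each potential raises the exponent by one. Since each step also enlarges the growth
  constant, the inductive statement has to hold for all constants at once.\<close>

definition fdiff :: "'n \<Rightarrow> (('n \<Rightarrow> int) \<Rightarrow> real) \<Rightarrow> ('n \<Rightarrow> int) \<Rightarrow> real" where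
  "fdiff i f z = f (z(i := z i + 1)) - f z"

definition fdiffs :: "'n list \<Rightarrow> (('n \<Rightarrow> int) \<Rightarrow> real) \<Rightarrow> ('n \<Rightarrow> int) \<Rightarrow> real" where
  "fdiffs is f = foldr fdiff is f"

definition fgrad :: "(('n::finite \<Rightarrow> int) \<Rightarrow> real) \<Rightarrow> ('n \<Rightarrow> int) \<Rightarrow> real" where
  "fgrad f z = (\<Sum>i\<in>UNIV. \<bar>fdiff i f z\<bar>)"

text \<open>Blocks and cubes are addressed by any of their points instead of by an index;
  \<open>div\<close> rounds towards minus infinity, so the blocks tile the integers on both sides of
  0.\<close>

definition block :: "nat \<Rightarrow> int \<Rightarrow> int set" where
  "block j t = {s. s div 2 ^ j = t div 2 ^ j}"

definition cube :: "nat \<Rightarrow> ('n \<Rightarrow> int) \<Rightarrow> ('n \<Rightarrow> int) set" where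
  "cube j z = {y. \<forall>i. y i \<in> block j (z i)}"

text \<open>Finite unions of level-\<open>j\<close> cubes. Sums over such a set never cut a cube,
  which makes sums over pairs in a common cube symmetric.\<close>

definition saturated :: "nat \<Rightarrow> ('n \<Rightarrow> int) set \<Rightarrow> bool" where
  "saturated j G \<longleftrightarrow> finite G \<and> (\<forall>z\<in>G. cube j z \<subseteq> G)"

lemma fgrad_nonneg: "0 \<le> fgrad f z"
  unfolding fgrad_def by (intro sum_nonneg) auto

lemma block_eq: "block j t = {(t div 2 ^ j) * 2 ^ j ..< (t div 2 ^ j) * 2 ^ j + 2 ^ j}"
proof -
  have "s div 2 ^ j = q \<longleftrightarrow> q * 2 ^ j \<le> s \<and> s < q * 2 ^ j + 2 ^ j" for s q :: int
  proof
    assume q: "s div 2 ^ j = q"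
    have "s div 2 ^ j * 2 ^ j + s mod 2 ^ j = s" by (rule div_mult_mod_eq)
    moreover have "0 \<le> s mod 2 ^ j" "s mod 2 ^ j < 2 ^ j"
      by simp_all
    ultimately show "q * 2 ^ j \<le> s \<and> s < q * 2 ^ j + 2 ^ j"
      unfolding q by linarith
  next
    assume "q * 2 ^ j \<le> s \<and> s < q * 2 ^ j + 2 ^ j"
    then show "s div 2 ^ j = q"
      by (intro int_div_pos_eq[of _ _ _ "s - q * 2 ^ j"]) (auto simp: mult.commute)
  qed
  then show ?thesis by (auto simp: block_def)
qed

lemma finite_block [simp]: "finite (block j t)"
  by (simp add: block_eq)

lemma card_block [simp]: "card (block j t) = 2 ^ j"
  by (simp add: block_eq nat_power_eq)

lemma cube_PiE: "cube j z = Pi\<^sub>E UNIV (\<lambda>i. block j (z i))"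
  by (auto simp: cube_def PiE_def Pi_def)

lemma finite_cube [simp]: "finite (cube j (z :: 'n::finite \<Rightarrow> int))"
  by (simp add: cube_PiE finite_PiE)

lemma card_cube: "card (cube j (z :: 'n::finite \<Rightarrow> int)) = 2 ^ (j * CARD('n))"
  by (simp add: cube_PiE card_PiE power_mult)

lemma cube_self [simp]: "z \<in> cube j z"
  by (simp add: cube_def block_def)

lemma cube_sym: "y \<in> cube j z \<longleftrightarrow> z \<in> cube j y"
  by (auto simp: cube_def block_def)

lemma cube_cong: "y \<in> cube j z \<Longrightarrow> cube j y = cube j z"
  by (auto simp: cube_def block_def)

lemma block_mono: "j \<le> k \<Longrightarrow> block j t \<subseteq> block k t"
proof -
  assume "j \<le> k"
  then obtain d where k: "k = j + d" using le_Suc_ex by blast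
  have "s div 2 ^ k = (s div 2 ^ j) div 2 ^ d" for s :: int
    by (simp add: k power_add zdiv_zmult2_eq)
  then show ?thesis by (auto simp: block_def)
qed

lemma cube_mono: "j \<le> k \<Longrightarrow> cube j z \<subseteq> cube k z"
  using block_mono by (fastforce simp: cube_def)

lemma cube_0 [simp]: "cube 0 z = {z}"
  by (auto simp: cube_def block_def)

lemma saturated_mono: "saturated k G \<Longrightarrow> j \<le> k \<Longrightarrow> saturated j G"
  using cube_mono unfolding saturated_def by blast

lemma saturated_cube: "j \<le> k \<Longrightarrow> saturated j (cube k (z :: 'n::finite \<Rightarrow> int))"
  unfolding saturated_def using cube_mono cube_cong by fastforce

text \<open>Lying in a common cube is a symmetric relation and saturation keeps all partners inside
  \<open>G\<close>, so this is Fubini over one set of pairs. The duality between \<mu> and gradients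
  rests on it.\<close>

lemma sum_cube_swap:
  fixes F :: "('n::finite \<Rightarrow> int) \<Rightarrow> ('n \<Rightarrow> int) \<Rightarrow> real"
  assumes "saturated j G"
  shows "(\<Sum>x\<in>G. \<Sum>z\<in>cube j x. F x z) = (\<Sum>z\<in>G. \<Sum>x\<in>cube j z. F x z)"
proof -
  have fin: "finite G" and sub: "\<And>z. z \<in> G \<Longrightarrow> cube j z \<subseteq> G"
    using assms by (auto simp: saturated_def)
  have "(\<Sum>x\<in>G. \<Sum>z\<in>cube j x. F x z) = (\<Sum>x\<in>G. \<Sum>z | z \<in> G \<and> z \<in> cube j x. F x z)"
    using sub by (intro sum.cong) auto
  also have "\<dots> = (\<Sum>z\<in>G. \<Sum>x | x \<in> G \<and> z \<in> cube j x. F x z)"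
    using fin by (intro sum.swap_restrict)
  also have "\<dots> = (\<Sum>z\<in>G. \<Sum>x\<in>cube j z. F x z)"
    using sub cube_sym by (intro sum.cong) blast+
  finally show ?thesis .
qed

section \<open>Poincare inequality on a cube and potential estimates\<close>

lemma telescope_line:
  assumes "a \<le> b"
  shows "w (u(i := b)) - w (u(i := a)) = (\<Sum>s\<in>{a..<b}. fdiff i w (u(i := s)))"
  using assms
proof (induction b rule: int_ge_induct)
  case (step b)
  then have "{a..<b + 1} = insert b {a..<b}" by auto
  moreover have "fdiff i w (u(i := b)) = w (u(i := b + 1)) - w (u(i := b))"
    by (simp add: fdiff_def)
  ultimately show ?case using step by (simp del: fun_upd_apply)
qed simp

lemma line_diff_le:
  assumes "a \<in> block j c" "b \<in> block j c"
  shows "\<bar>w (u(i := b)) - w (u(i := a))\<bar> \<le> (\<Sum>s\<in>block j c. \<bar>fdiff i w (u(i := s))\<bar>)"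
proof -
  have *: "\<bar>w (u(i := b)) - w (u(i := a))\<bar> \<le> (\<Sum>s\<in>block j c. \<bar>fdiff i w (u(i := s))\<bar>)"
    if "a \<le> b" "a \<in> block j c" "b \<in> block j c" for a b
  proof -
    have "\<bar>w (u(i := b)) - w (u(i := a))\<bar> \<le> (\<Sum>s\<in>{a..<b}. \<bar>fdiff i w (u(i := s))\<bar>)"
      unfolding telescope_line[OF that(1)] by (rule sum_abs)
    also have "\<dots> \<le> (\<Sum>s\<in>block j c. \<bar>fdiff i w (u(i := s))\<bar>)"
      using that by (intro sum_mono2) (auto simp: block_eq)
    finally show ?thesis .
  qed
  show ?thesis
  proof (cases "a \<le> b")
    case False
    then show ?thesis using *[of b a] assms by (simp add: abs_minus_commute)
  qed (use * assms in auto)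
qed

text \<open>Overwriting coordinate \<open>i\<close> hits each point of the cube once for every old
  value of that coordinate, hence 2^j times; exchanging old and new value is the bijection.\<close>

lemma sum_cube_update:
  fixes F :: "('n::finite \<Rightarrow> int) \<Rightarrow> real"
  shows "(\<Sum>u\<in>cube j c. \<Sum>t\<in>block j (c i). F (u(i := t))) = 2 ^ j * (\<Sum>z\<in>cube j c. F z)"
proof -
  have "(\<Sum>u\<in>cube j c. \<Sum>t\<in>block j (c i). F (u(i := t)))
      = (\<Sum>(u, t)\<in>cube j c \<times> block j (c i). F (u(i := t)))"
    by (simp add: sum.cartesian_product)
  also have "\<dots> = (\<Sum>(z, s)\<in>cube j c \<times> block j (c i). F z)"
    by (rule sum.reindex_bij_witness[where i = "\<lambda>(u, t). (u(i := t), u i)"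
          and j = "\<lambda>(u, t). (u(i := t), u i)"]) (auto simp: cube_def)
  also have "\<dots> = (\<Sum>z\<in>cube j c. \<Sum>s\<in>block j (c i). F z)"
    by (rule sum.cartesian_product[symmetric])
  finally show ?thesis by (simp add: sum_distrib_left)
qed

text \<open>The points of a cube are joined by changing one coordinate at a time; the swap of the
  coordinates in \<open>S\<close> is an involution of the pairs.\<close>

lemma poincare_cube_aux:
  fixes w :: "('n::finite \<Rightarrow> int) \<Rightarrow> real"
  defines "mix \<equiv> (\<lambda>S x y (i::'n). if i \<in> S then y i else x i :: int)"
  assumes "finite S"
  shows "(\<Sum>x\<in>cube j c. \<Sum>y\<in>cube j c. \<bar>w (mix S x y) - w x\<bar>)
    \<le> 2 ^ j * card (cube j c) * (\<Sum>i\<in>S. \<Sum>z\<in>cube j c. \<bar>fdiff i w z\<bar>)"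
  using assms(2)
proof (induction S)
  case empty
  then show ?case by (simp add: mix_def)
next
  case (insert i S)
  let ?Q = "cube j c"
  have mixi: "mix (insert i S) x y = (mix S x y)(i := y i)" for x y
    using insert by (auto simp: mix_def)
  have "(\<Sum>x\<in>?Q. \<Sum>y\<in>?Q. \<bar>w ((mix S x y)(i := y i)) - w (mix S x y)\<bar>)
      = (\<Sum>(x, y)\<in>?Q \<times> ?Q. \<bar>w ((mix S x y)(i := y i)) - w (mix S x y)\<bar>)"
    by (simp add: sum.cartesian_product)
  \<comment> \<open>The intermediate point \<open>mix S x y\<close> becomes the free variable
    \<open>u\<close>. Since \<open>i\<close> is not in \<open>S\<close>, the swapped partner keeps
    the value \<open>y i\<close>, so only the line through \<open>u\<close> in direction
    \<open>i\<close> is involved.\<close>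
  also have "\<dots> = (\<Sum>(u, y)\<in>?Q \<times> ?Q. \<bar>w (u(i := y i)) - w u\<bar>)"
    by (rule sum.reindex_bij_witness[where i = "\<lambda>(x, y). (mix S x y, mix S y x)"
          and j = "\<lambda>(x, y). (mix S x y, mix S y x)"])
      (use insert.hyps in \<open>auto simp: mix_def cube_def fun_eq_iff\<close>)
  also have "\<dots> = (\<Sum>u\<in>?Q. \<Sum>y\<in>?Q. \<bar>w (u(i := y i)) - w (u(i := u i))\<bar>)"
    by (simp add: sum.cartesian_product)
  also have "\<dots> \<le> (\<Sum>u\<in>?Q. \<Sum>y\<in>?Q. \<Sum>t\<in>block j (c i). \<bar>fdiff i w (u(i := t))\<bar>)"
    by (intro sum_mono line_diff_le) (auto simp: cube_def)
  also have "\<dots> = card ?Q * (\<Sum>u\<in>?Q. \<Sum>t\<in>block j (c i). \<bar>fdiff i w (u(i := t))\<bar>)"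
    by (simp add: sum_distrib_left)
  also have "\<dots> = 2 ^ j * card ?Q * (\<Sum>z\<in>?Q. \<bar>fdiff i w z\<bar>)"
    unfolding sum_cube_update[where F = "\<lambda>z. \<bar>fdiff i w z\<bar>"] by simp
  finally have step: "(\<Sum>x\<in>?Q. \<Sum>y\<in>?Q. \<bar>w ((mix S x y)(i := y i)) - w (mix S x y)\<bar>)
    \<le> 2 ^ j * card ?Q * (\<Sum>z\<in>?Q. \<bar>fdiff i w z\<bar>)" .
  have "(\<Sum>x\<in>?Q. \<Sum>y\<in>?Q. \<bar>w (mix (insert i S) x y) - w x\<bar>)
     \<le> (\<Sum>x\<in>?Q. \<Sum>y\<in>?Q. \<bar>w ((mix S x y)(i := y i)) - w (mix S x y)\<bar> + \<bar>w (mix S x y) - w x\<bar>)"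
    unfolding mixi
  proof (intro sum_mono)
    show "\<bar>a - c\<bar> \<le> \<bar>a - b\<bar> + \<bar>b - c\<bar>" for a b c :: real by linarith
  qed
  also have "\<dots> \<le> 2 ^ j * card ?Q * (\<Sum>z\<in>?Q. \<bar>fdiff i w z\<bar>)
      + 2 ^ j * card ?Q * (\<Sum>i\<in>S. \<Sum>z\<in>?Q. \<bar>fdiff i w z\<bar>)"
    unfolding sum.distrib by (intro add_mono step insert.IH)
  also have "\<dots> = 2 ^ j * card ?Q * (\<Sum>i\<in>insert i S. \<Sum>z\<in>?Q. \<bar>fdiff i w z\<bar>)"
    by (simp only: sum.insert[OF insert.hyps] distrib_left)
  finally show ?case .
qed

lemma poincare_cube:
  fixes w :: "('n::finite \<Rightarrow> int) \<Rightarrow> real"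
  shows "(\<Sum>x\<in>cube j c. \<Sum>y\<in>cube j c. \<bar>w x - w y\<bar>)
    \<le> 2 ^ j * 2 ^ (j * CARD('n)) * (\<Sum>z\<in>cube j c. fgrad w z)"
proof -
  have "(\<Sum>x\<in>cube j c. \<Sum>y\<in>cube j c. \<bar>w x - w y\<bar>) = (\<Sum>x\<in>cube j c. \<Sum>y\<in>cube j c. \<bar>w y - w x\<bar>)"
    by (simp add: abs_minus_commute)
  also have "\<dots> \<le> 2 ^ j * card (cube j c) * (\<Sum>i\<in>UNIV. \<Sum>z\<in>cube j c. \<bar>fdiff i w z\<bar>)"
    using poincare_cube_aux[of UNIV w j c] by simp
  also have "(\<Sum>i\<in>UNIV. \<Sum>z\<in>cube j c. \<bar>fdiff i w z\<bar>) = (\<Sum>z\<in>cube j c. fgrad w z)"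
    unfolding fgrad_def by (rule sum.swap)
  finally show ?thesis by (simp add: card_cube)
qed

text \<open>The difference of the two averages is an average over pairs from a cube and its parent.
  Enlarging the first factor to the parent makes the Poincare inequality applicable; the cost is a
  factor 2^N, visible in the denominator 2^(j*N) in place of 2^(Suc j * N).\<close>

lemma average_step:
  fixes w :: "('n::finite \<Rightarrow> int) \<Rightarrow> real"
  defines "N \<equiv> CARD('n)"
  shows "\<bar>(\<Sum>y\<in>cube j x. w y) / 2 ^ (j * N) - (\<Sum>y\<in>cube (Suc j) x. w y) / 2 ^ (Suc j * N)\<bar>
    \<le> 2 ^ Suc j / 2 ^ (j * N) * (\<Sum>z\<in>cube (Suc j) x. fgrad w z)"
proof -
  let ?P = "cube j x" and ?Q = "cube (Suc j) x"
  have c: "real (card ?P) = 2 ^ (j * N)" "real (card ?Q) = 2 ^ (Suc j * N)"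
    by (simp_all only: card_cube N_def of_nat_power of_nat_numeral)
  have "(\<Sum>y\<in>?P. w y) / 2 ^ (j * N) - (\<Sum>y\<in>?Q. w y) / 2 ^ (Suc j * N)
      = (\<Sum>u\<in>?P. \<Sum>y\<in>?Q. w u - w y) / (2 ^ (j * N) * 2 ^ (Suc j * N))"
    unfolding sum_subtractf by (simp add: c divide_simps sum_distrib_left[symmetric] del: mult_Suc) 
  also have "\<bar>\<dots>\<bar> \<le> (\<Sum>u\<in>?P. \<Sum>y\<in>?Q. \<bar>w u - w y\<bar>) / (2 ^ (j * N) * 2 ^ (Suc j * N))"
    unfolding abs_divide
    by (intro frac_le order_trans[OF sum_abs] sum_mono) (auto intro!: sum_nonneg)
  also have "\<dots> \<le> (\<Sum>u\<in>?Q. \<Sum>y\<in>?Q. \<bar>w u - w y\<bar>) / (2 ^ (j * N) * 2 ^ (Suc j * N))"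
    using cube_mono[of j "Suc j" x] by (intro divide_right_mono sum_mono2) (auto intro: sum_nonneg)
  also have "\<dots> \<le> (2 ^ Suc j * 2 ^ (Suc j * N) * (\<Sum>z\<in>?Q. fgrad w z)) / (2 ^ (j * N) * 2 ^ (Suc j * N))"
    unfolding N_def by (intro divide_right_mono poincare_cube) auto
  finally show ?thesis by simp
qed

text \<open>Telescoping of averages over nested cubes, starting from \<open>cube 0 x\<close>, which
  is the single point \<open>x\<close>. The average at level \<open>m\<close> remains, since
  \<open>w\<close> is not assumed to vanish anywhere.\<close>

lemma abs_le_potential:
  fixes w :: "('n::finite \<Rightarrow> int) \<Rightarrow> real"
  defines "N \<equiv> CARD('n)"
  shows "\<bar>w x\<bar> \<le> (\<Sum>j<m. 2 ^ Suc j / 2 ^ (j * N) * (\<Sum>z\<in>cube (Suc j) x. fgrad w z))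
    + (\<Sum>y\<in>cube m x. \<bar>w y\<bar>) / 2 ^ (m * N)"
proof -
  have "\<bar>w x\<bar> \<le> (\<Sum>j<m. 2 ^ Suc j / 2 ^ (j * N) * (\<Sum>z\<in>cube (Suc j) x. fgrad w z))
    + \<bar>(\<Sum>y\<in>cube m x. w y) / 2 ^ (m * N)\<bar>"
  proof (induction m)
    case (Suc m)
    have "\<bar>a\<bar> \<le> \<bar>b\<bar> + c" if "\<bar>a - b\<bar> \<le> c" for a b c :: real using that by linarith
    from this[OF average_step[of w m x, folded N_def]] Suc.IH show ?case by simp
  qed simp
  also have "\<bar>(\<Sum>y\<in>cube m x. w y) / 2 ^ (m * N)\<bar> \<le> (\<Sum>y\<in>cube m x. \<bar>w y\<bar>) / 2 ^ (m * N)"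
    by (simp add: abs_divide divide_right_mono)
  finally show ?thesis by simp
qed

text \<open>A dyadic Riesz potential of order one: it dominates \<open>w\<close> by its gradient and turns a measure
  of growth \<open>k\<close> into one of growth \<open>k + 1\<close>, as long as \<open>k + 2\<close> does not exceed the dimension.\<close>

definition potential :: "nat \<Rightarrow> (('n::finite \<Rightarrow> int) \<Rightarrow> real) \<Rightarrow> ('n \<Rightarrow> int) \<Rightarrow> real" where
  "potential m \<mu> z = (\<Sum>j<m. 2 ^ Suc j / 2 ^ (j * CARD('n)) * (\<Sum>x\<in>cube (Suc j) z. \<mu> x))"

lemma potential_nonneg: "(\<And>z. 0 \<le> \<mu> z) \<Longrightarrow> 0 \<le> potential m \<mu> z"
  unfolding potential_def by (intro sum_nonneg mult_nonneg_nonneg) (auto intro: sum_nonneg)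

text \<open>The kernel of the potential is symmetric, so it can be moved from the gradient to \<mu>.
  In the remaining top-level term the mass of a level-\<open>m\<close> cube is bounded by that of
  \<open>G\<close>.\<close>

lemma sum_le_potential:
  fixes w :: "('n::finite \<Rightarrow> int) \<Rightarrow> real"
  assumes G: "saturated m G" and \<mu>: "\<And>z. 0 \<le> \<mu> z"
  shows "(\<Sum>x\<in>G. \<mu> x * \<bar>w x\<bar>)
    \<le> (\<Sum>z\<in>G. potential m \<mu> z * fgrad w z) + (\<Sum>x\<in>G. \<mu> x) / 2 ^ (m * CARD('n)) * (\<Sum>x\<in>G. \<bar>w x\<bar>)"
proof -
  let ?N = "CARD('n)"
  let ?a = "\<lambda>j. 2 ^ Suc j / 2 ^ (j * ?N) :: real"
  have fin: "finite G" using G by (simp add: saturated_def)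
  have "(\<Sum>x\<in>G. \<mu> x * \<bar>w x\<bar>) \<le> (\<Sum>x\<in>G. \<mu> x *
     ((\<Sum>j<m. ?a j * (\<Sum>z\<in>cube (Suc j) x. fgrad w z)) + (\<Sum>y\<in>cube m x. \<bar>w y\<bar>) / 2 ^ (m * ?N)))"
    by (intro sum_mono mult_left_mono abs_le_potential \<mu>)
  also have "\<dots> = (\<Sum>j<m. ?a j * (\<Sum>x\<in>G. \<Sum>z\<in>cube (Suc j) x. \<mu> x * fgrad w z))
     + (\<Sum>x\<in>G. \<Sum>y\<in>cube m x. \<mu> x * \<bar>w y\<bar>) / 2 ^ (m * ?N)"
    unfolding distrib_left sum.distrib sum_distrib_left sum_divide_distrib
    by (subst sum.swap) (simp add: mult_ac sum_distrib_left sum_divide_distrib)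
  also have "(\<Sum>j<m. ?a j * (\<Sum>x\<in>G. \<Sum>z\<in>cube (Suc j) x. \<mu> x * fgrad w z))
     = (\<Sum>j<m. ?a j * (\<Sum>z\<in>G. \<Sum>x\<in>cube (Suc j) z. \<mu> x * fgrad w z))"
    using saturated_mono[OF G] by (intro sum.cong refl arg_cong2[where f = "(*)"] sum_cube_swap) auto
  also have "\<dots> = (\<Sum>z\<in>G. potential m \<mu> z * fgrad w z)"
    unfolding potential_def sum_distrib_left sum_distrib_right
    by (subst sum.swap) (simp add: mult_ac)
  also have "(\<Sum>x\<in>G. \<Sum>y\<in>cube m x. \<mu> x * \<bar>w y\<bar>) = (\<Sum>y\<in>G. \<Sum>x\<in>cube m y. \<mu> x * \<bar>w y\<bar>)"
    by (rule sum_cube_swap[OF G])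
  also have "\<dots> \<le> (\<Sum>y\<in>G. (\<Sum>x\<in>G. \<mu> x) * \<bar>w y\<bar>)"
    unfolding sum_distrib_right[symmetric] using G fin \<mu>
    by (intro sum_mono mult_right_mono sum_mono2) (auto simp: saturated_def)
  finally show ?thesis by (simp add: sum_distrib_left[symmetric] divide_right_mono)
qed

text \<open>Level \<open>j\<close> contributes a multiple of 2^j times the mass, and the geometric
  sum is dominated by the largest scale.\<close>

lemma potential_total:
  fixes \<mu> :: "('n::finite \<Rightarrow> int) \<Rightarrow> real"
  assumes G: "saturated m G" and \<mu>: "\<And>z. 0 \<le> \<mu> z"
  shows "(\<Sum>z\<in>G. potential m \<mu> z) \<le> 2 * 2 ^ CARD('n) * 2 ^ m * (\<Sum>z\<in>G. \<mu> z)"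
proof -
  let ?N = "CARD('n)"
  have "(\<Sum>z\<in>G. potential m \<mu> z)
      = (\<Sum>j<m. 2 ^ Suc j / 2 ^ (j * ?N) * (\<Sum>z\<in>G. \<Sum>x\<in>cube (Suc j) z. \<mu> x))"
    unfolding potential_def by (subst sum.swap) (simp add: sum_distrib_left)
  also have "\<dots> = (\<Sum>j<m. 2 ^ Suc j / 2 ^ (j * ?N) * (2 ^ (Suc j * ?N) * (\<Sum>x\<in>G. \<mu> x)))"
  proof (intro sum.cong refl arg_cong2[where f = "(*)"])
    fix j assume "j \<in> {..<m}"
    then have "saturated (Suc j) G" using saturated_mono[OF G] by auto
    from sum_cube_swap[OF this, of "\<lambda>z x. \<mu> x"]
    show "(\<Sum>z\<in>G. \<Sum>x\<in>cube (Suc j) z. \<mu> x) = 2 ^ (Suc j * ?N) * (\<Sum>x\<in>G. \<mu> x)"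
      by (simp add: card_cube sum_distrib_left del: mult_Suc)
  qed
  also have "\<dots> = 2 ^ ?N * (\<Sum>x\<in>G. \<mu> x) * 2 * (\<Sum>j<m. 2 ^ j)"
    by (simp add: sum_distrib_left power_add mult_ac)
  also have "\<dots> \<le> 2 ^ ?N * (\<Sum>x\<in>G. \<mu> x) * 2 * 2 ^ m"
    proof -
    have "(\<Sum>j<m. 2 ^ j) \<le> (2 ^ m :: real)" by (induction m) auto
    then show ?thesis by (intro mult_left_mono) (auto simp: sum_nonneg \<mu>)
  qed
  finally show ?thesis by (simp add: mult_ac)
qed

text \<open>Scales below \<open>l\<close> see only the mass inside the cube and are handled by
  \<open>potential_total\<close>; this gives the constant 2. Scales from \<open>l\<close> on are
  estimated pointwise by the growth of \<mu>, with a geometrically decaying sum, which gives the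
  constant 1.\<close>

lemma potential_growth:
  fixes \<mu> :: "('n::finite \<Rightarrow> int) \<Rightarrow> real"
  assumes \<mu>: "\<And>z. 0 \<le> \<mu> z" and k: "k + 2 \<le> CARD('n)" and A: "0 \<le> A" and "l \<le> m"
    and growth: "\<And>j z. j \<le> m \<Longrightarrow> (\<Sum>x\<in>cube j z. \<mu> x) \<le> A * 2 ^ (j * k)"
  shows "(\<Sum>x\<in>cube l z. potential m \<mu> x) \<le> 3 * 2 ^ CARD('n) * A * 2 ^ (l * Suc k)"
proof -
  let ?N = "CARD('n)"
  let ?a = "\<lambda>j. 2 ^ Suc j / 2 ^ (j * ?N) :: real"
  have split: "potential m \<mu> x = potential l \<mu> x
      + (\<Sum>j=l..<m. ?a j * (\<Sum>y\<in>cube (Suc j) x. \<mu> y))" for x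
    unfolding potential_def lessThan_atLeast0 using \<open>l \<le> m\<close>
    by (intro sum.atLeastLessThan_concat[symmetric]) auto
  have far: "(\<Sum>j=l..<m. ?a j * (\<Sum>y\<in>cube (Suc j) x. \<mu> y))
      \<le> 2 ^ ?N * A * 2 ^ (l * Suc k) / 2 ^ (l * ?N)" if "x \<in> cube l z" for x
  proof -
    have "?a j * (\<Sum>y\<in>cube (Suc j) x. \<mu> y)
        \<le> 2 ^ ?N * A * 2 ^ (l * Suc k) / 2 ^ (l * ?N) * (1/2) ^ Suc (j - l)"
      if j: "j \<in> {l..<m}" for j
    proof -
      define i where "i = Suc (j - l)"
      \<comment> \<open>\<open>d\<close> is the excess of the dimension over \<open>k + 2\<close>.
        The ratio of consecutive scales is 2^(k+1-N) = (1/2) * 2^(-d); this is where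
        \<open>k + 2 \<le> N\<close> enters.\<close>
      obtain d where d: "?N = Suc k + 1 + d" using k by (metis add_2_eq_Suc' add_Suc_right le_Suc_ex plus_1_eq_Suc add.commute)
      have ji: "Suc j = l + i" using j by (simp add: i_def)
      have "?a j * (\<Sum>y\<in>cube (Suc j) x. \<mu> y) \<le> ?a j * (A * 2 ^ (Suc j * k))"
        using j by (intro mult_left_mono growth) auto
      also have "\<dots> = 2 ^ ?N * A * (2 ^ (Suc j * Suc k) / 2 ^ (Suc j * ?N))"
        by (simp add: power_add field_simps)
      also have "\<dots> = 2 ^ ?N * A * (2 ^ (l * Suc k) / 2 ^ (l * ?N) * (2 ^ (i * Suc k) / 2 ^ (i * ?N)))"
        unfolding ji by (simp add: add_mult_distrib power_add field_simps)
      also have "2 ^ (i * Suc k) / 2 ^ (i * ?N) = (1/2 :: real) ^ i / 2 ^ (i * d)"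
        unfolding d by (simp add: power_add add_mult_distrib2 field_simps power_one_over)
      also have "\<dots> \<le> (1/2) ^ i" by (simp add: field_simps)
      finally show ?thesis using A by (simp add: i_def[symmetric] mult_left_mono divide_right_mono)
    qed
    then have "(\<Sum>j=l..<m. ?a j * (\<Sum>y\<in>cube (Suc j) x. \<mu> y))
        \<le> (\<Sum>j=l..<m. 2 ^ ?N * A * 2 ^ (l * Suc k) / 2 ^ (l * ?N) * (1/2) ^ Suc (j - l))"
      by (rule sum_mono)
    also have "\<dots> = 2 ^ ?N * A * 2 ^ (l * Suc k) / 2 ^ (l * ?N) * (\<Sum>j=l..<m. (1/2) ^ Suc (j - l))"
      by (simp add: sum_distrib_left)
    also have "(\<Sum>j=l..<m. (1/2 :: real) ^ Suc (j - l)) = 1 - (1/2) ^ (m - l)"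
      using \<open>l \<le> m\<close> by (induction m rule: dec_induct) (auto simp: Suc_diff_le)
    also have "\<dots> \<le> 1" by simp
    finally show ?thesis using A by (simp add: mult_left_mono divide_right_mono)
  qed
  have "(\<Sum>x\<in>cube l z. potential l \<mu> x) \<le> 2 * 2 ^ ?N * 2 ^ l * (\<Sum>x\<in>cube l z. \<mu> x)"
    by (intro potential_total saturated_cube \<mu>) simp
  also have "\<dots> \<le> 2 * 2 ^ ?N * 2 ^ l * (A * 2 ^ (l * k))"
    using \<open>l \<le> m\<close> by (intro mult_left_mono growth) auto
  finally have near: "(\<Sum>x\<in>cube l z. potential l \<mu> x) \<le> 2 * 2 ^ ?N * A * 2 ^ (l * Suc k)"
    by (simp add: power_add mult_ac)
  have "(\<Sum>x\<in>cube l z. \<Sum>j=l..<m. ?a j * (\<Sum>y\<in>cube (Suc j) x. \<mu> y))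
      \<le> (\<Sum>x\<in>cube l z. 2 ^ ?N * A * 2 ^ (l * Suc k) / 2 ^ (l * ?N))"
    by (intro sum_mono far)
  also have "\<dots> = 2 ^ ?N * A * 2 ^ (l * Suc k)" by (simp add: card_cube)
  finally show ?thesis using near by (simp add: split sum.distrib)
qed


section \<open>Relative isoperimetry and the boxing inequality\<close>

text \<open>The coarsest balanced cubes containing the points of \<open>A\<close> are automatically disjoint, and each of
  them satisfies a relative isoperimetric inequality.\<close>

definition balanced :: "('n::finite \<Rightarrow> int) set \<Rightarrow> nat \<Rightarrow> ('n \<Rightarrow> int) \<Rightarrow> bool" where
  "balanced A j x \<longleftrightarrow> 2 ^ (j * CARD('n)) \<le> 2 * 2 ^ CARD('n) * real (card (A \<inter> cube j x))
     \<and> 2 * real (card (A \<inter> cube j x)) \<le> 2 ^ (j * CARD('n))"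

lemma balanced_cong: "y \<in> cube j x \<Longrightarrow> balanced A j y = balanced A j x"
  using cube_cong[of y j x] by (simp add: balanced_def)

text \<open>Take the least level at which \<open>A\<close> fills at most half of the cube. It is not
  0, because \<open>cube 0 x\<close> lies in \<open>A\<close>. One level below, the cube was more
  than half full, and passing to the parent lowers the density by a factor of at most 2^N; this is
  the origin of the lower bound in \<open>balanced\<close>.\<close>

lemma balanced_exists:
  fixes x :: "'n::finite \<Rightarrow> int"
  assumes "x \<in> A" and "2 * real (card (A \<inter> cube m x)) \<le> 2 ^ (m * CARD('n))"
  obtains j where "j \<le> m" "balanced A j x"
proof -
  let ?thin = "\<lambda>j. 2 * real (card (A \<inter> cube j x)) \<le> 2 ^ (j * CARD('n))"
  define j where "j = (LEAST j. ?thin j)"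
  have thin: "?thin j" unfolding j_def by (rule LeastI[of ?thin m]) (rule assms(2))
  have "j \<le> m" unfolding j_def by (rule Least_le) (rule assms(2))
  have "j \<noteq> 0"
  proof
    assume "j = 0"
    with thin \<open>x \<in> A\<close> show False by simp
  qed
  then obtain i where i: "j = Suc i" using not0_implies_Suc by blast
  have "\<not> ?thin i" using not_less_Least[of i ?thin] by (auto simp: j_def[symmetric] i)
  moreover have "card (A \<inter> cube i x) \<le> card (A \<inter> cube j x)"
    using cube_mono[of i j x] i by (intro card_mono) auto
  ultimately have "2 ^ (i * CARD('n)) \<le> 2 * real (card (A \<inter> cube j x))" by linarith
  then have "2 ^ CARD('n) * 2 ^ (i * CARD('n)) \<le> 2 ^ CARD('n) * (2 * real (card (A \<inter> cube j x)))"
    by (intro mult_left_mono) auto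
  then have "balanced A j x" using thin by (simp add: balanced_def i power_add mult_ac)
  with \<open>j \<le> m\<close> show ?thesis by (rule that)
qed

lemma sum_indicat_real: "finite Q \<Longrightarrow> (\<Sum>y\<in>Q. indicat_real A y) = card (A \<inter> Q)"
  by (simp add: indicator_def sum.If_cases Int_commute)

text \<open>Poincare inequality for the indicator of \<open>A\<close>. With \<open>a\<close> points
  of \<open>A\<close> among \<open>c\<close>, the sum over pairs is 2a(c - a), which is at least ac
  by the upper density bound; the lower one then compares \<open>a\<close> with
  \<open>c\<close>.\<close>

lemma balanced_isoperimetric:
  fixes x :: "'n::finite \<Rightarrow> int"
  assumes "balanced A j x"
  shows "2 ^ (j * CARD('n)) \<le> 2 * 2 ^ CARD('n) * 2 ^ j * (\<Sum>z\<in>cube j x. fgrad (indicat_real A) z)"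
proof -
  let ?Q = "cube j x" and ?c = "2 ^ (j * CARD('n)) :: real"
  define a where "a = real (card (A \<inter> ?Q))"
  have a: "?c \<le> 2 * 2 ^ CARD('n) * a" "2 * a \<le> ?c"
    using assms by (auto simp: balanced_def a_def)
  have sumA: "(\<Sum>y\<in>?Q. indicat_real A y) = a"
    by (simp add: a_def sum_indicat_real)
  have c: "real (card ?Q) = ?c" by (simp add: card_cube)
  have pos: "0 < ?c" by simp
  have "(\<Sum>u\<in>?Q. \<Sum>y\<in>?Q. \<bar>indicat_real A u - indicat_real A y\<bar>)
      = (\<Sum>u\<in>?Q. \<Sum>y\<in>?Q. indicat_real A u + indicat_real A y
           - 2 * (indicat_real A u * indicat_real A y))"
    by (intro sum.cong refl) (auto simp: indicator_def)
  also have "\<dots> = 2 * a * (?c - a)"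
    by (simp add: sum.distrib sum_subtractf sum_distrib_left[symmetric] sum_distrib_right[symmetric]
          sumA card_cube algebra_simps)
  finally have "2 * a * (?c - a) \<le> 2 ^ j * ?c * (\<Sum>z\<in>?Q. fgrad (indicat_real A) z)"
    using poincare_cube[where w = "indicat_real A" and j = j and c = x] by simp
  moreover have "a * ?c \<le> 2 * a * (?c - a)"
  proof -
    have "0 \<le> a" by (simp add: a_def)
    then have "a * (2 * a) \<le> a * ?c" using a(2) by (intro mult_left_mono)
    then show ?thesis by (simp add: algebra_simps)
  qed
  ultimately have "a * ?c \<le> 2 ^ j * ?c * (\<Sum>z\<in>?Q. fgrad (indicat_real A) z)"
    by linarith
  then have "a * ?c \<le> (2 ^ j * (\<Sum>z\<in>?Q. fgrad (indicat_real A) z)) * ?c"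
    by (simp only: mult_ac)
  then have "a \<le> 2 ^ j * (\<Sum>z\<in>?Q. fgrad (indicat_real A) z)"
    using pos by (rule mult_right_le_imp_le)
  then have "2 * 2 ^ CARD('n) * a \<le> 2 * 2 ^ CARD('n) * (2 ^ j * (\<Sum>z\<in>?Q. fgrad (indicat_real A) z))"
    by (intro mult_left_mono) auto
  then have "2 * 2 ^ CARD('n) * a \<le> 2 * 2 ^ CARD('n) * 2 ^ j * (\<Sum>z\<in>?Q. fgrad (indicat_real A) z)"
    by (simp only: mult.assoc)
  with a(1) show ?thesis by linarith
qed

text \<open>On each chosen cube, growth bounds the mass of \<mu> by a power of the side length, and
  the isoperimetric inequality bounds that power by the perimeter of \<open>A\<close> inside the
  cube. Disjointness allows the perimeters to be added.\<close>

lemma boxing_inequality: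
  fixes \<mu> :: "('n::finite \<Rightarrow> int) \<Rightarrow> real"
  assumes G: "saturated m G" and \<mu>: "\<And>z. 0 \<le> \<mu> z" and B: "0 \<le> B"
    and growth: "\<And>j z. j \<le> m \<Longrightarrow> (\<Sum>x\<in>cube j z. \<mu> x) * 2 ^ j \<le> B * 2 ^ (j * CARD('n))"
  shows "(\<Sum>x\<in>G. \<mu> x * indicat_real A x)
    \<le> 2 * 2 ^ CARD('n) * B * ((\<Sum>z\<in>G. fgrad (indicat_real A) z) + (\<Sum>x\<in>G. indicat_real A x) / 2 ^ m)"
proof -
  let ?N = "CARD('n)"
  have fin: "finite G" and sub: "\<And>z. z \<in> G \<Longrightarrow> cube m z \<subseteq> G"
    using G by (auto simp: saturated_def)
  define A1 where "A1 = {x \<in> G. \<exists>j\<le>m. balanced A j x}"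
  define J where "J x = (GREATEST j. j \<le> m \<and> balanced A j x)" for x
  have J: "J x \<le> m" "balanced A (J x) x" "\<And>j. j \<le> m \<Longrightarrow> balanced A j x \<Longrightarrow> j \<le> J x"
    if "x \<in> A1" for x
  proof -
    have ex: "\<exists>j. j \<le> m \<and> balanced A j x" using that by (auto simp: A1_def)
    have "J x \<le> m \<and> balanced A (J x) x"
      unfolding J_def by (rule GreatestI_ex_nat[OF ex]) auto
    then show "J x \<le> m" "balanced A (J x) x" by auto
    show "j \<le> J x" if "j \<le> m" "balanced A j x" for j
      unfolding J_def by (rule Greatest_le_nat[where b = m]) (use that in auto)
  qed
  define F where "F = (\<lambda>x. cube (J x) x) ` A1"
  \<comment> \<open>Intersecting dyadic cubes are nested. If the cube of \<open>y\<close> were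
    contained in a larger one chosen for \<open>x\<close>, that larger cube would be balanced for
    \<open>y\<close> as well, against the maximality of \<open>J y\<close>.\<close>
  have disj: "cube (J x) x = cube (J y) y" if "x \<in> A1" "y \<in> A1" "z \<in> cube (J x) x" "z \<in> cube (J y) y" for x y z
  proof -
    have *: "J x \<le> J y" if "x \<in> A1" "y \<in> A1" "z \<in> cube (J x) x" "z \<in> cube (J y) y" for x y
    proof (rule ccontr)
      assume "\<not> J x \<le> J y"
      then have "z \<in> cube (J x) y" using cube_mono[of "J y" "J x" y] that by auto
      then have "y \<in> cube (J x) x" using that(3) cube_cong cube_sym by metis
      then have "balanced A (J x) y" using balanced_cong J(2)[OF that(1)] by blast
      then have "J x \<le> J y" using J(3)[OF that(2)] J(1)[OF that(1)] by blast
      with \<open>\<not> J x \<le> J y\<close> show False by simp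
    qed
    have "J x = J y" using *[of x y] *[of y x] that by simp
    then show ?thesis using that(3,4) cube_cong by metis
  qed
  have disjoint: "\<forall>P\<in>F. \<forall>Q\<in>F. P \<noteq> Q \<longrightarrow> P \<inter> Q = {}"
  proof (intro ballI impI equals0I)
    fix P Q z assume "P \<in> F" "Q \<in> F" "P \<noteq> Q" "z \<in> P \<inter> Q"
    then show False using disj unfolding F_def by blast
  qed
  have UF: "A1 \<subseteq> \<Union>F" "\<Union>F \<subseteq> G"
  proof -
    show "A1 \<subseteq> \<Union>F" unfolding F_def using cube_self by blast
    show "\<Union>F \<subseteq> G"
    proof
      fix y assume "y \<in> \<Union>F"
      then obtain x where x: "x \<in> A1" "y \<in> cube (J x) x" by (auto simp: F_def)
      then have "y \<in> cube m x" using cube_mono[OF J(1)[OF x(1)]] by blast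
      moreover have "x \<in> G" using x by (simp add: A1_def)
      ultimately show "y \<in> G" using sub by blast
    qed
  qed
  have one: "(\<Sum>x\<in>Q. \<mu> x) \<le> 2 * 2 ^ ?N * B * (\<Sum>z\<in>Q. fgrad (indicat_real A) z)" if Q: "Q \<in> F" for Q
  proof -
    obtain x where x: "x \<in> A1" "Q = cube (J x) x" using Q unfolding F_def by blast
    have "(\<Sum>x\<in>Q. \<mu> x) * 2 ^ J x \<le> B * 2 ^ (J x * ?N)"
      unfolding x(2) by (rule growth) (rule J(1)[OF x(1)])
    also have "\<dots> \<le> B * (2 * 2 ^ ?N * 2 ^ J x * (\<Sum>z\<in>Q. fgrad (indicat_real A) z))"
      unfolding x(2) by (intro mult_left_mono balanced_isoperimetric J x B)
    finally have "(\<Sum>x\<in>Q. \<mu> x) * 2 ^ J x \<le> (2 * 2 ^ ?N * B * (\<Sum>z\<in>Q. fgrad (indicat_real A) z)) * 2 ^ J x"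
      by (simp add: mult_ac)
    then show ?thesis by (rule mult_right_le_imp_le) simp
  qed
  have finQ: "\<forall>Q\<in>F. finite Q" by (auto simp: F_def)
  have "(\<Sum>x\<in>A1. \<mu> x) \<le> (\<Sum>x\<in>\<Union>F. \<mu> x)"
    using UF finite_subset[OF UF(2) fin] \<mu> by (intro sum_mono2) auto
  also have "\<dots> = (\<Sum>Q\<in>F. \<Sum>x\<in>Q. \<mu> x)" using sum.Union_disjoint[OF finQ disjoint, of \<mu>] by simp
  also have "\<dots> \<le> (\<Sum>Q\<in>F. 2 * 2 ^ ?N * B * (\<Sum>z\<in>Q. fgrad (indicat_real A) z))"
    by (intro sum_mono one)
  also have "\<dots> = 2 * 2 ^ ?N * B * (\<Sum>z\<in>\<Union>F. fgrad (indicat_real A) z)"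
    using sum.Union_disjoint[OF finQ disjoint, of "fgrad (indicat_real A)"] by (simp add: sum_distrib_left)
  also have "\<dots> \<le> 2 * 2 ^ ?N * B * (\<Sum>z\<in>G. fgrad (indicat_real A) z)"
    using UF fin B by (intro mult_left_mono sum_mono2) (auto simp: fgrad_nonneg)
  finally have part1: "(\<Sum>x\<in>A1. \<mu> x) \<le> 2 * 2 ^ ?N * B * (\<Sum>z\<in>G. fgrad (indicat_real A) z)" .
  \<comment> \<open>A point of \<open>A\<close> without a balanced cube up to level \<open>m\<close>
    sees density above 1/2 in its level-\<open>m\<close> cube, so its indicator is at most twice
    that density. Interchanging the sums turns this into the zero-order term.\<close>
  have dense: "1 \<le> 2 * (\<Sum>y\<in>cube m x. indicat_real A y) / 2 ^ (m * ?N)" if "x \<in> G" "x \<in> A" "x \<notin> A1" for x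
  proof -
    have "\<not> 2 * real (card (A \<inter> cube m x)) \<le> 2 ^ (m * ?N)"
      using balanced_exists[OF that(2), of m] that by (auto simp: A1_def)
    then show ?thesis by (simp add: sum_indicat_real field_simps)
  qed
  have "(\<Sum>x\<in>G. \<mu> x * indicat_real A x) \<le> (\<Sum>x\<in>G. \<mu> x * indicat_real A1 x
      + \<mu> x * (2 * (\<Sum>y\<in>cube m x. indicat_real A y) / 2 ^ (m * ?N)))"
  proof (intro sum_mono)
    fix x assume x: "x \<in> G"
    have nn: "0 \<le> 2 * (\<Sum>y\<in>cube m x. indicat_real A y) / 2 ^ (m * ?N)"
      by (intro divide_nonneg_nonneg mult_nonneg_nonneg sum_nonneg) auto
    have "indicat_real A x \<le> indicat_real A1 x + 2 * (\<Sum>y\<in>cube m x. indicat_real A y) / 2 ^ (m * ?N)"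
      using dense[OF x] nn by (cases "x \<in> A"; cases "x \<in> A1") auto
    then have "\<mu> x * indicat_real A x \<le> \<mu> x * (indicat_real A1 x + 2 * (\<Sum>y\<in>cube m x. indicat_real A y) / 2 ^ (m * ?N))"
      by (intro mult_left_mono \<mu>)
    then show "\<mu> x * indicat_real A x \<le> \<mu> x * indicat_real A1 x
      + \<mu> x * (2 * (\<Sum>y\<in>cube m x. indicat_real A y) / 2 ^ (m * ?N))"
      by (simp only: distrib_left)
  qed
  also have "\<dots> = (\<Sum>x\<in>A1. \<mu> x)
      + 2 / 2 ^ (m * ?N) * (\<Sum>x\<in>G. \<Sum>y\<in>cube m x. \<mu> x * indicat_real A y)"
  proof -
    have "(\<Sum>x\<in>G. \<mu> x * indicat_real A1 x) = (\<Sum>x\<in>G. if x \<in> A1 then \<mu> x else 0)"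
      by (intro sum.cong) (auto simp: indicator_def)
    also have "\<dots> = (\<Sum>x\<in>G \<inter> A1. \<mu> x)" by (rule sum.inter_restrict[OF fin, symmetric])
    also have "G \<inter> A1 = A1" by (auto simp: A1_def)
    finally show ?thesis
      by (simp add: sum.distrib sum_distrib_left mult_ac)
  qed
  also have "(\<Sum>x\<in>G. \<Sum>y\<in>cube m x. \<mu> x * indicat_real A y)
      = (\<Sum>y\<in>G. (\<Sum>x\<in>cube m y. \<mu> x) * indicat_real A y)"
    by (subst sum_cube_swap[OF G]) (simp add: sum_distrib_right)
  also have "2 / 2 ^ (m * ?N) * \<dots> \<le> 2 / 2 ^ (m * ?N) * (\<Sum>y\<in>G. B * 2 ^ (m * ?N) / 2 ^ m * indicat_real A y)"
    using growth[of m] by (intro mult_left_mono sum_mono mult_right_mono) (auto simp: field_simps)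
  also have "\<dots> = 2 * B * ((\<Sum>x\<in>G. indicat_real A x) / 2 ^ m)"
    unfolding sum_distrib_left[symmetric] by (simp add: field_simps)
  also have "\<dots> \<le> 2 * 2 ^ ?N * B * ((\<Sum>x\<in>G. indicat_real A x) / 2 ^ m)"
    using B by (intro mult_right_mono) (auto intro!: sum_nonneg divide_nonneg_nonneg mult_left_mono)
  finally show ?thesis using part1 by (simp add: distrib_left)
qed


section \<open>Discrete coarea formula and Maz'ya's inequality\<close>

text \<open>A discrete coarea formula: peeling off the lowest positive level set preserves the
  differences on both sides.\<close>

lemma coarea_induct:
  fixes u :: "'a \<Rightarrow> real"
  assumes "finite X" and u: "\<And>x. 0 \<le> u x"
    and zero: "P (\<lambda>x. 0)"
    and cong: "\<And>f g. (\<And>x. x \<in> X \<Longrightarrow> f x = g x) \<Longrightarrow> P f \<Longrightarrow> P g"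
    and level: "\<And>c A f. 0 < (c :: real) \<Longrightarrow> (\<And>x. 0 \<le> f x) \<Longrightarrow> (\<And>x. 0 < f x \<Longrightarrow> x \<in> A) \<Longrightarrow> P f
      \<Longrightarrow> P (\<lambda>x. c * indicat_real A x + f x)"
  shows "P u"
  using u
proof (induction "card (u ` X - {0})" arbitrary: u rule: less_induct)
  case less
  have fin: "finite (u ` X - {0})" using \<open>finite X\<close> by simp
  show ?case
  proof (cases "u ` X - {0} = {}")
    case True
    then have "u x = 0" if "x \<in> X" for x using that by blast
    then show ?thesis using cong[OF _ zero, of u] by simp
  next
    case False
    define c where "c = Min (u ` X - {0})"
    have c: "c \<in> u ` X - {0}" unfolding c_def using fin False by (rule Min_in)
    then have "0 < c" using less.prems by (auto simp: less_le)
    define f where "f x = max 0 (u x - c)" for x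
    have "f ` X - {0} \<subseteq> (\<lambda>t. t - c) ` (u ` X - {0} - {c})"
      using \<open>0 < c\<close> by (auto simp: f_def max_def)
    then have "card (f ` X - {0}) \<le> card ((\<lambda>t. t - c) ` (u ` X - {0} - {c}))"
      using fin by (intro card_mono) auto
    also have "\<dots> \<le> card (u ` X - {0} - {c})" using fin by (intro card_image_le) auto
    also have "\<dots> < card (u ` X - {0})" using fin c by (intro psubset_card_mono) auto
    finally have "P f" by (rule less.hyps) (simp add: f_def)
    moreover have "0 < u x" if "0 < f x" for x using that \<open>0 < c\<close> by (auto simp: f_def max_def split: if_splits)
    moreover have "0 \<le> f x" for x by (simp add: f_def)
    ultimately have "P (\<lambda>x. c * indicat_real {x. 0 < u x} x + f x)"
      using \<open>0 < c\<close> by (intro level[of c f "{x. 0 < u x}"]) auto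
    moreover have "c * indicat_real {x. 0 < u x} x + f x = u x" if "x \<in> X" for x
    proof (cases "u x = 0")
      case True
      then show ?thesis using \<open>0 < c\<close> by (simp add: f_def)
    next
      case False
      then have "c \<le> u x" unfolding c_def using fin that by (intro Min_le) auto
      then show ?thesis using \<open>0 < c\<close> by (simp add: f_def)
    qed
    ultimately show ?thesis by (rule cong[rotated])
  qed
qed

text \<open>\<open>f\<close> vanishes off \<open>A\<close>, so the differences of the layer and of
  \<open>f\<close> never have opposite signs. Equality matters: the triangle inequality alone would
  bound the gradient of the sum from the wrong side.\<close>

lemma abs_diff_level:
  fixes f :: "'a \<Rightarrow> real" and c :: real
  assumes "0 < c" and "\<And>x. 0 \<le> f x" and "\<And>x. 0 < f x \<Longrightarrow> x \<in> A"
  shows "\<bar>(c * indicat_real A x + f x) - (c * indicat_real A y + f y)\<bar>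
    = c * \<bar>indicat_real A x - indicat_real A y\<bar> + \<bar>f x - f y\<bar>"
proof -
  have "f z = 0" if "z \<notin> A" for z using assms(2)[of z] assms(3)[of z] that by linarith
  then show ?thesis
    using assms(1) assms(2)[of x] assms(2)[of y] by (cases "x \<in> A"; cases "y \<in> A") auto
qed

text \<open>Both sides are additive over the layers produced by \<open>coarea_induct\<close>, and a
  single layer is the boxing inequality. A constant \<open>u\<close> has zero gradient, which
  explains the zero-order term.\<close>

lemma mazya_inequality:
  fixes \<mu> :: "('n::finite \<Rightarrow> int) \<Rightarrow> real"
  assumes G: "saturated m G" and \<mu>: "\<And>z. 0 \<le> \<mu> z" and B: "0 \<le> B"
    and growth: "\<And>j z. j \<le> m \<Longrightarrow> (\<Sum>x\<in>cube j z. \<mu> x) * 2 ^ j \<le> B * 2 ^ (j * CARD('n))"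
    and u: "\<And>x. 0 \<le> u x"
  shows "(\<Sum>x\<in>G. \<mu> x * u x)
    \<le> 2 * 2 ^ CARD('n) * B * ((\<Sum>z\<in>G. fgrad u z) + (\<Sum>x\<in>G. u x) / 2 ^ m)"
proof -
  let ?K = "2 * 2 ^ CARD('n) * B"
  \<comment> \<open>\<open>fgrad\<close> on \<open>G\<close> also reads the forward neighbours of
    \<open>G\<close>, so the finite set on which the levels of \<open>u\<close> are counted has to
    contain them.\<close>
  define X where "X = G \<union> (\<Union>i. (\<lambda>z. z(i := z i + 1)) ` G)"
  have "finite X" using G by (auto simp: X_def saturated_def)
  from this u show ?thesis
  proof (rule coarea_induct)
    show "(\<Sum>x\<in>G. \<mu> x * 0) \<le> ?K * ((\<Sum>z\<in>G. fgrad (\<lambda>x. 0) z) + (\<Sum>x\<in>G. 0) / 2 ^ m)"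
      by (simp add: fgrad_def fdiff_def)
  next
    fix f g :: "('n \<Rightarrow> int) \<Rightarrow> real"
    assume eq: "\<And>x. x \<in> X \<Longrightarrow> f x = g x"
      and f: "(\<Sum>x\<in>G. \<mu> x * f x) \<le> ?K * ((\<Sum>z\<in>G. fgrad f z) + (\<Sum>x\<in>G. f x) / 2 ^ m)"
    have fg: "f x = g x" if "x \<in> G" for x using that eq by (simp add: X_def)
    have fg': "f (x(i := x i + 1)) = g (x(i := x i + 1))" if "x \<in> G" for x i
      using that by (intro eq) (auto simp: X_def)
    have "(\<Sum>x\<in>G. \<mu> x * f x) = (\<Sum>x\<in>G. \<mu> x * g x)" "(\<Sum>x\<in>G. f x) = (\<Sum>x\<in>G. g x)"
      "(\<Sum>z\<in>G. fgrad f z) = (\<Sum>z\<in>G. fgrad g z)"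
      unfolding fgrad_def fdiff_def by (intro sum.cong refl; simp add: fg fg')+
    with f show "(\<Sum>x\<in>G. \<mu> x * g x) \<le> ?K * ((\<Sum>z\<in>G. fgrad g z) + (\<Sum>x\<in>G. g x) / 2 ^ m)"
      by simp
  next
    fix c :: real and A and f :: "('n \<Rightarrow> int) \<Rightarrow> real"
    assume c: "0 < c" and f: "\<And>x. 0 \<le> f x" "\<And>x. 0 < f x \<Longrightarrow> x \<in> A"
      and IH: "(\<Sum>x\<in>G. \<mu> x * f x) \<le> ?K * ((\<Sum>z\<in>G. fgrad f z) + (\<Sum>x\<in>G. f x) / 2 ^ m)"
    let ?h = "\<lambda>x. c * indicat_real A x + f x"
    have grad: "fgrad ?h z = c * fgrad (indicat_real A) z + fgrad f z" for z
    proof -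
      have "\<bar>fdiff i ?h z\<bar> = c * \<bar>fdiff i (indicat_real A) z\<bar> + \<bar>fdiff i f z\<bar>" for i
        unfolding fdiff_def by (rule abs_diff_level[OF c f])
      then show ?thesis by (simp add: fgrad_def sum.distrib sum_distrib_left)
    qed
    have "(\<Sum>x\<in>G. \<mu> x * ?h x) = c * (\<Sum>x\<in>G. \<mu> x * indicat_real A x) + (\<Sum>x\<in>G. \<mu> x * f x)"
      by (simp add: distrib_left sum.distrib sum_distrib_left mult_ac)
    also have "\<dots> \<le> c * (?K * ((\<Sum>z\<in>G. fgrad (indicat_real A) z) + (\<Sum>x\<in>G. indicat_real A x) / 2 ^ m))
        + ?K * ((\<Sum>z\<in>G. fgrad f z) + (\<Sum>x\<in>G. f x) / 2 ^ m)"
      using c by (intro add_mono mult_left_mono boxing_inequality[OF G \<mu> B growth] IH) auto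
    also have "\<dots> = ?K * ((\<Sum>z\<in>G. fgrad ?h z) + (\<Sum>x\<in>G. ?h x) / 2 ^ m)"
      unfolding grad sum.distrib sum_distrib_left[symmetric]
      by (simp add: add_divide_distrib algebra_simps)
    finally show "(\<Sum>x\<in>G. \<mu> x * ?h x) \<le> ?K * ((\<Sum>z\<in>G. fgrad ?h z) + (\<Sum>x\<in>G. ?h x) / 2 ^ m)" .
  qed
qed

text \<open>Cutting \<open>\<bar>w\<bar>\<close> at height \<open>M\<close> confines the right-hand side to a superlevel set, which is small
  uniformly in the mesh size.\<close>

lemma mazya_truncated:
  fixes \<mu> :: "('n::finite \<Rightarrow> int) \<Rightarrow> real"
  assumes G: "saturated m G" and \<mu>: "\<And>z. 0 \<le> \<mu> z" and B: "0 \<le> B" and M: "0 \<le> M"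
    and growth: "\<And>j z. j \<le> m \<Longrightarrow> (\<Sum>x\<in>cube j z. \<mu> x) * 2 ^ j \<le> B * 2 ^ (j * CARD('n))"
  shows "(\<Sum>x\<in>G. \<mu> x * \<bar>w x\<bar>) \<le> M * (\<Sum>x\<in>G. \<mu> x)
    + 2 * 2 ^ CARD('n) * B *
      ((\<Sum>i\<in>UNIV. \<Sum>z | z \<in> G \<and> (M < \<bar>w z\<bar> \<or> M < \<bar>w (z(i := z i + 1))\<bar>). \<bar>fdiff i w z\<bar>)
       + (\<Sum>z | z \<in> G \<and> M < \<bar>w z\<bar>. \<bar>w z\<bar>) / 2 ^ m)"
proof -
  let ?K = "2 * 2 ^ CARD('n) * B"
  have fin: "finite G" using G by (simp add: saturated_def)
  define u where "u x = max 0 (\<bar>w x\<bar> - M)" for x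
  \<comment> \<open>Truncation is 1-Lipschitz and is 0 on values up to \<open>M\<close>, so a
    difference survives only if one of its two endpoints exceeds \<open>M\<close>.\<close>
  have trunc: "\<bar>max 0 (\<bar>a\<bar> - M) - max 0 (\<bar>b\<bar> - M)\<bar> \<le> (if M < \<bar>b\<bar> \<or> M < \<bar>a\<bar> then \<bar>a - b\<bar> else 0)" for a b
  proof -
    have "\<bar>max 0 p - max 0 q\<bar> \<le> \<bar>p - q\<bar>" for p q :: real by (auto simp: max_def)
    from this[of "\<bar>a\<bar> - M" "\<bar>b\<bar> - M"] show ?thesis using abs_triangle_ineq3[of a b] by auto
  qed
  have "(\<Sum>x\<in>G. \<mu> x * \<bar>w x\<bar>) \<le> (\<Sum>x\<in>G. M * \<mu> x + \<mu> x * u x)"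
  proof (intro sum_mono)
    fix x
    have "\<mu> x * \<bar>w x\<bar> \<le> \<mu> x * (M + u x)" by (intro mult_left_mono \<mu>) (simp add: u_def)
    then show "\<mu> x * \<bar>w x\<bar> \<le> M * \<mu> x + \<mu> x * u x" by (simp add: algebra_simps)
  qed
  also have "\<dots> = M * (\<Sum>x\<in>G. \<mu> x) + (\<Sum>x\<in>G. \<mu> x * u x)"
    by (simp add: sum.distrib sum_distrib_left)
  finally have 1: "(\<Sum>x\<in>G. \<mu> x * \<bar>w x\<bar>) \<le> M * (\<Sum>x\<in>G. \<mu> x) + (\<Sum>x\<in>G. \<mu> x * u x)" .
  have 2: "(\<Sum>x\<in>G. \<mu> x * u x) \<le> ?K * ((\<Sum>z\<in>G. fgrad u z) + (\<Sum>x\<in>G. u x) / 2 ^ m)"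
    by (intro mazya_inequality[OF G \<mu> B growth]) (simp_all add: u_def)
  have "(\<Sum>z\<in>G. fgrad u z) = (\<Sum>i\<in>UNIV. \<Sum>z\<in>G. \<bar>fdiff i u z\<bar>)"
    unfolding fgrad_def by (rule sum.swap)
  also have "\<dots> \<le> (\<Sum>i\<in>UNIV. \<Sum>z\<in>G. if M < \<bar>w z\<bar> \<or> M < \<bar>w (z(i := z i + 1))\<bar> then \<bar>fdiff i w z\<bar> else 0)"
    unfolding u_def fdiff_def by (intro sum_mono trunc)
  also have "\<dots> = (\<Sum>i\<in>UNIV. \<Sum>z | z \<in> G \<and> (M < \<bar>w z\<bar> \<or> M < \<bar>w (z(i := z i + 1))\<bar>). \<bar>fdiff i w z\<bar>)" (is "_ = ?S")
    by (simp only: sum.inter_filter[OF fin])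
  finally have 3: "(\<Sum>z\<in>G. fgrad u z) \<le> ?S" .
  have "(\<Sum>x\<in>G. u x) \<le> (\<Sum>z\<in>G. if M < \<bar>w z\<bar> then \<bar>w z\<bar> else 0)"
  proof (intro sum_mono)
    show "u x \<le> (if M < \<bar>w x\<bar> then \<bar>w x\<bar> else 0)" for x
      using M unfolding u_def by (cases "M < \<bar>w x\<bar>") simp_all
  qed
  also have "\<dots> = (\<Sum>z | z \<in> G \<and> M < \<bar>w z\<bar>. \<bar>w z\<bar>)" (is "_ = ?T")
    by (simp only: sum.inter_filter[OF fin])
  finally have 4: "(\<Sum>x\<in>G. u x) \<le> ?T" .
  have "?K * ((\<Sum>z\<in>G. fgrad u z) + (\<Sum>x\<in>G. u x) / 2 ^ m) \<le> ?K * (?S + ?T / 2 ^ m)"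
    using B by (intro mult_left_mono add_mono divide_right_mono 3 4) simp_all
  with 1 2 show ?thesis by linarith
qed

subsection \<open>Uniform estimates over all mesh sizes\<close>

lemma uniform_choice:
  fixes P :: "'i::finite \<Rightarrow> real \<Rightarrow> bool"
  assumes "\<And>i. \<exists>\<delta>>0. P i \<delta>" and "\<And>i \<delta> \<delta>'. P i \<delta> \<Longrightarrow> \<delta>' \<le> \<delta> \<Longrightarrow> P i \<delta>'"
  obtains \<delta> where "\<delta> > 0" "\<And>i. P i \<delta>"
proof -
  obtain d where d: "\<And>i. d i > 0" "\<And>i. P i (d i)" using assms(1) by metis
  show ?thesis
  proof (rule that)
    show "0 < Min (range d)" using d(1) by (subst Min_gr_iff) auto
    show "P i (Min (range d))" for i using assms(2)[OF d(2)] by simp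
  qed
qed

text \<open>\<open>f m\<close> lives on the lattice of mesh \<open>2^-m\<close>. After rescaling, its difference quotients are
  bounded in \<open>L\<^sup>1\<close> and uniformly integrable, uniformly in \<open>m\<close>.\<close>

locale lattice_family =
  fixes f :: "nat \<Rightarrow> ('n::finite \<Rightarrow> int) \<Rightarrow> real"
  assumes bounded: "length is \<le> CARD('n) \<Longrightarrow> \<exists>C. \<forall>m A. finite A \<longrightarrow>
      (\<Sum>z\<in>A. \<bar>fdiffs is (f m) z\<bar>) * 2 ^ (m * length is) \<le> C * 2 ^ (m * CARD('n))"
    and uniformly_integrable: "length is \<le> CARD('n) \<Longrightarrow> \<epsilon> > 0 \<Longrightarrow> \<exists>\<eta>>0. \<forall>m A. finite A \<longrightarrow>
      real (card A) \<le> \<eta> * 2 ^ (m * CARD('n)) \<longrightarrow>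
      (\<Sum>z\<in>A. \<bar>fdiffs is (f m) z\<bar>) * 2 ^ (m * length is) \<le> \<epsilon> * 2 ^ (m * CARD('n))"
begin

text \<open>In lattice units the unit cube has side 2^m. Rescaled, \<open>K\<close> is a growth
  constant of exponent \<open>k\<close> and \<delta> a total mass, both independent of
  \<open>m\<close>; when \<open>length is = k\<close>, the factors 2^(m*k) of the mass and of the
  difference quotients cancel in the conclusion.\<close>

definition controls :: "real \<Rightarrow> nat \<Rightarrow> 'n list \<Rightarrow> real \<Rightarrow> real \<Rightarrow> bool" where
  "controls K k is \<epsilon> \<delta> \<longleftrightarrow> (\<forall>m \<mu> G. saturated m G \<longrightarrow> (\<forall>z. 0 \<le> \<mu> z) \<longrightarrow>
     (\<forall>j\<le>m. \<forall>z. (\<Sum>x\<in>cube j z. \<mu> x) \<le> K * 2 ^ (j * k)) \<longrightarrow>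
     (\<Sum>x\<in>G. \<mu> x) \<le> \<delta> * 2 ^ (m * k) \<longrightarrow>
     (\<Sum>x\<in>G. \<mu> x * \<bar>fdiffs is (f m) x\<bar>) \<le> \<epsilon>)"

lemma controlsD:
  assumes "controls K k is \<epsilon> \<delta>" "saturated m G" "\<And>z. 0 \<le> \<mu> z"
    "\<And>j z. j \<le> m \<Longrightarrow> (\<Sum>x\<in>cube j z. \<mu> x) \<le> K * 2 ^ (j * k)"
    "(\<Sum>x\<in>G. \<mu> x) \<le> \<delta> * 2 ^ (m * k)"
  shows "(\<Sum>x\<in>G. \<mu> x * \<bar>fdiffs is (f m) x\<bar>) \<le> \<epsilon>"
  using assms unfolding controls_def by blast

lemma controls_mono: "controls K k is \<epsilon> \<delta> \<Longrightarrow> \<delta>' \<le> \<delta> \<Longrightarrow> controls K k is \<epsilon> \<delta>'"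
  unfolding controls_def by (meson mult_right_mono order_trans zero_le_numeral zero_le_power)

lemma bound_pos:
  assumes "length is \<le> CARD('n)"
  obtains C where "C > 0" "\<And>m A. finite A \<Longrightarrow>
      (\<Sum>z\<in>A. \<bar>fdiffs is (f m) z\<bar>) * 2 ^ (m * length is) \<le> C * 2 ^ (m * CARD('n))"
proof -
  obtain C where C: "\<And>m A. finite A \<Longrightarrow>
      (\<Sum>z\<in>A. \<bar>fdiffs is (f m) z\<bar>) * 2 ^ (m * length is) \<le> C * 2 ^ (m * CARD('n))"
    using bounded[OF assms] by blast
  show ?thesis
  proof (rule that[of "max C 1"])
    fix m and A :: "('n \<Rightarrow> int) set"
    assume "finite A"
    have "C * 2 ^ (m * CARD('n)) \<le> max C 1 * 2 ^ (m * CARD('n))" by (intro mult_right_mono) auto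
    with C[OF \<open>finite A\<close>, of m]
    show "(\<Sum>z\<in>A. \<bar>fdiffs is (f m) z\<bar>) * 2 ^ (m * length is) \<le> max C 1 * 2 ^ (m * CARD('n))" by linarith
  qed simp
qed

lemma card_superlevel:
  fixes u :: "'a \<Rightarrow> real"
  assumes "finite G" and "\<And>x. x \<in> G \<Longrightarrow> 0 \<le> u x"
  shows "t * card {x \<in> G. t < u x} \<le> (\<Sum>x\<in>G. u x)"
proof -
  have "t * card {x \<in> G. t < u x} = (\<Sum>x | x \<in> G \<and> t < u x. t)" by simp
  also have "\<dots> \<le> (\<Sum>x | x \<in> G \<and> t < u x. u x)" by (intro sum_mono) auto
  also have "\<dots> \<le> (\<Sum>x\<in>G. u x)" using assms by (intro sum_mono2) auto
  finally show ?thesis .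
qed

text \<open>Large values of \<open>\<mu>\<close> occur on a small set by Chebyshev's inequality.\<close>

lemma controls_top:
  assumes len: "length is = CARD('n)" and "K \<ge> 0" "\<epsilon> > 0"
  shows "\<exists>\<delta>>0. controls K CARD('n) is \<epsilon> \<delta>"
proof -
  obtain C where C: "C > 0" "\<And>m A. finite A \<Longrightarrow>
      (\<Sum>z\<in>A. \<bar>fdiffs is (f m) z\<bar>) * 2 ^ (m * length is) \<le> C * 2 ^ (m * CARD('n))"
    using bound_pos[of "is"] len by auto
  \<comment> \<open>\<epsilon> is split evenly: where \<mu> is at most \<open>t\<close>, the L^1
    bound \<open>C\<close> suffices; the exceptional set costs at most \<open>K * e\<close>. The
    \<open>K + 1\<close> in \<open>e\<close> keeps the division meaningful for
    \<open>K = 0\<close>.\<close>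
  define t where "t = \<epsilon> / (2 * C)"
  have t: "t > 0" using C assms by (simp add: t_def)
  define e where "e = \<epsilon> / (2 * (K + 1))"
  have e: "e > 0" "K * e \<le> \<epsilon> / 2" using assms by (auto simp: e_def field_simps)
  obtain \<eta> where \<eta>: "\<eta> > 0" "\<And>m A. finite A \<Longrightarrow> real (card A) \<le> \<eta> * 2 ^ (m * CARD('n)) \<Longrightarrow>
      (\<Sum>z\<in>A. \<bar>fdiffs is (f m) z\<bar>) * 2 ^ (m * length is) \<le> e * 2 ^ (m * CARD('n))"
    using uniformly_integrable[of "is" e] len e by auto
  have "controls K CARD('n) is \<epsilon> (\<eta> * t)"
    unfolding controls_def
  proof (intro allI impI)
    fix m and \<mu> :: "('n \<Rightarrow> int) \<Rightarrow> real" and G :: "('n \<Rightarrow> int) set"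
    assume sat: "saturated m G" and \<mu>: "\<forall>z. 0 \<le> \<mu> z"
      and growth: "\<forall>j\<le>m. \<forall>z. (\<Sum>x\<in>cube j z. \<mu> x) \<le> K * 2 ^ (j * CARD('n))"
      and total: "(\<Sum>x\<in>G. \<mu> x) \<le> \<eta> * t * 2 ^ (m * CARD('n))"
    let ?w = "\<lambda>x. \<bar>fdiffs is (f m) x\<bar>"
    have fin: "finite G" using sat by (simp add: saturated_def)
    \<comment> \<open>Growth at level 0, where cubes are points, is a pointwise bound.\<close>
    have muK: "\<mu> z \<le> K" for z using growth[rule_format, of 0 z] by simp
    let ?H = "{x \<in> G. t < \<mu> x}"
    have "t * card ?H \<le> t * (\<eta> * 2 ^ (m * CARD('n)))"
      using card_superlevel[OF fin, of \<mu> t] \<mu> total by (simp add: mult_ac)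
    then have "real (card ?H) \<le> \<eta> * 2 ^ (m * CARD('n))" using t by simp
    then have high: "(\<Sum>x\<in>?H. ?w x) \<le> e" using \<eta>(2)[of ?H m] fin len by simp
    have low: "(\<Sum>x\<in>G. ?w x) \<le> C" using C(2)[OF fin, of m] len by simp
    have "(\<Sum>x\<in>G. \<mu> x * ?w x) \<le> (\<Sum>x\<in>G. t * ?w x + (if t < \<mu> x then K * ?w x else 0))"
    proof (intro sum_mono)
      fix x
      show "\<mu> x * ?w x \<le> t * ?w x + (if t < \<mu> x then K * ?w x else 0)"
      proof (cases "t < \<mu> x")
        case True
        have "\<mu> x * ?w x \<le> K * ?w x" by (intro mult_right_mono muK) simp
        moreover have "0 \<le> t * ?w x" using t by simp
        ultimately show ?thesis using True by simp
      qed (auto intro: mult_right_mono)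
    qed
    also have "\<dots> = t * (\<Sum>x\<in>G. ?w x) + K * (\<Sum>x\<in>?H. ?w x)"
      unfolding sum.distrib sum.inter_filter[OF fin, symmetric] by (simp add: sum_distrib_left)
    also have "\<dots> \<le> t * C + K * e"
      using t assms by (intro add_mono mult_left_mono high low) auto
    also have "\<dots> \<le> \<epsilon>" using e(2) C(1) by (simp add: t_def)
    finally show "(\<Sum>x\<in>G. \<mu> x * ?w x) \<le> \<epsilon>" .
  qed
  then show ?thesis using \<eta> t by (intro exI[of _ "\<eta> * t"]) auto
qed

text \<open>The part of the differences up to height \<open>M\<close> is paid for by the small mass
  of \<mu>. The part above lives on few points, and there the differences of order
  \<open>k + 1\<close> and \<open>k\<close> are small by uniform integrability; Maz'ya's inequality
  reduces it to them.\<close>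

lemma controls_pretop:
  assumes len: "length is = k" and k: "Suc k = CARD('n)" and "K \<ge> 0" "\<epsilon> > 0"
  shows "\<exists>\<delta>>0. controls K k is \<epsilon> \<delta>"
proof -
  obtain C where C: "C > 0" "\<And>m A. finite A \<Longrightarrow>
      (\<Sum>z\<in>A. \<bar>fdiffs is (f m) z\<bar>) * 2 ^ (m * length is) \<le> C * 2 ^ (m * CARD('n))"
    using bound_pos[of "is"] len k by auto
  have mN: "(2::real) ^ (m * CARD('n)) = 2 ^ (m * k) * 2 ^ m" for m
    unfolding k[symmetric] by (simp add: power_add)
  define L where "L = 2 * 2 ^ CARD('n) * K"
  have L: "L \<ge> 0" using assms by (simp add: L_def)
  \<comment> \<open>\<open>L\<close> times \<open>CARD('n)\<close> edge terms and one zero-order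
    term has to fit into \<epsilon>/2; \<open>L + 1\<close> keeps the denominator positive when
    \<open>K = 0\<close>.\<close>
  define e where "e = \<epsilon> / (2 * ((L + 1) * (CARD('n) + 1)))"
  have e: "e > 0" using assms L by (simp add: e_def add_pos_pos)
  have halve: "x * (y / (2 * x)) = y / 2" if "x \<noteq> 0" for x y :: real
    using that by simp
  have eL: "L * (CARD('n) * e + e) \<le> \<epsilon> / 2"
  proof -
    have "L * (CARD('n) * e + e) = L * ((CARD('n) + 1) * e)" by (simp add: algebra_simps)
    also have "\<dots> \<le> (L + 1) * ((CARD('n) + 1) * e)" using e by (intro mult_right_mono) auto
    also have "\<dots> = (L + 1) * (CARD('n) + 1) * e" by (simp add: mult.assoc)
    also have "\<dots> = \<epsilon> / 2"
      unfolding e_def by (rule halve) (use L in auto)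
    finally show ?thesis .
  qed
  \<comment> \<open>A single \<eta> has to serve the top-order estimate in every direction
    \<open>i\<close> and the estimate at order \<open>k\<close>.\<close>
  define P where "P i \<eta> \<longleftrightarrow> (\<forall>m A. finite A \<longrightarrow> real (card A) \<le> \<eta> * 2 ^ (m * CARD('n)) \<longrightarrow>
      (\<Sum>z\<in>A. \<bar>fdiffs (i # is) (f m) z\<bar>) * 2 ^ (m * CARD('n)) \<le> e * 2 ^ (m * CARD('n)) \<and>
      (\<Sum>z\<in>A. \<bar>fdiffs is (f m) z\<bar>) * 2 ^ (m * length is) \<le> e * 2 ^ (m * CARD('n)))" for i \<eta>
  have scale: "x \<le> \<delta> * 2 ^ (m * CARD('n))" if "x \<le> \<delta>' * 2 ^ (m * CARD('n))" "\<delta>' \<le> \<delta>" for x m and \<delta> \<delta>' :: real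
    using that by (meson mult_right_mono order_trans zero_le_numeral zero_le_power)
  have ex: "\<exists>\<eta>>0. P i \<eta>" for i
  proof -
    have l: "length (i # is) = CARD('n)" using len k by simp
    obtain \<eta>1 where 1: "\<eta>1 > 0" "\<And>m A. finite A \<Longrightarrow> real (card A) \<le> \<eta>1 * 2 ^ (m * CARD('n)) \<Longrightarrow>
      (\<Sum>z\<in>A. \<bar>fdiffs (i # is) (f m) z\<bar>) * 2 ^ (m * CARD('n)) \<le> e * 2 ^ (m * CARD('n))"
      using uniformly_integrable[of "i # is" e, unfolded l] e by blast
    obtain \<eta>2 where 2: "\<eta>2 > 0" "\<And>m A. finite A \<Longrightarrow> real (card A) \<le> \<eta>2 * 2 ^ (m * CARD('n)) \<Longrightarrow>
      (\<Sum>z\<in>A. \<bar>fdiffs is (f m) z\<bar>) * 2 ^ (m * length is) \<le> e * 2 ^ (m * CARD('n))"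
      using uniformly_integrable[of "is" e] l e by auto
    have "P i (min \<eta>1 \<eta>2)"
      unfolding P_def
    proof (intro allI impI conjI)
      fix m and A :: "('n \<Rightarrow> int) set"
      assume A: "finite A" "real (card A) \<le> min \<eta>1 \<eta>2 * 2 ^ (m * CARD('n))"
      show "(\<Sum>z\<in>A. \<bar>fdiffs (i # is) (f m) z\<bar>) * 2 ^ (m * CARD('n)) \<le> e * 2 ^ (m * CARD('n))"
        by (rule 1(2)[OF A(1) scale[OF A(2)]]) simp
      show "(\<Sum>z\<in>A. \<bar>fdiffs is (f m) z\<bar>) * 2 ^ (m * length is) \<le> e * 2 ^ (m * CARD('n))"
        by (rule 2(2)[OF A(1) scale[OF A(2)]]) simp
    qed
    then show ?thesis using 1 2 by (intro exI[of _ "min \<eta>1 \<eta>2"]) simp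
  qed
  have mono: "P i \<delta>'" if P: "P i \<delta>" and le: "\<delta>' \<le> \<delta>" for i \<delta> \<delta>'
    unfolding P_def
  proof (intro allI impI)
    fix m and A :: "('n \<Rightarrow> int) set"
    assume A: "finite A" "real (card A) \<le> \<delta>' * 2 ^ (m * CARD('n))"
    from P[unfolded P_def, rule_format, OF A(1) scale[OF A(2) le]]
    show "(\<Sum>z\<in>A. \<bar>fdiffs (i # is) (f m) z\<bar>) * 2 ^ (m * CARD('n)) \<le> e * 2 ^ (m * CARD('n)) \<and>
      (\<Sum>z\<in>A. \<bar>fdiffs is (f m) z\<bar>) * 2 ^ (m * length is) \<le> e * 2 ^ (m * CARD('n))" .
  qed
  obtain \<eta> where "\<eta> > 0" and P: "\<And>i. P i \<eta>"
    using uniform_choice[of P] ex mono by metis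
  note \<eta> = P[unfolded P_def]
  \<comment> \<open>Chebyshev's inequality with the L^1 bound \<open>C\<close>: at this height a
    superlevel set has at most (\<eta>/2) * 2^(m*N) points, which leaves a factor 2 for the two
    endpoints of an edge.\<close>
  define M0 where "M0 = 2 * C / \<eta>"
  have M0: "M0 > 0" using C \<open>\<eta> > 0\<close> by (simp add: M0_def)
  define \<delta> where "\<delta> = \<epsilon> / (2 * M0)"
  have "controls K k is \<epsilon> \<delta>"
    unfolding controls_def
  proof (intro allI impI)
    fix m and \<mu> :: "('n \<Rightarrow> int) \<Rightarrow> real" and G :: "('n \<Rightarrow> int) set"
    assume sat: "saturated m G" and \<mu>: "\<forall>z. 0 \<le> \<mu> z"
      and growth: "\<forall>j\<le>m. \<forall>z. (\<Sum>x\<in>cube j z. \<mu> x) \<le> K * 2 ^ (j * k)"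
      and total: "(\<Sum>x\<in>G. \<mu> x) \<le> \<delta> * 2 ^ (m * k)"
    define w where "w = fdiffs is (f m)"
    \<comment> \<open>Differences of order \<open>k\<close> are 2^-(m*k) times difference quotients,
      so the mesh-independent height \<open>M0\<close> for quotients becomes this one.\<close>
    define M where "M = M0 / 2 ^ (m * k)"
    have M: "M > 0" using M0 by (simp add: M_def)
    have fin: "finite G" using sat by (simp add: saturated_def)
    have wC: "(\<Sum>z\<in>A. \<bar>w z\<bar>) \<le> C * 2 ^ m" if "finite A" for A
      using C(2)[OF that, of m] unfolding w_def len mN by (simp add: mult_ac)
    have few: "real (card {z \<in> A. M < \<bar>w z\<bar>}) \<le> \<eta> / 2 * 2 ^ (m * CARD('n))" if "finite A" for A
    proof -
      have "M * card {z \<in> A. M < \<bar>w z\<bar>} \<le> C * 2 ^ m"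
        using card_superlevel[OF that, of "\<lambda>z. \<bar>w z\<bar>" M] wC[OF that] by simp
      also have "\<dots> = M * (\<eta> / 2 * 2 ^ (m * CARD('n)))"
        using \<open>\<eta> > 0\<close> C(1) by (simp add: M_def M0_def mN)
      finally show ?thesis using M by simp
    qed
    \<comment> \<open>An edge is selected if either endpoint is high. The shift in direction
      \<open>i\<close> is injective, so edges with a high far endpoint are counted by the high
      points of the shifted set.\<close>
    have edges: "(\<Sum>z | z \<in> G \<and> (M < \<bar>w z\<bar> \<or> M < \<bar>w (z(i := z i + 1))\<bar>). \<bar>fdiff i w z\<bar>) \<le> e" for i
    proof -
      let ?s = "\<lambda>z::'n \<Rightarrow> int. z(i := z i + 1)"
      let ?S = "{z. z \<in> G \<and> (M < \<bar>w z\<bar> \<or> M < \<bar>w (?s z)\<bar>)}"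
      have inj: "inj ?s"
      proof (rule injI)
        fix x y :: "'n \<Rightarrow> int" assume "?s x = ?s y"
        then have "x l = y l" for l by (metis add_right_cancel fun_upd_apply)
        then show "x = y" by auto
      qed
      have "?S = {z \<in> G. M < \<bar>w z\<bar>} \<union> {z \<in> G. M < \<bar>w (?s z)\<bar>}" by auto
      then have "card ?S \<le> card {z \<in> G. M < \<bar>w z\<bar>} + card {z \<in> G. M < \<bar>w (?s z)\<bar>}"
        by (simp only: card_Un_le)
      also have "card {z \<in> G. M < \<bar>w (?s z)\<bar>} = card (?s ` {z \<in> G. M < \<bar>w (?s z)\<bar>})"
        using inj by (intro card_image[symmetric]) (rule inj_on_subset, auto)
      also have "?s ` {z \<in> G. M < \<bar>w (?s z)\<bar>} = {y \<in> ?s ` G. M < \<bar>w y\<bar>}" by auto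
      finally have "real (card ?S) \<le> real (card {z \<in> G. M < \<bar>w z\<bar>} + card {y \<in> ?s ` G. M < \<bar>w y\<bar>})"
        by (rule of_nat_mono)
      also have "\<dots> \<le> \<eta> / 2 * 2 ^ (m * CARD('n)) + \<eta> / 2 * 2 ^ (m * CARD('n))"
        unfolding of_nat_add by (intro add_mono few finite_imageI fin)
      finally have card: "real (card ?S) \<le> \<eta> * 2 ^ (m * CARD('n))" by simp
      have "finite ?S" using fin by simp
      from conjunct1[OF \<eta>[rule_format, OF this card]]
      have "(\<Sum>z\<in>?S. \<bar>fdiffs (i # is) (f m) z\<bar>) * 2 ^ (m * CARD('n)) \<le> e * 2 ^ (m * CARD('n))" .
      then show ?thesis by (simp add: w_def fdiffs_def)
    qed
    have points: "(\<Sum>z | z \<in> G \<and> M < \<bar>w z\<bar>. \<bar>w z\<bar>) / 2 ^ m \<le> e"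
    proof -
      let ?T = "{z. z \<in> G \<and> M < \<bar>w z\<bar>}"
      have "\<eta> / 2 * 2 ^ (m * CARD('n)) \<le> \<eta> * 2 ^ (m * CARD('n))" using \<open>\<eta> > 0\<close> by (intro mult_right_mono) auto
      then have card: "real (card ?T) \<le> \<eta> * 2 ^ (m * CARD('n))" using few[OF fin] by linarith
      have "finite ?T" using fin by simp
      from conjunct2[OF \<eta>[rule_format, OF this card]]
      have "(\<Sum>z\<in>?T. \<bar>w z\<bar>) * 2 ^ (m * k) \<le> e * 2 ^ (m * CARD('n))"
        by (simp add: w_def len)
      then show ?thesis by (simp add: mN field_simps)
    qed
    have "(\<Sum>x\<in>G. \<mu> x * \<bar>w x\<bar>) \<le> M * (\<Sum>x\<in>G. \<mu> x) + L *
      ((\<Sum>i\<in>UNIV. \<Sum>z | z \<in> G \<and> (M < \<bar>w z\<bar> \<or> M < \<bar>w (z(i := z i + 1))\<bar>). \<bar>fdiff i w z\<bar>)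
       + (\<Sum>z | z \<in> G \<and> M < \<bar>w z\<bar>. \<bar>w z\<bar>) / 2 ^ m)"
      unfolding L_def
    proof (rule mazya_truncated[OF sat])
      fix j and z :: "'n \<Rightarrow> int" assume "j \<le> m"
      then have "(\<Sum>x\<in>cube j z. \<mu> x) * 2 ^ j \<le> K * 2 ^ (j * k) * 2 ^ j"
        using growth by (intro mult_right_mono) auto
      then show "(\<Sum>x\<in>cube j z. \<mu> x) * 2 ^ j \<le> K * 2 ^ (j * CARD('n))" by (simp add: mN)
    qed (use \<mu> M assms in auto)
    also have "\<dots> \<le> M * (\<delta> * 2 ^ (m * k)) + L * ((\<Sum>i\<in>(UNIV::'n set). e) + e)"
      using M L by (intro add_mono mult_left_mono total sum_mono edges points) auto
    also have "\<dots> = M0 * \<delta> + L * (CARD('n) * e + e)" by (simp add: M_def)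
    also have "\<dots> \<le> \<epsilon>" using eL M0 by (simp add: \<delta>_def)
    finally show "(\<Sum>x\<in>G. \<mu> x * \<bar>fdiffs is (f m) x\<bar>) \<le> \<epsilon>" by (simp add: w_def)
  qed
  moreover have "\<delta> > 0" using M0 assms by (simp add: \<delta>_def)
  ultimately show ?thesis by blast
qed

text \<open>The potential of \<mu> is a measure of exponent \<open>k + 1\<close> with growth
  constant 3 * 2^N * K and comparable rescaled mass, so the hypothesis at order \<open>k + 1\<close>
  applies to it in each direction. The two bounds in the choice of \<delta> serve this mass and the
  top-level remainder.\<close>

lemma controls_step:
  assumes k: "k + 2 \<le> CARD('n)" and "K \<ge> 0" "\<epsilon> > 0" and len: "length is = k"
    and IH: "\<And>i K \<epsilon>. K \<ge> 0 \<Longrightarrow> \<epsilon> > 0 \<Longrightarrow> \<exists>\<delta>>0. controls K (Suc k) (i # is) \<epsilon> \<delta>"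
  shows "\<exists>\<delta>>0. controls K k is \<epsilon> \<delta>"
proof -
  obtain C where C: "C > 0" "\<And>m A. finite A \<Longrightarrow>
      (\<Sum>z\<in>A. \<bar>fdiffs is (f m) z\<bar>) * 2 ^ (m * length is) \<le> C * 2 ^ (m * CARD('n))"
    using bound_pos[of "is"] len k by auto
  define e where "e = \<epsilon> / (2 * CARD('n))"
  have e: "e > 0" "CARD('n) * e = \<epsilon> / 2" using assms by (auto simp: e_def)
  obtain d where "d > 0" and d: "\<And>i. controls (3 * 2 ^ CARD('n) * K) (Suc k) (i # is) e d"
  proof -
    have ex: "\<exists>\<delta>>0. controls (3 * 2 ^ CARD('n) * K) (Suc k) (i # is) e \<delta>" for i
      using \<open>K \<ge> 0\<close> e(1) by (intro IH) auto
    show thesis by (rule uniform_choice[OF ex controls_mono that])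
  qed
  define \<delta> where "\<delta> = min (d / (2 * 2 ^ CARD('n))) (\<epsilon> / (2 * C))"
  have \<delta>: "\<delta> > 0" "2 * 2 ^ CARD('n) * \<delta> \<le> d" "\<delta> * C \<le> \<epsilon> / 2"
  proof -
    show "\<delta> > 0" using \<open>d > 0\<close> C assms by (simp add: \<delta>_def)
    have "\<delta> \<le> d / (2 * 2 ^ CARD('n))" "\<delta> \<le> \<epsilon> / (2 * C)" by (auto simp: \<delta>_def)
    then show "2 * 2 ^ CARD('n) * \<delta> \<le> d" "\<delta> * C \<le> \<epsilon> / 2" using C(1) by (auto simp: field_simps)
  qed
  have "controls K k is \<epsilon> \<delta>"
    unfolding controls_def
  proof (intro allI impI)
    fix m and \<mu> :: "('n \<Rightarrow> int) \<Rightarrow> real" and G :: "('n \<Rightarrow> int) set"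
    assume sat: "saturated m G" and \<mu>: "\<forall>z. 0 \<le> \<mu> z"
      and growth: "\<forall>j\<le>m. \<forall>z. (\<Sum>x\<in>cube j z. \<mu> x) \<le> K * 2 ^ (j * k)"
      and total: "(\<Sum>x\<in>G. \<mu> x) \<le> \<delta> * 2 ^ (m * k)"
    define w where "w = fdiffs is (f m)"
    have fin: "finite G" using sat by (simp add: saturated_def)
    have pot: "(\<Sum>x\<in>G. potential m \<mu> x * \<bar>fdiffs (i # is) (f m) x\<bar>) \<le> e" for i
    proof (rule controlsD[OF d sat])
      show "0 \<le> potential m \<mu> z" for z using \<mu> by (intro potential_nonneg) auto
      show "(\<Sum>x\<in>cube j z. potential m \<mu> x) \<le> 3 * 2 ^ CARD('n) * K * 2 ^ (j * Suc k)" if "j \<le> m" for j z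
        using \<mu> k that growth \<open>K \<ge> 0\<close> by (intro potential_growth) auto
      have "(\<Sum>x\<in>G. potential m \<mu> x) \<le> 2 * 2 ^ CARD('n) * 2 ^ m * (\<Sum>x\<in>G. \<mu> x)"
        using \<mu> by (intro potential_total sat) auto
      also have "\<dots> \<le> 2 * 2 ^ CARD('n) * 2 ^ m * (\<delta> * 2 ^ (m * k))"
        by (intro mult_left_mono total) auto
      also have "\<dots> = 2 * 2 ^ CARD('n) * \<delta> * 2 ^ (m * Suc k)" by (simp add: power_add)
      also have "\<dots> \<le> d * 2 ^ (m * Suc k)" by (intro mult_right_mono \<delta>) auto
      finally show "(\<Sum>x\<in>G. potential m \<mu> x) \<le> d * 2 ^ (m * Suc k)" .
    qed
    have "(\<Sum>x\<in>G. \<mu> x * \<bar>w x\<bar>) \<le> (\<Sum>z\<in>G. potential m \<mu> z * fgrad w z)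
        + (\<Sum>x\<in>G. \<mu> x) / 2 ^ (m * CARD('n)) * (\<Sum>x\<in>G. \<bar>w x\<bar>)"
      using \<mu> by (intro sum_le_potential sat) auto
    also have "(\<Sum>z\<in>G. potential m \<mu> z * fgrad w z)
        = (\<Sum>i\<in>UNIV. \<Sum>x\<in>G. potential m \<mu> x * \<bar>fdiffs (i # is) (f m) x\<bar>)"
      unfolding fgrad_def sum_distrib_left by (subst sum.swap) (simp add: w_def fdiffs_def)
    also have "\<dots> \<le> (\<Sum>i\<in>(UNIV :: 'n set). e)" by (intro sum_mono pot)
    also have "\<dots> = \<epsilon> / 2" using e by simp
    also have "(\<Sum>x\<in>G. \<mu> x) / 2 ^ (m * CARD('n)) * (\<Sum>x\<in>G. \<bar>w x\<bar>)
        \<le> \<delta> * 2 ^ (m * k) / 2 ^ (m * CARD('n)) * (\<Sum>x\<in>G. \<bar>w x\<bar>)"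
      by (intro mult_right_mono divide_right_mono total) (auto intro: sum_nonneg)
    also have "\<dots> = \<delta> * ((\<Sum>x\<in>G. \<bar>w x\<bar>) * 2 ^ (m * k) / 2 ^ (m * CARD('n)))" by simp
    also have "\<dots> \<le> \<delta> * C"
      using C(2)[OF fin, of m] \<delta>(1) unfolding w_def len by (intro mult_left_mono) (auto simp: field_simps)
    also have "\<dots> \<le> \<epsilon> / 2" by (rule \<delta>)
    finally show "(\<Sum>x\<in>G. \<mu> x * \<bar>fdiffs is (f m) x\<bar>) \<le> \<epsilon>" by (simp add: w_def)
  qed
  with \<delta>(1) show ?thesis by blast
qed

text \<open>Induction on the distance of \<open>k\<close> from the dimension. The list is
  generalised because each step prepends a new direction, and \<open>K\<close> because each step
  enlarges it.\<close>

lemma controls_all: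
  assumes "k \<le> CARD('n)" "K \<ge> 0" "\<epsilon> > 0" "length is = k"
  shows "\<exists>\<delta>>0. controls K k is \<epsilon> \<delta>"
  using assms
proof (induction "CARD('n) - k" arbitrary: k "is" K \<epsilon>)
  case 0
  then have "k = CARD('n)" by simp
  then show ?case using 0 controls_top[of "is" K \<epsilon>] by simp
next
  case (Suc n)
  show ?case
  proof (cases "Suc k = CARD('n)")
    case True
    show ?thesis by (rule controls_pretop[OF _ True]) (use Suc.prems in auto)
  next
    case False
    then have "k + 2 \<le> CARD('n)" using Suc.prems(1) Suc.hyps(2) by linarith
    show ?thesis
    proof (rule controls_step)
      show "\<exists>\<delta>>0. controls K (Suc k) (i # is) \<epsilon> \<delta>" if "K \<ge> 0" "\<epsilon> > 0" for i K \<epsilon>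
        by (rule Suc.hyps(1)) (use Suc.hyps(2) Suc.prems that \<open>k + 2 \<le> CARD('n)\<close> in auto)
    qed (use Suc.prems \<open>k + 2 \<le> CARD('n)\<close> in auto)
  qed
qed

definition gradient_controls :: "real \<Rightarrow> real \<Rightarrow> real \<Rightarrow> bool" where
  "gradient_controls K \<epsilon> \<delta> \<longleftrightarrow> (\<forall>m \<mu> G. saturated m G \<longrightarrow> (\<forall>z. 0 \<le> \<mu> z) \<longrightarrow>
     (\<forall>j\<le>m. \<forall>z. (\<Sum>x\<in>cube j z. \<mu> x) \<le> K * 2 ^ j) \<longrightarrow>
     (\<Sum>x\<in>G. \<mu> x) \<le> \<delta> * 2 ^ m \<longrightarrow> (\<Sum>x\<in>G. \<mu> x * fgrad (f m) x) \<le> \<epsilon>)"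

lemma gradient_controlsD:
  assumes "gradient_controls K \<epsilon> \<delta>" "saturated m G" "\<And>z. 0 \<le> \<mu> z"
    "\<And>j z. j \<le> m \<Longrightarrow> (\<Sum>x\<in>cube j z. \<mu> x) \<le> K * 2 ^ j" "(\<Sum>x\<in>G. \<mu> x) \<le> \<delta> * 2 ^ m"
  shows "(\<Sum>x\<in>G. \<mu> x * fgrad (f m) x) \<le> \<epsilon>"
  using assms unfolding gradient_controls_def by blast

lemma gradient_control:
  assumes "K \<ge> 0" "\<epsilon> > 0"
  shows "\<exists>\<delta>>0. gradient_controls K \<epsilon> \<delta>"
proof -
  define e where "e = \<epsilon> / CARD('n)"
  have e: "e > 0" using assms by (auto simp: e_def)
  have "\<exists>\<delta>>0. controls K 1 [i] e \<delta>" for i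
    using e assms by (intro controls_all) (auto simp: Suc_le_eq)
  note ex = this
  obtain d where "d > 0" and d: "\<And>i. controls K 1 [i] e d"
  proof -
    show thesis by (rule uniform_choice[OF ex controls_mono that])
  qed
  have "gradient_controls K \<epsilon> d"
    unfolding gradient_controls_def
  proof (intro allI impI)
    fix m and \<mu> :: "('n \<Rightarrow> int) \<Rightarrow> real" and G :: "('n \<Rightarrow> int) set"
    assume sat: "saturated m G" and \<mu>: "\<forall>z. 0 \<le> \<mu> z"
      and growth: "\<forall>j\<le>m. \<forall>z. (\<Sum>x\<in>cube j z. \<mu> x) \<le> K * 2 ^ j"
      and total: "(\<Sum>x\<in>G. \<mu> x) \<le> d * 2 ^ m"
    have "(\<Sum>x\<in>G. \<mu> x * fgrad (f m) x) = (\<Sum>i\<in>UNIV. \<Sum>x\<in>G. \<mu> x * \<bar>fdiffs [i] (f m) x\<bar>)"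
      unfolding fgrad_def sum_distrib_left by (subst sum.swap) (simp add: fdiffs_def)
    also have "\<dots> \<le> (\<Sum>i\<in>(UNIV :: 'n set). e)"
      using \<mu> growth total by (intro sum_mono controlsD[OF d sat]) auto
    also have "\<dots> = \<epsilon>" by (simp add: e_def)
    finally show "(\<Sum>x\<in>G. \<mu> x * fgrad (f m) x) \<le> \<epsilon>" .
  qed
  with \<open>d > 0\<close> show ?thesis by blast
qed

end

section \<open>Lattice paths and sums of oscillations\<close>

lemma saturated_Union_cubes: "finite S \<Longrightarrow> saturated m (\<Union>z\<in>S. cube m (z :: 'n::finite \<Rightarrow> int))"
  unfolding saturated_def using cube_cong by fastforce

text \<open>The mass of \<open>\<mu>\<close> is spread over a lattice path from \<open>x\<close> towards \<open>y\<close> along the axes in \<open>S\<close>.\<close>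

definition path_mass :: "'n set \<Rightarrow> ('n::finite \<Rightarrow> int) \<Rightarrow> ('n \<Rightarrow> int) \<Rightarrow> (('n \<Rightarrow> int) \<Rightarrow> real) \<Rightarrow> bool" where
  "path_mass S x y \<mu> \<longleftrightarrow> (\<forall>z. 0 \<le> \<mu> z) \<and> finite {z. \<mu> z \<noteq> 0} \<and>
    (\<forall>z i. \<mu> z \<noteq> 0 \<longrightarrow> z i \<in> {min (x i) (y i)..max (x i) (y i)}) \<and>
    (\<forall>j z. (\<Sum>u\<in>cube j z. \<mu> u) \<le> real (card S) * 2 ^ j) \<and>
    (\<forall>G. finite G \<longrightarrow> (\<Sum>u\<in>G. \<mu> u) \<le> real_of_int (\<Sum>i\<in>S. \<bar>y i - x i\<bar>)) \<and>
    (\<forall>w G. finite G \<longrightarrow> {z. \<mu> z \<noteq> 0} \<subseteq> G \<longrightarrow>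
       \<bar>w (\<lambda>i. if i \<in> S then y i else x i) - w x\<bar> \<le> (\<Sum>u\<in>G. \<mu> u * fgrad w u))"

lemma path_massD:
  assumes "path_mass S x y \<mu>"
  shows "0 \<le> \<mu> z" "finite {z. \<mu> z \<noteq> 0}"
    "\<mu> z \<noteq> 0 \<Longrightarrow> z i \<in> {min (x i) (y i)..max (x i) (y i)}"
    "(\<Sum>u\<in>cube j z. \<mu> u) \<le> real (card S) * 2 ^ j"
    "finite G \<Longrightarrow> (\<Sum>u\<in>G. \<mu> u) \<le> real_of_int (\<Sum>i\<in>S. \<bar>y i - x i\<bar>)"
    "finite G \<Longrightarrow> {z. \<mu> z \<noteq> 0} \<subseteq> G \<Longrightarrow>
       \<bar>w (\<lambda>i. if i \<in> S then y i else x i) - w x\<bar> \<le> (\<Sum>u\<in>G. \<mu> u * fgrad w u)"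
  using assms unfolding path_mass_def by simp_all

text \<open>Each axis adds one segment parallel to it. A segment meets a cube of level
  \<open>j\<close> in at most 2^j points, which accounts for the factor \<open>card S\<close> in the
  growth bound.\<close>

lemma path_mass_exists:
  fixes x y :: "'n::finite \<Rightarrow> int"
  assumes "finite S"
  shows "\<exists>\<mu>. path_mass S x y \<mu>"
  using assms
proof (induction S)
  case empty
  show ?case by (intro exI[of _ "\<lambda>z. 0"]) (simp add: path_mass_def)
next
  case (insert i S)
  then obtain \<mu> where "path_mass S x y \<mu>" by blast
  note \<mu> = path_massD[OF this]
  define p where "p = (\<lambda>i. if i \<in> S then y i else x i)"
  define a where "a = min (x i) (y i)"
  define b where "b = max (x i) (y i)"
  \<comment> \<open>The interval is half open because the forward difference at \<open>t\<close>
    covers the step from \<open>t\<close> to \<open>t + 1\<close>. With \<open>a\<close> the smaller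
    and \<open>b\<close> the larger coordinate, the direction of travel does not matter.\<close>
  define T where "T = (\<lambda>t. p(i := t)) ` {a..<b}"
  have inj: "inj_on (\<lambda>t. p(i := t)) A" for A
    by (rule inj_onI) (metis fun_upd_same)
  have finT: "finite T" by (simp add: T_def)
  have cardT: "int (card T) = \<bar>y i - x i\<bar>"
    unfolding T_def card_image[OF inj] by (simp add: a_def b_def) linarith
  have pnew: "(\<lambda>l. if l \<in> insert i S then y l else x l) = p(i := y i)"
    by (auto simp: p_def)
  have pi: "p i = x i" using insert.hyps by (simp add: p_def)
  show ?case
    unfolding path_mass_def
  proof (intro exI[of _ "\<lambda>z. \<mu> z + indicat_real T z"] conjI allI impI)
    fix z
    show "0 \<le> \<mu> z + indicat_real T z" using \<mu>(1)[of z] by (simp add: indicator_def)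
    show "finite {z. \<mu> z + indicat_real T z \<noteq> 0}"
      by (rule finite_subset[OF _ finite_UnI[OF \<mu>(2) finT]]) (auto simp: indicator_def)
    fix l
    assume nz: "\<mu> z + indicat_real T z \<noteq> 0"
    show "z l \<in> {min (x l) (y l)..max (x l) (y l)}"
    proof (cases "z \<in> T")
      case True
      then obtain t where t: "z = p(i := t)" "t \<in> {a..<b}" by (auto simp: T_def)
      show ?thesis
      proof (cases "l = i")
        case True
        then show ?thesis using t by (simp add: a_def b_def)
      qed (simp add: t p_def)
    next
      case False
      then show ?thesis using nz by (intro \<mu>(3)) simp
    qed
  next
    fix j z
    have "T \<inter> cube j z \<subseteq> (\<lambda>t. p(i := t)) ` block j (z i)"
    proof
      fix u assume u: "u \<in> T \<inter> cube j z"
      then obtain t where t: "u = p(i := t)" by (auto simp: T_def)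
      have "u i \<in> block j (z i)" using u by (simp add: cube_def)
      then show "u \<in> (\<lambda>t. p(i := t)) ` block j (z i)" using t by simp
    qed
    then have "card (T \<inter> cube j z) \<le> card ((\<lambda>t. p(i := t)) ` block j (z i))"
      by (intro card_mono) auto
    also have "\<dots> \<le> 2 ^ j" using card_image_le[of "block j (z i)" "\<lambda>t. p(i := t)"] by simp
    finally have T: "real (card (T \<inter> cube j z)) \<le> 2 ^ j"
      by (metis of_nat_le_iff of_nat_numeral of_nat_power)
    have "(\<Sum>u\<in>cube j z. \<mu> u + indicat_real T u) \<le> real (card S) * 2 ^ j + 2 ^ j"
      unfolding sum.distrib sum_indicat_real[OF finite_cube] by (intro add_mono T \<mu>(4))
    also have "\<dots> = real (card (insert i S)) * 2 ^ j"
      using insert.hyps by (simp add: algebra_simps)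
    finally show "(\<Sum>u\<in>cube j z. \<mu> u + indicat_real T u) \<le> real (card (insert i S)) * 2 ^ j" .
  next
    fix G :: "('n \<Rightarrow> int) set" assume G: "finite G"
    have "card (T \<inter> G) \<le> card T" by (intro card_mono finT) auto
    then have "real (card (T \<inter> G)) \<le> real_of_int \<bar>y i - x i\<bar>"
      unfolding cardT[symmetric] by simp
    then show "(\<Sum>u\<in>G. \<mu> u + indicat_real T u) \<le> real_of_int (\<Sum>i\<in>insert i S. \<bar>y i - x i\<bar>)"
      using \<mu>(5)[OF G] insert.hyps by (simp add: sum.distrib sum_indicat_real[OF G])
  next
    fix w :: "('n \<Rightarrow> int) \<Rightarrow> real" and G
    assume G: "finite G" "{z. \<mu> z + indicat_real T z \<noteq> 0} \<subseteq> G"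
    have nz: "\<mu> z + indicat_real T z \<noteq> 0" if "\<mu> z \<noteq> 0 \<or> z \<in> T" for z
      using \<mu>(1)[of z] that by (auto simp: indicator_def)
    have TG: "T \<subseteq> G" "{z. \<mu> z \<noteq> 0} \<subseteq> G" using G(2) nz by blast+
    have "\<bar>w (p(i := y i)) - w p\<bar> = \<bar>w (p(i := b)) - w (p(i := a))\<bar>"
    proof -
      have "p = p(i := x i)" using pi fun_upd_triv[of p i] by simp
      then have "\<bar>w (p(i := y i)) - w p\<bar> = \<bar>w (p(i := y i)) - w (p(i := x i))\<bar>" by simp
      then show ?thesis by (auto simp: a_def b_def min_def max_def abs_minus_commute)
    qed
    also have "\<dots> \<le> (\<Sum>s\<in>{a..<b}. \<bar>fdiff i w (p(i := s))\<bar>)"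
      unfolding telescope_line[where a = a and b = b and u = p and i = i and w = w, OF min.coboundedI1[OF max.cobounded1, of "x i" "y i" "y i", folded a_def b_def]]
      by (rule sum_abs)
    also have "\<dots> = (\<Sum>u\<in>T. \<bar>fdiff i w u\<bar>)"
      unfolding T_def by (subst sum.reindex[OF inj]) simp
    also have "\<dots> \<le> (\<Sum>u\<in>T. fgrad w u)"
      unfolding fgrad_def by (intro sum_mono member_le_sum) auto
    also have "\<dots> = (\<Sum>u\<in>G. indicat_real T u * fgrad w u)"
      using TG(1) G(1) by (intro sum.mono_neutral_cong_left) (auto simp: indicator_def)
    finally have new: "\<bar>w (p(i := y i)) - w p\<bar> \<le> (\<Sum>u\<in>G. indicat_real T u * fgrad w u)" .
    have "\<bar>w (p(i := y i)) - w x\<bar> \<le> \<bar>w (p(i := y i)) - w p\<bar> + \<bar>w p - w x\<bar>" by linarith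
    also have "\<dots> \<le> (\<Sum>u\<in>G. indicat_real T u * fgrad w u) + (\<Sum>u\<in>G. \<mu> u * fgrad w u)"
      using \<mu>(6)[OF G(1) TG(2), of w] new by (simp add: p_def)
    finally show "\<bar>w (\<lambda>l. if l \<in> insert i S then y l else x l) - w x\<bar>
        \<le> (\<Sum>u\<in>G. (\<mu> u + indicat_real T u) * fgrad w u)"
      unfolding pnew by (simp add: distrib_right sum.distrib add.commute)
  qed
qed

text \<open>A packing condition of Carleson type in dimension one: a member no larger than the test
  cube and anchored in it is contained in it, and the side lengths of these members add up to at
  most \<open>R\<close> times that of the test cube.\<close>

definition regular_family :: "real \<Rightarrow> nat \<Rightarrow> 'p set \<Rightarrow> ('p \<Rightarrow> nat) \<Rightarrow> ('p \<Rightarrow> 'n \<Rightarrow> int) \<Rightarrow> bool" where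
  "regular_family R m I lev a \<longleftrightarrow> finite I \<and> (\<forall>p\<in>I. lev p \<le> m) \<and>
    (\<forall>p\<in>I. \<forall>q\<in>I. p \<noteq> q \<longrightarrow> cube (lev p) (a p) \<inter> cube (lev q) (a q) = {}) \<and>
    (\<forall>j\<le>m. \<forall>z. (\<Sum>p | p \<in> I \<and> lev p \<le> j \<and> a p \<in> cube j z. 2 ^ lev p) \<le> R * 2 ^ j)"

lemma regular_familyD:
  assumes "regular_family R m I lev a"
  shows "finite I" "p \<in> I \<Longrightarrow> lev p \<le> m"
    "p \<in> I \<Longrightarrow> q \<in> I \<Longrightarrow> p \<noteq> q \<Longrightarrow> cube (lev p) (a p) \<inter> cube (lev q) (a q) = {}"
    "j \<le> m \<Longrightarrow> (\<Sum>p | p \<in> I \<and> lev p \<le> j \<and> a p \<in> cube j z. 2 ^ lev p) \<le> R * 2 ^ j"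
  using assms unfolding regular_family_def by simp_all

context lattice_family
begin

lemma equicontinuous:
  assumes "\<epsilon> > 0"
  shows "\<exists>\<delta>>0. \<forall>m a b. (\<forall>i. \<bar>real_of_int (a i - b i)\<bar> \<le> \<delta> * 2 ^ m) \<longrightarrow> \<bar>f m a - f m b\<bar> \<le> \<epsilon>"
proof -
  obtain d where d: "d > 0" "gradient_controls (real CARD('n)) \<epsilon> d"
    using gradient_control[of "real CARD('n)" \<epsilon>] assms by auto
  show ?thesis
  proof (intro exI[of _ "d / CARD('n)"] conjI allI impI)
    show "d / CARD('n) > 0" using d by simp
    fix m and a b :: "'n \<Rightarrow> int"
    assume ab: "\<forall>i. \<bar>real_of_int (a i - b i)\<bar> \<le> d / CARD('n) * 2 ^ m"
    obtain \<mu> where "path_mass UNIV b a \<mu>" using path_mass_exists[OF finite] by blast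
    note \<mu> = path_massD[OF this]
    define G where "G = (\<Union>z\<in>{z. \<mu> z \<noteq> 0}. cube m z)"
    have sat: "saturated m G" unfolding G_def by (intro saturated_Union_cubes \<mu>)
    then have fin: "finite G" by (simp add: saturated_def)
    have sub: "{z. \<mu> z \<noteq> 0} \<subseteq> G" unfolding G_def using cube_self by blast
    have "\<bar>f m a - f m b\<bar> \<le> (\<Sum>u\<in>G. \<mu> u * fgrad (f m) u)" using \<mu>(6)[OF fin sub, of "f m"] by simp
    also have "\<dots> \<le> \<epsilon>"
    proof (rule gradient_controlsD[OF d(2) sat \<mu>(1) \<mu>(4)])
      have "(\<Sum>u\<in>G. \<mu> u) \<le> (\<Sum>i\<in>UNIV. \<bar>real_of_int (a i - b i)\<bar>)" using \<mu>(5)[OF fin] by simp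
      also have "\<dots> \<le> (\<Sum>i\<in>(UNIV::'n set). d / CARD('n) * 2 ^ m)" by (intro sum_mono ab[rule_format])
      also have "\<dots> = d * 2 ^ m" by simp
      finally show "(\<Sum>u\<in>G. \<mu> u) \<le> d * 2 ^ m" .
    qed
    finally show "\<bar>f m a - f m b\<bar> \<le> \<epsilon>" .
  qed
qed

text \<open>The measure is the sum of the path masses of all pairs. Its growth is checked by
  comparing a test cube with the cubes of the family, since every path stays in its own
  cube.\<close>

lemma oscillation_sum:
  assumes "\<epsilon> > 0" "R \<ge> 1"
  shows "\<exists>\<delta>>0. \<forall>m (I :: 'p set) lev a b. regular_family R m I lev a \<longrightarrow>
    (\<forall>p\<in>I. b p \<in> cube (lev p) (a p)) \<longrightarrow> (\<Sum>p\<in>I. 2 ^ lev p) \<le> (\<delta> * 2 ^ m :: real) \<longrightarrow>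
    (\<Sum>p\<in>I. \<bar>f m (a p) - f m (b p)\<bar>) \<le> \<epsilon>"
proof -
  let ?N = "real CARD('n)"
  obtain d where d: "d > 0" "gradient_controls (CARD('n) * R) \<epsilon> d"
    using gradient_control[of "CARD('n) * R" \<epsilon>] assms by auto
  show ?thesis
  proof (intro exI[of _ "d / ?N"] conjI allI impI)
    show "d / ?N > 0" using d by simp
    fix m and I :: "'p set" and a b :: "'p \<Rightarrow> 'n \<Rightarrow> int" and lev
    assume family: "regular_family R m I lev a" and b: "\<forall>p\<in>I. b p \<in> cube (lev p) (a p)"
      and total: "(\<Sum>p\<in>I. 2 ^ lev p) \<le> d / ?N * 2 ^ m"
    note I = regular_familyD(1)[OF family] and lev = regular_familyD(2)[OF family]
      and disj = regular_familyD(3)[OF family] and regular = regular_familyD(4)[OF family]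
    note b = b[rule_format]
    have "\<forall>p. \<exists>\<mu>. path_mass UNIV (b p) (a p) \<mu>" by (intro allI path_mass_exists finite)
    then obtain \<nu> where "\<And>p. path_mass UNIV (b p) (a p) (\<nu> p)" by metis
    note \<nu> = path_massD[OF this]
    \<comment> \<open>A path stays in the box spanned by its endpoints, and a block is an
      interval.\<close>
    have supp: "z \<in> cube (lev p) (a p)" if "p \<in> I" "\<nu> p z \<noteq> 0" for p z
      unfolding cube_def
    proof (intro CollectI allI)
      fix i
      have "b p i \<in> block (lev p) (a p i)" "a p i \<in> block (lev p) (a p i)"
        using b[OF that(1)] cube_self[of "a p"] by (auto simp: cube_def)
      then show "z i \<in> block (lev p) (a p i)"
        using \<nu>(3)[OF that(2), of i] unfolding block_eq by auto
    qed
    have mass: "(\<Sum>u\<in>G. \<nu> p u) \<le> ?N * 2 ^ lev p" if "p \<in> I" "finite G" for p G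
    proof -
      have "\<bar>a p i - b p i\<bar> \<le> 2 ^ lev p" for i
      proof -
        have "b p i \<in> block (lev p) (a p i)" "a p i \<in> block (lev p) (a p i)"
          using b[OF that(1)] cube_self[of "a p"] by (auto simp: cube_def)
        then show ?thesis unfolding block_eq by auto
      qed
      then have "(\<Sum>i\<in>UNIV. \<bar>a p i - b p i\<bar>) \<le> (\<Sum>i\<in>(UNIV::'n set). 2 ^ lev p)" by (intro sum_mono)
      then have "real_of_int (\<Sum>i\<in>UNIV. \<bar>a p i - b p i\<bar>) \<le> real_of_int (\<Sum>i\<in>(UNIV::'n set). 2 ^ lev p)"
        by (simp only: of_int_le_iff)
      then show ?thesis using \<nu>(5)[OF that(2), of p] by simp
    qed
    define \<mu> where "\<mu> z = (\<Sum>p\<in>I. \<nu> p z)" for z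
    define G where "G = (\<Union>z\<in>(\<Union>p\<in>I. {z. \<nu> p z \<noteq> 0}). cube m z)"
    have sat: "saturated m G" unfolding G_def using I \<nu>(2) by (intro saturated_Union_cubes) auto
    then have fin: "finite G" by (simp add: saturated_def)
    have sub: "{z. \<nu> p z \<noteq> 0} \<subseteq> G" if "p \<in> I" for p
      unfolding G_def using cube_self that by blast
    have "(\<Sum>p\<in>I. \<bar>f m (a p) - f m (b p)\<bar>) \<le> (\<Sum>p\<in>I. \<Sum>u\<in>G. \<nu> p u * fgrad (f m) u)"
      using \<nu>(6)[OF fin sub, where w = "f m"] by (intro sum_mono) simp
    also have "\<dots> = (\<Sum>u\<in>G. \<mu> u * fgrad (f m) u)"
      unfolding \<mu>_def sum_distrib_right by (rule sum.swap)
    also have "\<dots> \<le> \<epsilon>"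
    proof (rule gradient_controlsD[OF d(2) sat])
      show "0 \<le> \<mu> z" for z unfolding \<mu>_def by (intro sum_nonneg \<nu>(1))
      show "(\<Sum>u\<in>G. \<mu> u) \<le> d * 2 ^ m"
      proof -
        have "(\<Sum>u\<in>G. \<mu> u) = (\<Sum>p\<in>I. \<Sum>u\<in>G. \<nu> p u)" unfolding \<mu>_def by (rule sum.swap)
        also have "\<dots> \<le> (\<Sum>p\<in>I. ?N * 2 ^ lev p)" by (intro sum_mono mass fin)
        also have "\<dots> = ?N * (\<Sum>p\<in>I. 2 ^ lev p)" by (simp add: sum_distrib_left)
        also have "\<dots> \<le> ?N * (d / ?N * 2 ^ m)" by (intro mult_left_mono total) auto
        finally show ?thesis by simp
      qed
      fix j and z :: "'n \<Rightarrow> int" assume j: "j \<le> m"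
      have swap: "(\<Sum>u\<in>cube j z. \<mu> u) = (\<Sum>p\<in>I. \<Sum>u\<in>cube j z. \<nu> p u)"
        unfolding \<mu>_def by (rule sum.swap)
      show "(\<Sum>u\<in>cube j z. \<mu> u) \<le> ?N * R * 2 ^ j"
      proof (cases "\<exists>p\<in>I. j \<le> lev p \<and> cube j z \<inter> cube (lev p) (a p) \<noteq> {}")
        \<comment> \<open>The test cube lies inside one cube of the family. Disjointness leaves a
          single path, and \<open>R \<ge> 1\<close> absorbs its growth constant.\<close>
        case True
        then obtain p y where p: "p \<in> I" "j \<le> lev p" "y \<in> cube j z" "y \<in> cube (lev p) (a p)" by blast
        have "cube j z \<subseteq> cube (lev p) (a p)"
          using cube_mono[OF p(2), of y] cube_cong[OF p(3)] cube_cong[OF p(4)] by simp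
        then have "\<nu> q u = 0" if "q \<in> I - {p}" "u \<in> cube j z" for q u
          using supp[of q u] disj[of p q] p(1) that by blast
        then have "(\<Sum>q\<in>I - {p}. \<Sum>u\<in>cube j z. \<nu> q u) = 0" by simp
        then have "(\<Sum>u\<in>cube j z. \<mu> u) = (\<Sum>u\<in>cube j z. \<nu> p u)"
          unfolding swap using sum.remove[OF I p(1), of "\<lambda>q. \<Sum>u\<in>cube j z. \<nu> q u"] by simp
        also have "\<dots> \<le> ?N * 2 ^ j" using \<nu>(4)[of p j z] by simp
        also have "\<dots> \<le> ?N * R * 2 ^ j" using assms(2) by (intro mult_right_mono) auto
        finally show ?thesis .
      next
        \<comment> \<open>Every family cube that meets the test cube is now smaller and contained in
          it, so the packing condition bounds the full masses of their paths.\<close>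
        case False
        have "(\<Sum>u\<in>cube j z. \<mu> u) \<le> (\<Sum>p\<in>I. if lev p \<le> j \<and> a p \<in> cube j z then ?N * 2 ^ lev p else 0)"
          unfolding swap
        proof (intro sum_mono)
          fix p assume p: "p \<in> I"
          show "(\<Sum>u\<in>cube j z. \<nu> p u) \<le> (if lev p \<le> j \<and> a p \<in> cube j z then ?N * 2 ^ lev p else 0)"
          proof (cases "lev p \<le> j \<and> a p \<in> cube j z")
            case in_cube: False
            have "\<nu> p u = 0" if "u \<in> cube j z" for u
            proof (rule ccontr)
              assume "\<nu> p u \<noteq> 0"
              then have u: "u \<in> cube (lev p) (a p)" by (rule supp[OF p])
              then have "\<not> j \<le> lev p" using False p that by blast
              then have "a p \<in> cube j u" using u cube_mono[of "lev p" j u] cube_sym by auto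
              then show False using in_cube \<open>\<not> j \<le> lev p\<close> cube_cong[OF that] by auto
            qed
            then show ?thesis using in_cube by auto
          qed (use mass[OF p] in simp)
        qed
        also have "\<dots> = ?N * (\<Sum>p | p \<in> I \<and> lev p \<le> j \<and> a p \<in> cube j z. 2 ^ lev p)"
          unfolding sum.inter_filter[OF I, symmetric] by (simp add: sum_distrib_left)
        also have "\<dots> \<le> ?N * (R * 2 ^ j)" by (intro mult_left_mono regular j) auto
        also have "\<dots> = ?N * R * 2 ^ j" by simp
        finally show ?thesis .
      qed
    qed
    finally show "(\<Sum>p\<in>I. \<bar>f m (a p) - f m (b p)\<bar>) \<le> \<epsilon>" .
  qed
qed

end

subsection \<open>Smooth splines\<close>

definition smooth1 :: "(real \<Rightarrow> real) \<Rightarrow> bool" where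
  "smooth1 f \<longleftrightarrow> (\<forall>k x. ((deriv ^^ k) f has_real_derivative (deriv ^^ Suc k) f x) (at x))"

text \<open>\<open>S\<close> is an invariant under differentiation. This suits the bump function,
  whose derivatives are never computed in closed form but keep the shape
  \<open>bump P k\<close>.\<close>

lemma smooth1_coinduct:
  assumes "f \<in> S" and S: "\<And>g. g \<in> S \<Longrightarrow> \<exists>g'\<in>S. \<forall>x. (g has_real_derivative g' x) (at x)"
  shows "smooth1 f"
proof -
  have closed: "deriv g \<in> S \<and> (\<forall>x. (g has_real_derivative deriv g x) (at x))" if g: "g \<in> S" for g
  proof -
    obtain g' where g': "g' \<in> S" "\<And>x. (g has_real_derivative g' x) (at x)" using S[OF g] by blast
    then have "deriv g = g'" by (intro ext DERIV_imp_deriv)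
    with g' show ?thesis by simp
  qed
  have "(deriv ^^ k) f \<in> S" for k
    by (induction k) (use assms(1) closed in auto)
  then show ?thesis using closed by (auto simp: smooth1_def)
qed

lemma smooth1_differentiable_funpow:
  assumes "smooth1 f"
  shows "((deriv ^^ k) f has_real_derivative (deriv ^^ Suc k) f x) (at x)"
  by (rule assms[unfolded smooth1_def, rule_format])

lemma smooth1_DERIV: "smooth1 f \<Longrightarrow> (f has_real_derivative deriv f x) (at x)"
  using smooth1_differentiable_funpow[of f 0] by simp

lemma smooth1_isCont: "smooth1 f \<Longrightarrow> isCont f x"
  by (rule DERIV_isCont[OF smooth1_DERIV])

lemma smooth1_affine:
  assumes "smooth1 f"
  shows "smooth1 (\<lambda>x. f (a * x + b))"
    and "(deriv ^^ k) (\<lambda>x. f (a * x + b)) = (\<lambda>x. a ^ k * (deriv ^^ k) f (a * x + b))"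
proof -
  have D: "((\<lambda>x. a ^ k * (deriv ^^ k) f (a * x + b)) has_real_derivative
      a ^ Suc k * (deriv ^^ Suc k) f (a * x + b)) (at x)" for k x
  proof -
    have "((\<lambda>x. a * x + b) has_real_derivative a) (at x)" by (auto intro!: derivative_eq_intros)
    from DERIV_chain2[where g = "\<lambda>x. a * x + b", OF smooth1_differentiable_funpow[OF assms] this]
    have "((\<lambda>x. a ^ k * (deriv ^^ k) f (a * x + b)) has_real_derivative
      a ^ k * ((deriv ^^ Suc k) f (a * x + b) * a)) (at x)"
      by (rule DERIV_cmult)
    then show ?thesis by (simp add: mult_ac)
  qed
  show eq: "(deriv ^^ k) (\<lambda>x. f (a * x + b)) = (\<lambda>x. a ^ k * (deriv ^^ k) f (a * x + b))" for k
  proof (induction k)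
    case (Suc k)
    then have "(deriv ^^ Suc k) (\<lambda>x. f (a * x + b)) = deriv (\<lambda>x. a ^ k * (deriv ^^ k) f (a * x + b))" by simp
    also have "\<dots> = (\<lambda>x. a ^ Suc k * (deriv ^^ Suc k) f (a * x + b))"
      using D by (intro ext DERIV_imp_deriv)
    finally show ?case .
  qed simp
  show "smooth1 (\<lambda>x. f (a * x + b))"
    unfolding smooth1_def eq using D by blast
qed

lemma deriv_funpow_diff:
  assumes "smooth1 f" "smooth1 g"
  shows "(deriv ^^ k) (\<lambda>x. f x - g x) = (\<lambda>x. (deriv ^^ k) f x - (deriv ^^ k) g x)"
proof (induction k)
  case (Suc k)
  have "(deriv ^^ Suc k) (\<lambda>x. f x - g x) = deriv (\<lambda>x. (deriv ^^ k) f x - (deriv ^^ k) g x)"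
    using Suc by simp
  also have "\<dots> = (\<lambda>x. (deriv ^^ Suc k) f x - (deriv ^^ Suc k) g x)"
    using assms by (intro ext DERIV_imp_deriv DERIV_diff smooth1_differentiable_funpow)
  finally show ?case .
qed simp

lemma smooth1_diff: "smooth1 f \<Longrightarrow> smooth1 g \<Longrightarrow> smooth1 (\<lambda>x. f x - g x)"
  unfolding smooth1_def[of "\<lambda>x. f x - g x"]
  by (simp only: deriv_funpow_diff) (intro allI DERIV_diff smooth1_differentiable_funpow)

section \<open>A smooth bump function on the unit interval\<close>

lemma power_le_exp:
  assumes "0 \<le> (y::real)"
  shows "y ^ m \<le> fact m * exp y"
proof -
  have "(\<Sum>n\<in>{m}. inverse (fact n) * y ^ n) \<le> (\<Sum>n. inverse (fact n) * y ^ n)"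
    using assms by (intro sum_le_suminf summable_exp) auto
  also have "\<dots> = exp y" by (simp add: exp_def scaleR_conv_of_real mult.commute)
  finally show ?thesis by (simp add: field_simps)
qed

text \<open>The classical function exp(-1/(t(1-t))) with a polynomial factor and negative powers of
  t(1-t), which closes the family under differentiation.\<close>

definition bump :: "real poly \<Rightarrow> nat \<Rightarrow> real \<Rightarrow> real" where
  "bump P k t = (if 0 < t \<and> t < 1
     then poly P t * inverse (t * (1 - t)) ^ k * exp (- inverse (t * (1 - t))) else 0)"

text \<open>For y = 1/(t(1-t)) the bound y^(k+2) exp(-y) \<le> (k+2)! leaves two spare powers of
  t(1-t). They give second-order vanishing at both endpoints, hence derivative 0 there.\<close>

lemma bump_flat: "\<exists>C. \<forall>t. \<bar>bump P k t\<bar> \<le> C * t\<^sup>2 \<and> \<bar>bump P k t\<bar> \<le> C * (t - 1)\<^sup>2"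
proof -
  have "compact ((\<lambda>t. poly P t) ` {0..1})"
    by (intro compact_continuous_image continuous_intros) auto
  then have "bounded ((\<lambda>t. poly P t) ` {0..1})" by (rule compact_imp_bounded)
  then obtain M where "\<forall>y\<in>(\<lambda>t. poly P t) ` {0..1}. norm y \<le> M" unfolding bounded_iff by blast
  then have M: "\<bar>poly P t\<bar> \<le> M" if "t \<in> {0..1}" for t using that by (auto simp: real_norm_def)
  have "0 \<le> M" using M[of 0] by (auto intro: order_trans[OF abs_ge_zero])
  define C where "C = M * fact (k + 2)"
  have C: "0 \<le> C" using \<open>0 \<le> M\<close> by (simp add: C_def)
  have bound: "\<bar>bump P k t\<bar> \<le> C * (t * (1 - t))\<^sup>2" if t: "0 < t" "t < 1" for t
  proof -
    define y where "y = inverse (t * (1 - t))"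
    have "0 < t * (1 - t)" using t by simp
    then have "0 < y" unfolding y_def by (rule positive_imp_inverse_positive)
    have "y ^ k * exp (- y) = y ^ (k + 2) * exp (- y) * (t * (1 - t))\<^sup>2"
    proof -
      have "y ^ (k + 2) * exp (- y) * (t * (1 - t))\<^sup>2 = y ^ k * exp (- y) * (y * (t * (1 - t)))\<^sup>2"
        by (simp only: power_add power_mult_distrib mult_ac)
      also have "y * (t * (1 - t)) = 1" unfolding y_def using t by (intro left_inverse) simp
      finally show ?thesis by simp
    qed
    also have "\<dots> \<le> fact (k + 2) * (t * (1 - t))\<^sup>2"
    proof (intro mult_right_mono)
      have "y ^ (k + 2) * exp (- y) \<le> fact (k + 2) * exp y * exp (- y)"
        using \<open>0 < y\<close> by (intro mult_right_mono power_le_exp) auto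
      then show "y ^ (k + 2) * exp (- y) \<le> fact (k + 2)"
        by (simp only: mult.assoc exp_minus_inverse mult_1_right)
    qed simp
    finally have le: "y ^ k * exp (- y) \<le> fact (k + 2) * (t * (1 - t))\<^sup>2" .
    have "bump P k t = poly P t * (y ^ k * exp (- y))"
      using t unfolding bump_def y_def by (simp only: mult.assoc if_True simp_thms)
    then have "\<bar>bump P k t\<bar> = \<bar>poly P t\<bar> * (y ^ k * exp (- y))"
      using \<open>0 < y\<close> by (simp add: abs_mult)
    also have "\<dots> \<le> M * (fact (k + 2) * (t * (1 - t))\<^sup>2)"
      by (rule mult_mono[OF _ le]) (use M[of t] t \<open>0 < y\<close> \<open>0 \<le> M\<close> in simp_all)
    finally show ?thesis by (simp only: C_def mult.assoc)
  qed
  have "\<bar>bump P k t\<bar> \<le> C * t\<^sup>2 \<and> \<bar>bump P k t\<bar> \<le> C * (t - 1)\<^sup>2" for t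
  proof (cases "0 < t \<and> t < 1")
    case True
    have "(t * (1 - t))\<^sup>2 \<le> t\<^sup>2" "(t * (1 - t))\<^sup>2 \<le> (1 - t)\<^sup>2"
    proof -
      have "0 \<le> t * (1 - t)" using True by simp
      moreover have "t * (1 - t) \<le> t" using True by (intro mult_left_le) auto
      moreover have "t * (1 - t) \<le> 1 - t" using True by (intro mult_left_le_one_le) auto
      ultimately show "(t * (1 - t))\<^sup>2 \<le> t\<^sup>2" "(t * (1 - t))\<^sup>2 \<le> (1 - t)\<^sup>2"
        using power_mono[of "t * (1 - t)" t 2] power_mono[of "t * (1 - t)" "1 - t" 2] by auto
    qed
    then have "C * (t * (1 - t))\<^sup>2 \<le> C * t\<^sup>2" "C * (t * (1 - t))\<^sup>2 \<le> C * (t - 1)\<^sup>2"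
      using mult_left_mono[OF _ C] power2_commute[of t 1] by auto
    then show ?thesis using bound[of t] True by linarith
  qed (use C in \<open>auto simp: bump_def\<close>)
  then show ?thesis by blast
qed

lemma DERIV_zero_if_quadratic:
  fixes f :: "real \<Rightarrow> real"
  assumes "\<And>t. \<bar>f t\<bar> \<le> C * (t - a)\<^sup>2"
  shows "(f has_real_derivative 0) (at a)"
proof -
  have fa: "f a = 0" using assms[of a] by simp
  have "((\<lambda>t. (f t - f a) / (t - a)) \<longlongrightarrow> 0) (at a)"
  proof (rule Lim_null_comparison)
    show "eventually (\<lambda>t. norm ((f t - f a) / (t - a)) \<le> C * \<bar>t - a\<bar>) (at a)"
      unfolding eventually_at_filter
    proof (intro always_eventually allI impI)
      fix t assume "t \<noteq> a"
      then show "norm ((f t - f a) / (t - a)) \<le> C * \<bar>t - a\<bar>"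
        using assms[of t] by (simp add: fa abs_divide field_simps power2_eq_square abs_mult_self_eq)
    qed
    show "((\<lambda>t. C * \<bar>t - a\<bar>) \<longlongrightarrow> 0) (at a)"
      by (auto intro!: tendsto_eq_intros)
  qed
  then show ?thesis by (simp add: has_field_derivative_iff)
qed

text \<open>The product rule for P r^(-k) exp(-1/r) with r = t(1-t) and r' = 1 - 2t, brought to the
  common power r^(-(k+2)): the three summands come from P, from the power and from the
  exponential.\<close>

lemma bump_DERIV:
  defines "r \<equiv> [:0, 1, -1:] :: real poly"
  shows "(bump P k has_real_derivative
    bump (pderiv P * r\<^sup>2 - smult (of_nat k) ([:1, -2:] * r * P) + [:1, -2:] * P) (k + 2) t) (at t)"
proof -
  let ?Q = "pderiv P * r\<^sup>2 - smult (of_nat k) ([:1, -2:] * r * P) + [:1, -2:] * P"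
  consider "t < 0" | "t = 0" | "0 < t \<and> t < 1" | "t = 1" | "t > 1" by linarith
  then show ?thesis
  proof cases
    case 1
    have "((\<lambda>t. 0) has_real_derivative bump ?Q (k + 2) t) (at t)" using 1 by (simp add: bump_def)
    then show ?thesis
      by (rule has_field_derivative_transform_within_open[where S = "{..<0}"]) (use 1 in \<open>auto simp: bump_def\<close>)
  next
    case 5
    have "((\<lambda>t. 0) has_real_derivative bump ?Q (k + 2) t) (at t)" using 5 by (simp add: bump_def)
    then show ?thesis
      by (rule has_field_derivative_transform_within_open[where S = "{1<..}"]) (use 5 in \<open>auto simp: bump_def\<close>)
  next
    case 2
    obtain C where "\<And>t. \<bar>bump P k t\<bar> \<le> C * t\<^sup>2" using bump_flat by blast
    then have "(bump P k has_real_derivative 0) (at 0)" by (intro DERIV_zero_if_quadratic[where C = C]) simp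
    then show ?thesis using 2 by (simp add: bump_def)
  next
    case 4
    obtain C where "\<And>t. \<bar>bump P k t\<bar> \<le> C * (t - 1)\<^sup>2" using bump_flat by blast
    then have "(bump P k has_real_derivative 0) (at 1)" by (intro DERIV_zero_if_quadratic[where C = C]) simp
    then show ?thesis using 4 by (simp add: bump_def)
  next
    case 3
    define s where "s = t * (1 - t)"
    define q where "q = inverse s"
    have s: "s > 0" using 3 by (simp add: s_def)
    have qs: "q * s = 1" using s by (simp add: q_def)
    have Dq: "((\<lambda>t. inverse (t * (1 - t))) has_real_derivative - (1 - 2 * t) * q\<^sup>2) (at t)"
      using s by (auto intro!: derivative_eq_intros simp: s_def q_def power2_eq_square field_simps)
    have Dqk: "((\<lambda>t. inverse (t * (1 - t)) ^ k) has_real_derivative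
        - (1 - 2 * t) * (of_nat k * s * q ^ (k + 2))) (at t)"
    proof -
      \<comment> \<open>The power rule leaves the exponent \<open>k - Suc 0\<close>, which truncates
        at \<open>k = 0\<close>, where the factor \<open>of_nat k\<close> vanishes. Otherwise
        \<open>q * s = 1\<close> trades one factor.\<close>
      have eq: "of_nat k * (- (1 - 2 * t) * q\<^sup>2 * q ^ (k - Suc 0)) = - (1 - 2 * t) * (of_nat k * s * q ^ (k + 2))"
      proof (cases k)
        case (Suc l)
        have "s * q ^ (k + 2) = (q * s) * (q\<^sup>2 * q ^ (k - Suc 0))"
          by (simp add: Suc power2_eq_square mult_ac)
        then have "s * q ^ (k + 2) = q\<^sup>2 * q ^ (k - Suc 0)" by (simp add: qs)
        then show ?thesis by (simp only: mult.assoc) (simp only: mult.left_commute)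
      qed simp
      show ?thesis
        by (rule DERIV_cong[OF DERIV_power[OF Dq, of k]])
          (unfold q_def[symmetric] s_def[symmetric], rule eq)
    qed
    have De: "((\<lambda>t. exp (- inverse (t * (1 - t)))) has_real_derivative exp (- q) * ((1 - 2 * t) * q\<^sup>2)) (at t)"
      by (rule DERIV_cong[OF DERIV_chain2[OF DERIV_exp DERIV_minus[OF Dq]]])
        (unfold q_def[symmetric] s_def[symmetric], simp add: algebra_simps)
    have "((\<lambda>t. poly P t * inverse (t * (1 - t)) ^ k * exp (- inverse (t * (1 - t)))) has_real_derivative
        (poly (pderiv P) t * q ^ k + (- (1 - 2 * t) * (of_nat k * s * q ^ (k + 2))) * poly P t) * exp (- q)
         + exp (- q) * ((1 - 2 * t) * q\<^sup>2) * (poly P t * q ^ k)) (at t)"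
      using DERIV_mult[OF DERIV_mult[OF poly_DERIV[of P t] Dqk] De]
      unfolding q_def[symmetric] s_def[symmetric] .
    also have "(poly (pderiv P) t * q ^ k + (- (1 - 2 * t) * (of_nat k * s * q ^ (k + 2))) * poly P t) * exp (- q)
         + exp (- q) * ((1 - 2 * t) * q\<^sup>2) * (poly P t * q ^ k) = bump ?Q (k + 2) t"
    proof -
      have "q ^ k = q ^ (k + 2) * s\<^sup>2"
        using qs by (metis mult.assoc mult.right_neutral power_add power_mult_distrib power_one)
      then have "poly (pderiv P) t * q ^ k = poly (pderiv P) t * (q ^ (k + 2) * s\<^sup>2)"
        by (rule arg_cong)
      then have 1: "poly (pderiv P) t * q ^ k = poly (pderiv P) t * s\<^sup>2 * q ^ (k + 2)"
        by (simp only: mult_ac)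
      have 2: "bump ?Q (k + 2) t = (poly (pderiv P) t * s\<^sup>2 - of_nat k * ((1 - 2 * t) * s * poly P t) + (1 - 2 * t) * poly P t)
          * q ^ (k + 2) * exp (- q)"
        using 3 by (simp add: bump_def q_def s_def r_def algebra_simps)
      show ?thesis unfolding 1 2 by (simp add: algebra_simps power_add power2_eq_square)
    qed
    finally show ?thesis
      by (rule has_field_derivative_transform_within_open[where S = "{0<..<1}"]) (use 3 in \<open>auto simp: bump_def\<close>)
  qed
qed

lemma smooth1_bump: "smooth1 (\<lambda>t. c * bump P k t)"
proof (rule smooth1_coinduct[where S = "{g. \<exists>P k. g = (\<lambda>t. c * bump P k t)}"])
  fix g assume "g \<in> {g. \<exists>P k. g = (\<lambda>t. c * bump P k t)}"
  then obtain P k where g: "g = (\<lambda>t. c * bump P k t)" by blast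
  show "\<exists>g'\<in>{g. \<exists>P k. g = (\<lambda>t. c * bump P k t)}. \<forall>x. (g has_real_derivative g' x) (at x)"
  proof (rule bexI)
    show "\<forall>x. (g has_real_derivative c * bump (pderiv P * [:0, 1, -1:]\<^sup>2
      - smult (of_nat k) ([:1, -2:] * [:0, 1, -1:] * P) + [:1, -2:] * P) (k + 2) x) (at x)"
      unfolding g by (intro allI DERIV_cmult bump_DERIV)
  qed blast
next
  show "(\<lambda>t. c * bump P k t) \<in> {g. \<exists>P k. g = (\<lambda>t. c * bump P k t)}"
    by (intro CollectI exI) (rule refl)
qed

section \<open>Antiderivatives and B-splines\<close>

text \<open>Meant for integrands that vanish on the negative half-line. A lower limit below 0 keeps
  every t \<ge> 0 interior to the interval up to \<open>t + 1\<close>, so the derivative there is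
  two-sided.\<close>

definition antideriv :: "(real \<Rightarrow> real) \<Rightarrow> real \<Rightarrow> real" where
  "antideriv g t = integral {-1..t} g"

lemma antideriv_nonpos:
  assumes "\<And>t. t \<le> 0 \<Longrightarrow> g t = 0" "t \<le> 0"
  shows "antideriv g t = 0"
proof -
  have "integral {-1..t} g = integral {-1..t} (\<lambda>x. 0)" using assms by (intro integral_cong) auto
  then show ?thesis by (simp add: antideriv_def)
qed

lemma antideriv_DERIV:
  assumes "\<And>x. isCont g x" and g: "\<And>t. t \<le> 0 \<Longrightarrow> g t = 0"
  shows "(antideriv g has_real_derivative g t) (at t)"
proof (cases "t < 0")
  case True
  have "((\<lambda>t. 0) has_real_derivative g t) (at t)" using True g by simp
  then show ?thesis
    by (rule has_field_derivative_transform_within_open[where S = "{..<0}"])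
      (use True antideriv_nonpos[OF g] in auto)
next
  case False
  have "((\<lambda>u. integral {-1..u} g) has_real_derivative g t) (at t within {-1..t + 1})"
    using False assms by (intro integral_has_real_derivative continuous_at_imp_continuous_on) auto
  moreover have "at t within {-1..t + 1} = at t"
    using False by (intro at_within_interior) auto
  ultimately show ?thesis unfolding antideriv_def by simp
qed

definition mollifier :: "real \<Rightarrow> real" where
  "mollifier t = 1 / antideriv (bump 1 0) 1 * bump 1 0 t"

text \<open>Smooth B-splines: the kernel \<open>mollifier\<close> convolved with \<open>k\<close> copies of the indicator of \<open>[0, 1]\<close>.
  The backward difference of one of them is the derivative of the next one.\<close>

fun spline :: "nat \<Rightarrow> real \<Rightarrow> real" where
  "spline 0 = mollifier"
| "spline (Suc k) = (\<lambda>t. antideriv (spline k) t - antideriv (spline k) (t - 1))"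

lemma smooth1_cong_DERIV:
  assumes "\<And>t. (f has_real_derivative g t) (at t)" "smooth1 g"
  shows "smooth1 f"
proof (rule smooth1_coinduct[where S = "insert f {(deriv ^^ k) g | k. True}"])
  fix h assume h: "h \<in> insert f {(deriv ^^ k) g | k. True}"
  show "\<exists>g'\<in>insert f {(deriv ^^ k) g | k. True}. \<forall>x. (h has_real_derivative g' x) (at x)"
  proof (cases "h = f")
    case True
    have "g = (deriv ^^ 0) g" by simp
    then show ?thesis using assms(1) True by (intro bexI[of _ g]) blast+
  next
    case False
    then obtain k where k: "h = (deriv ^^ k) g" using h by blast
    show ?thesis
      by (rule bexI[of _ "(deriv ^^ Suc k) g"]) (use assms(2) k smooth1_differentiable_funpow in blast)+
  qed
qed simp

lemma bump_1_nonneg: "0 \<le> bump 1 0 t"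
  by (simp add: bump_def)

lemma bump_mass_pos: "0 < antideriv (bump 1 0) 1"
proof -
  have cont: "continuous_on {-1..1} (bump 1 0)"
    using DERIV_isCont[OF bump_DERIV] by (intro continuous_at_imp_continuous_on) auto
  have "antideriv (bump 1 0) 1 \<noteq> 0"
  proof
    assume "antideriv (bump 1 0) 1 = 0"
    then have "bump 1 0 (1/2) = 0"
      using integral_eq_0_iff[OF cont, of] bump_1_nonneg by (auto simp: antideriv_def)
    then show False by (simp add: bump_def)
  qed
  moreover have "0 \<le> antideriv (bump 1 0) 1"
    unfolding antideriv_def using bump_1_nonneg
    by (intro integral_nonneg integrable_continuous_interval cont) auto
  ultimately show ?thesis by linarith
qed

lemma spline_nonpos: "t \<le> 0 \<Longrightarrow> spline k t = 0"
proof (induction k arbitrary: t)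
  case 0
  then show ?case by (simp add: mollifier_def bump_def)
next
  case (Suc k)
  then show ?case using antideriv_nonpos[of "spline k"] by simp
qed

lemma spline_step:
  assumes "smooth1 (spline k)"
  shows "(antideriv (spline k) has_real_derivative spline k t) (at t)"
    and "(spline (Suc k) has_real_derivative spline k t - spline k (t - 1)) (at t)"
proof -
  show *: "(antideriv (spline k) has_real_derivative spline k t) (at t)" for t
    using assms smooth1_isCont spline_nonpos by (intro antideriv_DERIV) auto
  have "((\<lambda>t. antideriv (spline k) (t - 1)) has_real_derivative spline k (t - 1)) (at t)"
  proof -
    have "((\<lambda>t. t - 1) has_real_derivative 1) (at t)" by (auto intro!: derivative_eq_intros)
    from DERIV_chain2[where g = "\<lambda>t. t - 1", OF * this] show ?thesis by simp
  qed
  then show "(spline (Suc k) has_real_derivative spline k t - spline k (t - 1)) (at t)"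
    using DERIV_diff[OF *] by simp
qed

lemma smooth1_spline: "smooth1 (spline k)"
proof (induction k)
  case 0
  show ?case using smooth1_bump[of "1 / antideriv (bump 1 0) 1" 1 0] by (simp add: mollifier_def[abs_def])
next
  case (Suc k)
  have "smooth1 (\<lambda>t. spline k (1 * t + (-1)))" by (rule smooth1_affine[OF Suc])
  then show ?case using smooth1_diff[OF Suc] spline_step(2)[OF Suc]
    by (intro smooth1_cong_DERIV[where f = "spline (Suc k)" and g = "\<lambda>t. spline k t - spline k (t - 1)"]) auto
qed

lemma deriv_spline:
  "(deriv ^^ Suc j) (spline (Suc k)) t = (deriv ^^ j) (spline k) t - (deriv ^^ j) (spline k) (t - 1)"
proof -
  have sm: "smooth1 (\<lambda>t. spline k (1 * t + (-1)))" by (rule smooth1_affine[OF smooth1_spline])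
  have "deriv (spline (Suc k)) = (\<lambda>t. spline k t - spline k (1 * t + (-1)))"
    using spline_step(2)[OF smooth1_spline] by (intro ext DERIV_imp_deriv) auto
  then have "(deriv ^^ Suc j) (spline (Suc k)) t = (deriv ^^ j) (\<lambda>t. spline k t - spline k (1 * t + (-1))) t"
    by (simp only: funpow_Suc_right o_apply)
  also have "\<dots> = (deriv ^^ j) (spline k) t - (deriv ^^ j) (spline k) (t - 1)"
    unfolding deriv_funpow_diff[OF smooth1_spline sm] smooth1_affine(2)[OF smooth1_spline] by simp
  finally show ?thesis .
qed

lemma antideriv_spline_mono:
  assumes "\<And>t. 0 \<le> spline k t" "s \<le> t"
  shows "antideriv (spline k) s \<le> antideriv (spline k) t"
  using assms(2)
proof (rule DERIV_nonneg_imp_nondecreasing)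
  show "\<exists>y. (antideriv (spline k) has_real_derivative y) (at x) \<and> 0 \<le> y" for x
    by (intro exI conjI) (rule spline_step(1)[OF smooth1_spline], rule assms(1))
qed

lemma spline_nonneg: "0 \<le> spline k t"
proof (induction k arbitrary: t)
  case 0
  show ?case using bump_mass_pos bump_1_nonneg by (simp add: mollifier_def)
next
  case (Suc k)
  show ?case using antideriv_spline_mono[of k "t - 1" t] Suc by simp
qed

lemma antideriv_spline_const_aux:
  assumes "\<And>t. real k + 1 \<le> t \<Longrightarrow> spline k t = 0" "real k + 1 \<le> t"
  shows "antideriv (spline k) t = antideriv (spline k) (k + 1)"
proof (cases "t = k + 1")
  case False
  then have "real k + 1 < t" using assms(2) by simp
  then obtain z :: real where "z > real k + 1"
    "antideriv (spline k) t - antideriv (spline k) (real k + 1) = (t - (real k + 1)) * spline k z"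
    using MVT2[of "real k + 1" t "antideriv (spline k)" "spline k"] spline_step(1)[OF smooth1_spline] by blast
  then show ?thesis using assms(1)[of z] by (simp add: add.commute)
qed simp

lemma spline_eq_0: "real k + 1 \<le> t \<Longrightarrow> spline k t = 0"
proof (induction k arbitrary: t)
  case 0
  then show ?case by (simp add: mollifier_def bump_def)
next
  case (Suc k)
  have "antideriv (spline k) s = antideriv (spline k) (k + 1)" if "real k + 1 \<le> s" for s
    using Suc.IH that by (rule antideriv_spline_const_aux)
  from this[of t] this[of "t - 1"] show ?case using Suc.prems by simp
qed

lemma antideriv_spline_const: "real k + 1 \<le> t \<Longrightarrow> antideriv (spline k) t = antideriv (spline k) (k + 1)"
  by (rule antideriv_spline_const_aux[OF spline_eq_0])

lemma antideriv_mollifier: "antideriv (spline 0) 1 = 1"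
proof -
  have "antideriv (spline 0) 1 = 1 / antideriv (bump 1 0) 1 * integral {-1..1} (bump 1 0)"
    unfolding antideriv_def[of "spline 0"] by (simp add: mollifier_def[abs_def])
  then show ?thesis using bump_mass_pos by (simp add: antideriv_def)
qed

text \<open>At order one, the value is a difference of two values of a primitive that rises from 0
  to 1. Afterwards it is an increment over unit length of a primitive with slope at most 1. The
  mollifier itself has integral 1 over the unit interval and vanishes at its ends, so it exceeds 1
  somewhere; hence the start at \<open>Suc\<close>.\<close>

lemma spline_le_1: "spline (Suc k) t \<le> 1"
proof (induction k arbitrary: t)
  case 0
  have "antideriv (spline 0) t \<le> 1"
  proof (cases "t \<le> 1")
    case True
    then show ?thesis using antideriv_spline_mono[OF spline_nonneg, of t 1 0] antideriv_mollifier by simp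
  next
    case False
    then show ?thesis using antideriv_spline_const[of 0 t] antideriv_mollifier by simp
  qed
  moreover have "0 \<le> antideriv (spline 0) (t - 1)"
  proof (cases "t - 1 \<le> 0")
    case True
    then show ?thesis using antideriv_nonpos[of "spline 0" "t - 1", OF spline_nonpos] by simp
  next
    case False
    then show ?thesis using antideriv_spline_mono[OF spline_nonneg, of 0 "t - 1" 0]
        antideriv_nonpos[of "spline 0" 0, OF spline_nonpos] by simp
  qed
  ultimately show ?case by simp
next
  case (Suc k)
  have "t - 1 < t" by simp
  then obtain z where "antideriv (spline (Suc k)) t - antideriv (spline (Suc k)) (t - 1) = (t - (t - 1)) * spline (Suc k) z"
    using MVT2[of "t - 1" t "antideriv (spline (Suc k))" "spline (Suc k)"] spline_step(1)[OF smooth1_spline] by blast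
  then show ?case using Suc[of z] by (simp only: spline.simps(2)[of "Suc k"]) simp
qed

text \<open>The sum of the integer translates telescopes to a difference of the primitive of the
  mollifier, evaluated where it is already 1 and where it is still 0.\<close>

lemma spline_partition:
  fixes a b :: int and t :: real
  assumes "a \<le> b" "a + 1 \<le> t" "t \<le> b + 1"
  shows "(\<Sum>z\<in>{a..b}. spline 1 (t - z)) = 1"
proof -
  have "(\<Sum>z\<in>{a..b}. spline 1 (t - z)) = antideriv (spline 0) (t - a) - antideriv (spline 0) (t - b - 1)"
    using assms(1)
  proof (induction b rule: int_ge_induct)
    case (step b)
    then have "{a..b + 1} = insert (b + 1) {a..b}" by auto
    with step show ?case by (simp add: algebra_simps)
  qed simp
  moreover have "antideriv (spline 0) (t - a) = 1"
    using antideriv_spline_const[of 0 "t - a"] antideriv_mollifier assms by simp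
  moreover have "antideriv (spline 0) (t - b - 1) = 0"
    using assms by (intro antideriv_nonpos[of "spline 0", OF spline_nonpos]) auto
  ultimately show ?thesis by simp
qed

subsection \<open>Lattice averages of Sobolev functions\<close>

lemma prod_coordinates_has_derivative:
  fixes c c' :: "'n::finite \<Rightarrow> real \<Rightarrow> real"
  assumes "\<And>l t. (c l has_real_derivative c' l t) (at t)"
  shows "((\<lambda>x :: real^'n. \<Prod>l\<in>UNIV. c l (x $ l)) has_derivative
    (\<lambda>h. \<Sum>l\<in>UNIV. c' l (x $ l) * h $ l * (\<Prod>j\<in>UNIV - {l}. c j (x $ j)))) (at x)"
proof (rule has_derivative_prod)
  fix l
  have "((\<lambda>x :: real^'n. x $ l) has_derivative (\<lambda>h. h $ l)) (at x)"
    by (rule bounded_linear.has_derivative[OF bounded_linear_vec_nth has_derivative_ident])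
  moreover have "(c l has_derivative (\<lambda>h. c' l (x $ l) * h)) (at (x $ l))"
    using assms[of l "x $ l"] by (simp add: has_field_derivative_def)
  ultimately show "((\<lambda>x :: real^'n. c l (x $ l)) has_derivative (\<lambda>h. c' l (x $ l) * h $ l)) (at x)"
    by (rule has_derivative_compose)
qed

lemma partial_deriv_prod_coordinates:
  fixes c c' :: "'n::finite \<Rightarrow> real \<Rightarrow> real"
  assumes "\<And>l t. (c l has_real_derivative c' l t) (at t)"
  shows "partial_deriv i (\<lambda>x :: real^'n. \<Prod>l\<in>UNIV. c l (x $ l)) x
    = c' i (x $ i) * (\<Prod>j\<in>UNIV - {i}. c j (x $ j))"
proof -
  have "partial_deriv i (\<lambda>x :: real^'n. \<Prod>l\<in>UNIV. c l (x $ l)) x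
      = (\<Sum>l\<in>UNIV. c' l (x $ l) * axis i 1 $ l * (\<Prod>j\<in>UNIV - {l}. c j (x $ j)))"
    unfolding partial_deriv_def frechet_derivative_at[OF prod_coordinates_has_derivative[OF assms], symmetric] ..
  also have "\<dots> = (\<Sum>l\<in>UNIV. if l = i then c' i (x $ i) * (\<Prod>j\<in>UNIV - {i}. c j (x $ j)) else 0)"
    by (intro sum.cong) (auto simp: axis_def)
  finally show ?thesis by simp
qed

text \<open>A partial derivative acts on one factor only, so only the number of occurrences of each
  direction in the list matters.\<close>

lemma partial_derivs_prod_coordinates:
  fixes c :: "'n::finite \<Rightarrow> real \<Rightarrow> real"
  assumes sm: "\<And>l. smooth1 (c l)"
  shows "partial_derivs is (\<lambda>x :: real^'n. \<Prod>l\<in>UNIV. c l (x $ l))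
    = (\<lambda>x. \<Prod>l\<in>UNIV. (deriv ^^ count_list is l) (c l) (x $ l))"
proof (induction "is")
  case Nil
  show ?case by (simp add: partial_derivs_def)
next
  case (Cons i "is")
  have D: "((deriv ^^ count_list is l) (c l) has_real_derivative (deriv ^^ Suc (count_list is l)) (c l) t) (at t)" for l t
    by (rule smooth1_differentiable_funpow[OF sm])
  show ?case
  proof
    fix x :: "real^'n"
    have "partial_derivs (i # is) (\<lambda>x :: real^'n. \<Prod>l\<in>UNIV. c l (x $ l)) x
        = partial_deriv i (\<lambda>x :: real^'n. \<Prod>l\<in>UNIV. (deriv ^^ count_list is l) (c l) (x $ l)) x"
      using Cons by (simp add: partial_derivs_def)
    also have "\<dots> = (deriv ^^ Suc (count_list is i)) (c i) (x $ i) * (\<Prod>j\<in>UNIV - {i}. (deriv ^^ count_list is j) (c j) (x $ j))"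
      by (rule partial_deriv_prod_coordinates[OF D])
    also have "(\<Prod>j\<in>UNIV - {i}. (deriv ^^ count_list is j) (c j) (x $ j))
        = (\<Prod>j\<in>UNIV - {i}. (deriv ^^ count_list (i # is) j) (c j) (x $ j))"
      by (intro prod.cong) auto
    also have "(deriv ^^ Suc (count_list is i)) (c i) (x $ i) * \<dots>
        = (\<Prod>l\<in>UNIV. (deriv ^^ count_list (i # is) l) (c l) (x $ l))"
      using prod.remove[of UNIV i "\<lambda>l. (deriv ^^ count_list (i # is) l) (c l) (x $ l)"]
      by (simp del: funpow.simps)
    finally show "partial_derivs (i # is) (\<lambda>x :: real^'n. \<Prod>l\<in>UNIV. c l (x $ l)) x
        = (\<Prod>l\<in>UNIV. (deriv ^^ count_list (i # is) l) (c l) (x $ l))" .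
  qed
qed

lemma test_function_prod_coordinates:
  fixes c :: "'n::finite \<Rightarrow> real \<Rightarrow> real"
  assumes sm: "\<And>l. smooth1 (c l)" and supp: "\<And>l t. c l t \<noteq> 0 \<Longrightarrow> a l \<le> t \<and> t \<le> b l"
  shows "test_function (\<lambda>x :: real^'n. \<Prod>l\<in>UNIV. c l (x $ l))"
  unfolding test_function_def
proof
  show "smooth (\<lambda>x :: real^'n. \<Prod>l\<in>UNIV. c l (x $ l))"
    unfolding smooth_def partial_derivs_prod_coordinates[OF sm] differentiable_def
    by (intro allI exI) (rule prod_coordinates_has_derivative, rule smooth1_differentiable_funpow[OF sm])
  have "{x :: real^'n. (\<Prod>l\<in>UNIV. c l (x $ l)) \<noteq> 0} \<subseteq> cbox (\<chi> l. a l) (\<chi> l. b l)"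
    using supp by (auto simp: mem_box_cart)
  then have "bounded {x :: real^'n. (\<Prod>l\<in>UNIV. c l (x $ l)) \<noteq> 0}"
    by (rule bounded_subset[OF bounded_cbox])
  then show "compact (closure {x :: real^'n. (\<Prod>l\<in>UNIV. c l (x $ l)) \<noteq> 0})" by simp
qed

text \<open>The spline order in direction \<open>l\<close> grows with the number of derivatives in
  that direction: the derivative along \<open>is\<close> of this kernel equals, up to sign and
  scale, the difference along \<open>is\<close> of the basic kernel for \<open>[]\<close>. Order 1
  is the base, as it gives a partition of unity.\<close>

definition spline_product :: "'n::finite list \<Rightarrow> nat \<Rightarrow> ('n \<Rightarrow> int) \<Rightarrow> real^'n \<Rightarrow> real" where
  "spline_product is m z y = (\<Prod>l\<in>UNIV. spline (Suc (count_list is l)) (2 ^ m * y $ l - z l))"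

definition lattice_average :: "(real^'n::finite \<Rightarrow> real) \<Rightarrow> nat \<Rightarrow> ('n \<Rightarrow> int) \<Rightarrow> real" where
  "lattice_average v m z = 2 ^ (m * CARD('n)) * (LINT y|lebesgue. v y * spline_product [] m z y)"

lemma spline_product_nonneg: "0 \<le> spline_product is m z y"
  unfolding spline_product_def by (intro prod_nonneg spline_nonneg ballI)

lemma spline_product_le_1: "spline_product is m z y \<le> 1"
  unfolding spline_product_def by (intro prod_le_1) (auto simp: spline_nonneg spline_le_1 simp del: spline.simps)

lemma spline_product_nonzero:
  assumes "spline_product is m z y \<noteq> 0"
  shows "0 < 2 ^ m * y $ l - z l" "2 ^ m * y $ l - z l < count_list is l + 2"
proof -
  have nz: "spline (Suc (count_list is l)) (2 ^ m * y $ l - z l) \<noteq> 0"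
    using assms unfolding spline_product_def by (simp del: spline.simps)
  show "0 < 2 ^ m * y $ l - z l" using nz spline_nonpos by (metis not_le)
  show "2 ^ m * y $ l - z l < count_list is l + 2"
    using nz spline_eq_0[of "Suc (count_list is l)" "2 ^ m * y $ l - z l"] by (force simp del: spline.simps)
qed

lemma continuous_spline_product: "continuous_on UNIV (spline_product is m (z :: 'n::finite \<Rightarrow> int))"
proof -
  have "continuous_on UNIV (\<lambda>y :: real^'n. spline (Suc (count_list is l)) (2 ^ m * y $ l - z l))" for l
    by (rule continuous_on_compose2[of UNIV "spline (Suc (count_list is l))"])
      (auto intro!: continuous_intros continuous_at_imp_continuous_on smooth1_isCont[OF smooth1_spline] simp del: spline.simps)
  then show ?thesis unfolding spline_product_def[abs_def] by (intro continuous_intros)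
qed

lemma measurable_spline_product [measurable]: "spline_product is m z \<in> borel_measurable lebesgue"
  using borel_measurable_continuous_onI[OF continuous_spline_product]
  by (intro measurable_completion) simp

lemma spline_product_derivs:
  fixes "is" :: "'n::finite list"
  shows "test_function (spline_product is m z)"
    and "partial_derivs is (spline_product is m z) y
      = 2 ^ (m * length is) * (\<Prod>l\<in>UNIV. (deriv ^^ count_list is l) (spline (Suc (count_list is l))) (2 ^ m * y $ l - z l))"
proof -
  define c where "c l t = spline (Suc (count_list is l)) (2 ^ m * t + (- real_of_int (z l)))" for l t
  have sm: "smooth1 (c l)" for l
    unfolding c_def by (rule smooth1_affine(1)[OF smooth1_spline])
  have eq: "spline_product is m z = (\<lambda>y. \<Prod>l\<in>UNIV. c l (y $ l))"
    by (simp add: spline_product_def[abs_def] c_def del: spline.simps)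
  show "test_function (spline_product is m z)"
    unfolding eq
  proof (rule test_function_prod_coordinates[OF sm, where a = "\<lambda>l. z l / 2 ^ m" and b = "\<lambda>l. (z l + count_list is l + 2) / 2 ^ m"])
    fix l t assume nz: "c l t \<noteq> 0"
    let ?u = "2 ^ m * t + (- real_of_int (z l))"
    have "0 < ?u" using nz spline_nonpos[of ?u] by (force simp: c_def simp del: spline.simps)
    moreover have "?u < count_list is l + 2"
      using nz spline_eq_0[of "Suc (count_list is l)" ?u] by (force simp: c_def simp del: spline.simps)
    ultimately show "z l / 2 ^ m \<le> t \<and> t \<le> (z l + count_list is l + 2) / 2 ^ m"
      by (simp add: field_simps)
  qed
  have "partial_derivs is (spline_product is m z) y = (\<Prod>l\<in>UNIV. (deriv ^^ count_list is l) (c l) (y $ l))"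
    unfolding eq partial_derivs_prod_coordinates[OF sm] ..
  also have "\<dots> = (\<Prod>l\<in>UNIV. (2 ^ m) ^ count_list is l *
      (deriv ^^ count_list is l) (spline (Suc (count_list is l))) (2 ^ m * y $ l - z l))"
    unfolding c_def smooth1_affine(2)[OF smooth1_spline] by simp
  also have "\<dots> = (2 ^ m) ^ (\<Sum>l\<in>UNIV. count_list is l) *
      (\<Prod>l\<in>UNIV. (deriv ^^ count_list is l) (spline (Suc (count_list is l))) (2 ^ m * y $ l - z l))"
    by (simp only: prod.distrib power_sum)
  also have "(\<Sum>l\<in>UNIV. count_list is l) = length is"
    by (rule sum_count_set) auto
  finally show "partial_derivs is (spline_product is m z) y
      = 2 ^ (m * length is) * (\<Prod>l\<in>UNIV. (deriv ^^ count_list is l) (spline (Suc (count_list is l))) (2 ^ m * y $ l - z l))"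
    by (simp only: power_mult)
qed

section \<open>Differences of the samples as averages of weak derivatives\<close>

text \<open>A forward difference in \<open>z\<close> moves the spline's argument back by one, so it
  is minus a backward difference, that is, minus the derivative of the spline of next order. The
  chain rule accounts for 2^m per derivative.\<close>

lemma fdiffs_spline_product:
  fixes "is" :: "'n::finite list"
  shows "fdiffs is (\<lambda>z. spline_product [] m z y) z * 2 ^ (m * length is)
    = (- 1) ^ length is * partial_derivs is (spline_product is m z) y"
proof -
  have "fdiffs is (\<lambda>z. spline_product [] m z y) z = (- 1) ^ length is *
      (\<Prod>l\<in>UNIV. (deriv ^^ count_list is l) (spline (Suc (count_list is l))) (2 ^ m * y $ l - z l))"
  proof (induction "is" arbitrary: z)
    case Nil
    show ?case by (simp add: fdiffs_def spline_product_def)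
  next
    case (Cons i "is")
    let ?B = "\<lambda>l. (deriv ^^ count_list is l) (spline (Suc (count_list is l)))"
    let ?p = "\<lambda>z::'n \<Rightarrow> int. \<Prod>l\<in>UNIV. ?B l (2 ^ m * y $ l - z l)"
    let ?r = "\<Prod>l\<in>UNIV - {i}. ?B l (2 ^ m * y $ l - z l)"
    have "?p (z(i := z i + 1)) = ?B i (2 ^ m * y $ i - (z i + 1)) * (\<Prod>l\<in>UNIV - {i}. ?B l (2 ^ m * y $ l - (z(i := z i + 1)) l))"
      by (subst prod.remove[of UNIV i]) (simp_all del: spline.simps)
    also have "(\<Prod>l\<in>UNIV - {i}. ?B l (2 ^ m * y $ l - (z(i := z i + 1)) l)) = ?r"
      by (intro prod.cong) (auto simp del: spline.simps)
    finally have p1: "?p (z(i := z i + 1)) = ?B i (2 ^ m * y $ i - (z i + 1)) * ?r" .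
    have p0: "?p z = ?B i (2 ^ m * y $ i - z i) * ?r"
      by (subst prod.remove[of UNIV i]) (simp_all del: spline.simps)
    have "fdiffs (i # is) (\<lambda>z. spline_product [] m z y) z
        = fdiffs is (\<lambda>z. spline_product [] m z y) (z(i := z i + 1)) - fdiffs is (\<lambda>z. spline_product [] m z y) z"
      by (simp add: fdiffs_def fdiff_def)
    also have "\<dots> = (- 1) ^ length is * ((?B i (2 ^ m * y $ i - (z i + 1)) - ?B i (2 ^ m * y $ i - z i)) * ?r)"
      unfolding Cons p0 p1 by (simp only: right_diff_distrib left_diff_distrib)
    also have "?B i (2 ^ m * y $ i - (z i + 1)) - ?B i (2 ^ m * y $ i - z i)
        = - (deriv ^^ count_list (i # is) i) (spline (Suc (count_list (i # is) i))) (2 ^ m * y $ i - z i)"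
      using deriv_spline[of "count_list is i" "Suc (count_list is i)" "2 ^ m * y $ i - z i"]
      by (simp add: diff_diff_eq del: spline.simps funpow.simps)
    also have "?r = (\<Prod>l\<in>UNIV - {i}. (deriv ^^ count_list (i # is) l) (spline (Suc (count_list (i # is) l))) (2 ^ m * y $ l - z l))"
      by (intro prod.cong) (auto simp del: spline.simps)
    also have "(- 1) ^ length is * (- (deriv ^^ count_list (i # is) i) (spline (Suc (count_list (i # is) i))) (2 ^ m * y $ i - z i) * \<dots>)
        = (- 1) ^ length (i # is) * (\<Prod>l\<in>UNIV. (deriv ^^ count_list (i # is) l) (spline (Suc (count_list (i # is) l))) (2 ^ m * y $ l - z l))"
      using prod.remove[of UNIV i "\<lambda>l. (deriv ^^ count_list (i # is) l) (spline (Suc (count_list (i # is) l))) (2 ^ m * y $ l - z l)"]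
      by (simp del: spline.simps funpow.simps count_list.simps)
    finally show ?case .
  qed
  then show ?thesis unfolding spline_product_derivs(2) by (simp only: mult_ac)
qed

lemma integrable_mult_spline_product:
  assumes "integrable lebesgue v"
  shows "integrable lebesgue (\<lambda>y. v y * spline_product is m z y)"
proof (rule Bochner_Integration.integrable_bound[OF assms])
  show "(\<lambda>y. v y * spline_product is m z y) \<in> borel_measurable lebesgue"
    using assms by (intro borel_measurable_times measurable_spline_product) auto
  have "\<bar>v y\<bar> * spline_product is m z y \<le> \<bar>v y\<bar>" for y
    using spline_product_le_1[of "is" m z y] spline_product_nonneg[of "is" m z y] by (intro mult_left_le) auto
  then show "AE y in lebesgue. norm (v y * spline_product is m z y) \<le> norm (v y)"
    using spline_product_nonneg[of "is" m z] by (simp add: abs_mult)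
qed

lemma fdiffs_integral:
  fixes K :: "'a \<Rightarrow> ('n::finite \<Rightarrow> int) \<Rightarrow> real"
  assumes "\<And>z. integrable M (\<lambda>y. v y * K y z)"
  shows "integrable M (\<lambda>y. v y * fdiffs is (K y) z) \<and>
    fdiffs is (\<lambda>z. c * (LINT y|M. v y * K y z)) z = c * (LINT y|M. v y * fdiffs is (K y) z)"
proof (induction "is" arbitrary: z)
  case Nil
  then show ?case using assms by (simp add: fdiffs_def)
next
  case (Cons i "is")
  have "v y * fdiffs (i # is) (K y) z = v y * fdiffs is (K y) (z(i := z i + 1)) - v y * fdiffs is (K y) z" for y
    by (simp add: fdiffs_def fdiff_def right_diff_distrib)
  moreover have "fdiffs (i # is) F z = fdiffs is F (z(i := z i + 1)) - fdiffs is F z" for F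
    by (simp add: fdiffs_def fdiff_def)
  ultimately show ?case using Cons by (simp add: right_diff_distrib del: fun_upd_apply)
qed

text \<open>The difference passes to the kernel, where it is a derivative of a test function; the
  weak derivative then moves it to \<open>v\<close>, and the two signs cancel.\<close>

lemma fdiffs_lattice_average:
  fixes v :: "real^'n::finite \<Rightarrow> real"
  assumes v: "integrable lebesgue v" and g: "has_weak_deriv v is g"
  shows "fdiffs is (lattice_average v m) z * 2 ^ (m * length is)
    = 2 ^ (m * CARD('n)) * (LINT y|lebesgue. g y * spline_product is m z y)"
proof -
  have "fdiffs is (lattice_average v m) z
      = 2 ^ (m * CARD('n)) * (LINT y|lebesgue. v y * fdiffs is (\<lambda>z. spline_product [] m z y) z)"
    unfolding lattice_average_def[abs_def]
    using fdiffs_integral[of lebesgue v "\<lambda>y z. spline_product [] m z y"] integrable_mult_spline_product[OF v] by blast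
  then have "fdiffs is (lattice_average v m) z * 2 ^ (m * length is)
      = 2 ^ (m * CARD('n)) * (LINT y|lebesgue. v y * (fdiffs is (\<lambda>z. spline_product [] m z y) z * 2 ^ (m * length is)))"
    by (simp add: mult.assoc[symmetric])
  also have "(LINT y|lebesgue. v y * (fdiffs is (\<lambda>z. spline_product [] m z y) z * 2 ^ (m * length is)))
      = (- 1) ^ length is * (LINT y|lebesgue. v y * partial_derivs is (spline_product is m z) y)"
    unfolding fdiffs_spline_product
    by (simp only: mult.left_commute[of "v _" "(- 1) ^ length is"] integral_mult_right_zero)
  also have "\<dots> = (- 1) ^ length is * ((- 1) ^ length is * (LINT y|lebesgue. g y * spline_product is m z y))"
    using g spline_product_derivs(1)[of "is" m z] unfolding has_weak_deriv_def by simp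
  finally show ?thesis by (simp add: mult.assoc[symmetric] power_add[symmetric])
qed

text \<open>|g| is at most \<open>k\<close> plus its part above height \<open>k\<close>. Dominated
  convergence makes the latter small for some \<open>k\<close>, and on a set of measure
  \<epsilon>/(2(k+1)) the former contributes at most \<epsilon>/2.\<close>

lemma uniform_integrability:
  fixes g :: "'a \<Rightarrow> real"
  assumes g: "integrable M g" and "\<epsilon> > 0"
  shows "\<exists>\<eta>>0. \<forall>S\<in>sets M. emeasure M S \<le> ennreal \<eta> \<longrightarrow> (LINT x|M. \<bar>g x\<bar> * indicator S x) \<le> \<epsilon>"
proof -
  have [measurable]: "g \<in> borel_measurable M" using g by auto
  let ?t = "\<lambda>k x. \<bar>g x\<bar> * indicator {x. real k < \<bar>g x\<bar>} x"
  have "(\<lambda>k. LINT x|M. ?t k x) \<longlonglongrightarrow> (LINT x|M. 0)"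
  proof (rule integral_dominated_convergence[where w = "\<lambda>x. \<bar>g x\<bar>"])
    show "AE x in M. (\<lambda>k. ?t k x) \<longlonglongrightarrow> 0"
    proof (rule AE_I2)
      fix x
      obtain k0 :: nat where "\<bar>g x\<bar> \<le> k0" using real_arch_simple by blast
      then have "\<forall>k\<ge>k0. ?t k x = 0" by (auto simp: indicator_def)
      then show "(\<lambda>k. ?t k x) \<longlonglongrightarrow> 0"
        by (intro tendsto_eventually) (auto simp: eventually_sequentially)
    qed
  qed (use g in \<open>auto simp: indicator_def\<close>)
  then have "eventually (\<lambda>k. (LINT x|M. ?t k x) < \<epsilon> / 2) sequentially"
    using \<open>\<epsilon> > 0\<close> by (intro order_tendstoD(2)) auto
  then obtain k where k: "(LINT x|M. ?t k x) < \<epsilon> / 2"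
    by (auto simp: eventually_sequentially)
  have int_t: "integrable M (?t k)"
    by (rule Bochner_Integration.integrable_bound[OF g]) (auto simp: indicator_def)
  show ?thesis
  proof (intro exI[of _ "\<epsilon> / (2 * (k + 1))"] conjI ballI impI)
    show "0 < \<epsilon> / (2 * (k + 1))" using \<open>\<epsilon> > 0\<close> by simp
    fix S assume S [measurable]: "S \<in> sets M" and small: "emeasure M S \<le> ennreal (\<epsilon> / (2 * (k + 1)))"
    have fin: "emeasure M S < \<infinity>" using small by (rule order_le_less_trans) simp
    then have int_S: "integrable M (indicat_real S)" by (simp add: S)
    have mS: "measure M S \<le> \<epsilon> / (2 * (k + 1))"
      using small \<open>\<epsilon> > 0\<close> by (auto simp: measure_def intro!: enn2real_leI)
    have "(LINT x|M. \<bar>g x\<bar> * indicator S x) \<le> (LINT x|M. k * indicat_real S x + ?t k x)"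
    proof (rule integral_mono)
      show "integrable M (\<lambda>x. \<bar>g x\<bar> * indicator S x)"
        by (rule Bochner_Integration.integrable_bound[OF g]) (auto simp: indicator_def)
      show "integrable M (\<lambda>x. k * indicat_real S x + ?t k x)" using int_S int_t by auto
    qed (auto simp: indicator_def)
    also have "\<dots> = k * measure M S + (LINT x|M. ?t k x)"
      using int_S int_t S fin by simp
    also have "\<dots> \<le> k * (\<epsilon> / (2 * (k + 1))) + \<epsilon> / 2"
      using k mS by (intro add_mono mult_left_mono) auto
    also have "\<dots> \<le> \<epsilon>"
    proof -
      have "k * (\<epsilon> / (2 * (k + 1))) = \<epsilon> / 2 * (k / (k + 1))" by simp
      also have "\<dots> \<le> \<epsilon> / 2 * 1" using \<open>\<epsilon> > 0\<close> by (intro mult_left_mono) auto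
      finally show ?thesis by linarith
    qed
    finally show "(LINT x|M. \<bar>g x\<bar> * indicator S x) \<le> \<epsilon>" .
  qed
qed


text \<open>No direction occurs more than N times in \<open>is\<close>, so a kernel lives in a box
  of side (N+2)/2^m, and at a fixed \<open>y\<close> at most N + 3 integers per coordinate are
  relevant. The constant \<open>K\<close> bounds both the scaled volume and the overlap.\<close>

lemma spline_product_support:
  fixes A :: "('n::finite \<Rightarrow> int) set" and K :: real
  defines "K \<equiv> (real CARD('n) + 3) ^ CARD('n)"
  assumes "finite A" and len: "length is \<le> CARD('n)"
  shows "\<exists>S\<in>sets lebesgue. emeasure lebesgue S \<le> ennreal (card A * K / 2 ^ (m * CARD('n))) \<and>
    (\<forall>y. (\<Sum>z\<in>A. spline_product is m z y) \<le> K * indicator S y)"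
proof -
  let ?N = "CARD('n)"
  let ?C = "\<lambda>z :: 'n \<Rightarrow> int. cbox (\<chi> l. z l / 2 ^ m) (\<chi> l. (z l + ?N + 2) / 2 ^ m)"
  have cnt: "count_list is l \<le> ?N" for l using count_le_length[of "is" l] len by linarith
  have inC: "y \<in> ?C z" if "spline_product is m z y \<noteq> 0" for z y
  proof -
    have "z l / 2 ^ m \<le> y $ l \<and> y $ l \<le> (z l + ?N + 2) / 2 ^ m" for l
    proof -
      have "real (count_list is l) \<le> ?N" using cnt[of l] by simp
      then have "0 < 2 ^ m * y $ l - z l" "2 ^ m * y $ l - z l < ?N + 2"
        using spline_product_nonzero[OF that, of l] by linarith+
      then show ?thesis by (simp add: field_simps)
    qed
    then show ?thesis by (simp add: mem_box_cart)
  qed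
  have C: "emeasure lebesgue (?C z) \<le> ennreal (K / 2 ^ (m * ?N))" for z
  proof -
    have ne: "?C z \<noteq> {}" by (simp add: interval_ne_empty_cart divide_right_mono)
    have "measure lebesgue (?C z) = (\<Prod>l\<in>(UNIV::'n set). (?N + 2) / 2 ^ m)"
      using content_cbox_cart[OF ne] by (simp add: diff_divide_distrib[symmetric] add.commute)
    also have "\<dots> = (?N + 2) ^ ?N / 2 ^ (m * ?N)" by (simp add: power_divide power_mult)
    also have "\<dots> \<le> K / 2 ^ (m * ?N)"
      unfolding K_def by (intro divide_right_mono) (auto intro!: power_mono)
    finally have "measure lebesgue (?C z) \<le> K / 2 ^ (m * ?N)" .
    moreover have "emeasure lebesgue (?C z) = ennreal (measure lebesgue (?C z))"
      by (intro emeasure_eq_ennreal_measure) (simp add: emeasure_lborel_cbox_eq)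
    ultimately show ?thesis by (simp only: ennreal_leI)
  qed
  have Ksum: "(\<Sum>z\<in>A. spline_product is m z y) \<le> K" for y
  proof -
    let ?T = "PiE UNIV (\<lambda>l. {\<lfloor>2 ^ m * y $ l\<rfloor> - ?N - 2 .. \<lfloor>2 ^ m * y $ l\<rfloor>})"
    have "(\<Sum>z\<in>A. spline_product is m z y) \<le> (\<Sum>z\<in>A. indicator ?T z)"
    proof (intro sum_mono)
      fix z
      show "spline_product is m z y \<le> indicator ?T z"
      proof (cases "spline_product is m z y = 0")
        case False
        have "z l \<in> {\<lfloor>2 ^ m * y $ l\<rfloor> - ?N - 2 .. \<lfloor>2 ^ m * y $ l\<rfloor>}" for l
        proof -
          have "real (count_list is l) \<le> ?N" using cnt[of l] by simp
          then have "0 < 2 ^ m * y $ l - z l" "2 ^ m * y $ l - z l < ?N + 2"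
            using spline_product_nonzero[OF False, of l] by linarith+
          then show ?thesis by (simp add: le_floor_iff) linarith
        qed
        then have "z \<in> ?T" by auto
        then show ?thesis using spline_product_le_1 by simp
      qed simp
    qed
    also have "\<dots> = card (?T \<inter> A)" using \<open>finite A\<close> by (rule sum_indicat_real)
    also have "\<dots> \<le> card ?T" by (intro of_nat_mono card_mono finite_PiE) auto
    also have "\<dots> = K"
    proof -
      have "nat (1 + (int ?N + 2)) = ?N + 3" by simp
      then show ?thesis by (simp add: card_PiE K_def)
    qed
    finally show ?thesis .
  qed
  show ?thesis
  proof (intro bexI[of _ "\<Union>z\<in>A. ?C z"] conjI allI)
    show "(\<Union>z\<in>A. ?C z) \<in> sets lebesgue" using \<open>finite A\<close> by (intro sets.finite_UN) auto
    have "emeasure lebesgue (\<Union>z\<in>A. ?C z) \<le> (\<Sum>z\<in>A. emeasure lebesgue (?C z))"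
      using \<open>finite A\<close> by (intro emeasure_subadditive_finite) auto
    also have "\<dots> \<le> (\<Sum>z\<in>A. ennreal (K / 2 ^ (m * ?N)))" by (intro sum_mono C)
    also have "\<dots> = ennreal (card A * K / 2 ^ (m * ?N))"
      by (simp add: K_def ennreal_of_nat_eq_real_of_nat ennreal_mult[symmetric])
    finally show "emeasure lebesgue (\<Union>z\<in>A. ?C z) \<le> ennreal (card A * K / 2 ^ (m * ?N))" .
    fix y
    show "(\<Sum>z\<in>A. spline_product is m z y) \<le> K * indicator (\<Union>z\<in>A. ?C z) y"
    proof (cases "y \<in> (\<Union>z\<in>A. ?C z)")
      case False
      then have "spline_product is m z y = 0" if "z \<in> A" for z using inC that by blast
      then show ?thesis using False by simp
    qed (use Ksum in simp)
  qed
qed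

text \<open>For each \<open>is\<close> one integrable \<open>g\<close> serves all meshes: a sum over
  \<open>A\<close> is controlled by the integral of |g| over a set of measure at most a constant
  times card A / 2^(m*N). Enlarging that set to the whole space gives the uniform bound; keeping it
  transfers the uniform integrability of \<open>g\<close>.\<close>

lemma lattice_average_family:
  fixes v :: "real^'n::finite \<Rightarrow> real"
  assumes "v \<in> sobolev_W1 CARD('n)"
  shows "lattice_family (lattice_average v)"
proof -
  let ?N = "CARD('n)"
  define K where "K = (real ?N + 3) ^ ?N"
  have K: "K > 0" by (simp add: K_def add_pos_pos)
  have v: "integrable lebesgue v" using assms by (simp add: sobolev_W1_def)
  have est: "\<exists>S\<in>sets lebesgue. emeasure lebesgue S \<le> ennreal (card A * K / 2 ^ (m * ?N)) \<and>
      (\<Sum>z\<in>A. \<bar>fdiffs is (lattice_average v m) z\<bar>) * 2 ^ (m * length is)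
        \<le> K * (LINT y|lebesgue. \<bar>g y\<bar> * indicator S y) * 2 ^ (m * ?N)"
    if len: "length is \<le> ?N" and g: "integrable lebesgue g" "has_weak_deriv v is g" and A: "finite A" for "is" g m A
  proof -
    obtain S where S: "S \<in> sets lebesgue" "emeasure lebesgue S \<le> ennreal (card A * K / 2 ^ (m * ?N))"
      "\<And>y. (\<Sum>z\<in>A. spline_product is m z y) \<le> K * indicator S y"
      using spline_product_support[OF A len, of m] unfolding K_def by blast
    have "(\<Sum>z\<in>A. \<bar>fdiffs is (lattice_average v m) z\<bar>) * 2 ^ (m * length is)
        = (\<Sum>z\<in>A. \<bar>fdiffs is (lattice_average v m) z * 2 ^ (m * length is)\<bar>)"
      by (simp add: sum_distrib_right abs_mult)
    also have "\<dots> = 2 ^ (m * ?N) * (\<Sum>z\<in>A. \<bar>LINT y|lebesgue. g y * spline_product is m z y\<bar>)"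
      unfolding fdiffs_lattice_average[OF v g(2)] by (simp add: sum_distrib_left abs_mult)
    also have "(\<Sum>z\<in>A. \<bar>LINT y|lebesgue. g y * spline_product is m z y\<bar>)
        \<le> (\<Sum>z\<in>A. LINT y|lebesgue. \<bar>g y\<bar> * spline_product is m z y)"
    proof (intro sum_mono)
      fix z
      have "\<bar>LINT y|lebesgue. g y * spline_product is m z y\<bar> \<le> (LINT y|lebesgue. \<bar>g y * spline_product is m z y\<bar>)"
        by (rule integral_abs_bound)
      then show "\<bar>LINT y|lebesgue. g y * spline_product is m z y\<bar> \<le> (LINT y|lebesgue. \<bar>g y\<bar> * spline_product is m z y)"
        by (simp add: abs_mult spline_product_nonneg)
    qed
    also have "\<dots> = (LINT y|lebesgue. \<bar>g y\<bar> * (\<Sum>z\<in>A. spline_product is m z y))"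
      unfolding sum_distrib_left using g(1)
      by (intro Bochner_Integration.integral_sum[symmetric] integrable_mult_spline_product) auto
    also have "\<dots> \<le> (LINT y|lebesgue. K * (\<bar>g y\<bar> * indicator S y))"
    proof (rule integral_mono)
      show "integrable lebesgue (\<lambda>y. \<bar>g y\<bar> * (\<Sum>z\<in>A. spline_product is m z y))"
        unfolding sum_distrib_left using g(1)
        by (intro Bochner_Integration.integrable_sum integrable_mult_spline_product) auto
      show "integrable lebesgue (\<lambda>y. K * (\<bar>g y\<bar> * indicator S y))"
        using S(1) g(1) by (intro integrable_mult_right integrable_real_mult_indicator) auto
      show "\<bar>g y\<bar> * (\<Sum>z\<in>A. spline_product is m z y) \<le> K * (\<bar>g y\<bar> * indicator S y)" for y
        using mult_left_mono[OF S(3)[of y], of "\<bar>g y\<bar>"] by (simp add: mult_ac)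
    qed
    finally show ?thesis using S(1,2) by (intro bexI[of _ S]) (auto simp: mult_ac)
  qed
  show ?thesis
  proof
    fix "is" :: "'n list" assume len: "length is \<le> ?N"
    then obtain g where g: "integrable lebesgue g" "has_weak_deriv v is g"
      using assms by (auto simp: sobolev_W1_def)
    show "\<exists>C. \<forall>m A. finite A \<longrightarrow> (\<Sum>z\<in>A. \<bar>fdiffs is (lattice_average v m) z\<bar>) * 2 ^ (m * length is) \<le> C * 2 ^ (m * ?N)"
    proof (intro exI allI impI)
      fix m and A :: "('n \<Rightarrow> int) set" assume A: "finite A"
      obtain S where S: "S \<in> sets lebesgue" "(\<Sum>z\<in>A. \<bar>fdiffs is (lattice_average v m) z\<bar>) * 2 ^ (m * length is)
        \<le> K * (LINT y|lebesgue. \<bar>g y\<bar> * indicator S y) * 2 ^ (m * ?N)"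
        using est[OF len g A] by blast
      have "(LINT y|lebesgue. \<bar>g y\<bar> * indicator S y) \<le> (LINT y|lebesgue. \<bar>g y\<bar>)"
        using g(1) S(1) by (intro integral_mono integrable_real_mult_indicator) (auto simp: indicator_def)
      then have "K * (LINT y|lebesgue. \<bar>g y\<bar> * indicator S y) * 2 ^ (m * ?N) \<le> K * (LINT y|lebesgue. \<bar>g y\<bar>) * 2 ^ (m * ?N)"
        using K by (intro mult_right_mono mult_left_mono) auto
      with S(2) show "(\<Sum>z\<in>A. \<bar>fdiffs is (lattice_average v m) z\<bar>) * 2 ^ (m * length is)
        \<le> K * (LINT y|lebesgue. \<bar>g y\<bar>) * 2 ^ (m * ?N)" by linarith
    qed
    fix \<epsilon> :: real assume "\<epsilon> > 0"
    then have "\<epsilon> / K > 0" using K by simp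
    then obtain \<eta> where \<eta>: "\<eta> > 0" "\<And>S. S \<in> sets lebesgue \<Longrightarrow> emeasure lebesgue S \<le> ennreal \<eta> \<Longrightarrow>
        (LINT x|lebesgue. \<bar>g x\<bar> * indicator S x) \<le> \<epsilon> / K"
      using uniform_integrability[OF g(1)] by blast
    show "\<exists>\<eta>>0. \<forall>m A. finite A \<longrightarrow> real (card A) \<le> \<eta> * 2 ^ (m * ?N) \<longrightarrow>
      (\<Sum>z\<in>A. \<bar>fdiffs is (lattice_average v m) z\<bar>) * 2 ^ (m * length is) \<le> \<epsilon> * 2 ^ (m * ?N)"
    proof (intro exI[of _ "\<eta> / K"] conjI allI impI)
      show "\<eta> / K > 0" using \<eta> K by simp
      fix m and A :: "('n \<Rightarrow> int) set" assume A: "finite A" and few: "real (card A) \<le> \<eta> / K * 2 ^ (m * ?N)"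
      obtain S where S: "S \<in> sets lebesgue" "emeasure lebesgue S \<le> ennreal (card A * K / 2 ^ (m * ?N))"
        "(\<Sum>z\<in>A. \<bar>fdiffs is (lattice_average v m) z\<bar>) * 2 ^ (m * length is)
        \<le> K * (LINT y|lebesgue. \<bar>g y\<bar> * indicator S y) * 2 ^ (m * ?N)"
        using est[OF len g A] by blast
      have "card A * K / 2 ^ (m * ?N) \<le> \<eta>" using few K by (simp add: field_simps)
      then have "emeasure lebesgue S \<le> ennreal \<eta>" using S(2) by (meson ennreal_leI order_trans)
      then have "(LINT x|lebesgue. \<bar>g x\<bar> * indicator S x) \<le> \<epsilon> / K" by (rule \<eta>(2)[OF S(1)])
      then have "K * (LINT y|lebesgue. \<bar>g y\<bar> * indicator S y) * 2 ^ (m * ?N) \<le> K * (\<epsilon> / K) * 2 ^ (m * ?N)"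
        using K by (intro mult_right_mono mult_left_mono) auto
      also have "K * (\<epsilon> / K) = \<epsilon>" using K by simp
      finally show "(\<Sum>z\<in>A. \<bar>fdiffs is (lattice_average v m) z\<bar>) * 2 ^ (m * length is) \<le> \<epsilon> * 2 ^ (m * ?N)"
        using S(3) by linarith
    qed
  qed
qed

subsection \<open>Convergence to the precise representative\<close>

definition dyadic_index :: "nat \<Rightarrow> real^'n \<Rightarrow> 'n \<Rightarrow> int" where
  "dyadic_index m x = (\<lambda>l. \<lfloor>2 ^ m * x $ l\<rfloor>)"

definition lattice_point :: "nat \<Rightarrow> ('n::finite \<Rightarrow> int) \<Rightarrow> real^'n" where
  "lattice_point m z = (\<chi> l. z l / 2 ^ m)"

lemma half_power_tendsto_0: "(\<lambda>m. C / 2 ^ m :: real) \<longlonglongrightarrow> 0"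
proof -
  have "(\<lambda>m. C * (1 / 2) ^ m :: real) \<longlonglongrightarrow> C * 0"
    by (intro tendsto_mult_left LIMSEQ_power_zero) simp
  then show ?thesis by (simp add: power_one_over)
qed

lemma dist_lattice_point_le:
  fixes y :: "real^'n::finite"
  assumes "\<And>l. \<bar>2 ^ m * y $ l - z l\<bar> \<le> 2"
  shows "dist y (lattice_point m z) \<le> 2 * real CARD('n) / 2 ^ m"
proof -
  have "\<bar>(y - lattice_point m z) $ l\<bar> \<le> 2 / 2 ^ m" for l
    using assms[of l] by (simp add: lattice_point_def field_simps abs_le_iff)
  then have "norm (y - lattice_point m z) \<le> (\<Sum>l\<in>(UNIV::'n set). 2 / 2 ^ m)"
    by (intro order_trans[OF norm_le_l1_cart] sum_mono)
  then show ?thesis by (simp add: dist_norm mult.commute)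
qed

text \<open>The cutoffs differ from the indicator of the ball only in a shell that shrinks to the
  sphere, a null set. It serves both sums of kernels and unions of dyadic cells.\<close>

lemma integral_cutoff_tendsto:
  fixes u :: "real^'n::finite \<Rightarrow> real"
  assumes u: "integrable lebesgue u"
    and meas: "\<And>m. \<psi> m \<in> borel_measurable lebesgue"
    and bounds: "\<And>m y. 0 \<le> \<psi> m y \<and> \<psi> m y \<le> (1::real)"
    and inside: "\<And>m y. dist x y + C / 2 ^ m < r \<Longrightarrow> \<psi> m y = 1"
    and outside: "\<And>m y. dist x y > r + C / 2 ^ m \<Longrightarrow> \<psi> m y = 0"
  shows "(\<lambda>m. LINT y|lebesgue. u y * \<psi> m y) \<longlonglongrightarrow> (LINT y|lebesgue. u y * indicator (ball x r) y)"
proof (rule integral_dominated_convergence[where w = "\<lambda>y. \<bar>u y\<bar>"])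
  show "(\<lambda>y. u y * indicator (ball x r) y) \<in> borel_measurable lebesgue"
    using u by (intro borel_measurable_times borel_measurable_indicator) auto
  show "(\<lambda>y. u y * \<psi> m y) \<in> borel_measurable lebesgue" for m
    using u meas by (intro borel_measurable_times) auto
  show "integrable lebesgue (\<lambda>y. \<bar>u y\<bar>)" using u by simp
  show "AE y in lebesgue. norm (u y * \<psi> m y) \<le> \<bar>u y\<bar>" for m
    using bounds[of m] by (intro AE_I2) (simp add: abs_mult mult_left_le)
  have "sphere x r \<in> null_sets lebesgue"
    using negligible_sphere[of x r] by (simp add: negligible_iff_null_sets)
  then have "AE y in lebesgue. y \<notin> sphere x r" by (rule AE_not_in)
  then show "AE y in lebesgue. (\<lambda>m. u y * \<psi> m y) \<longlonglongrightarrow> u y * indicator (ball x r) y"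
  proof eventually_elim
    case (elim y)
    have "eventually (\<lambda>m. \<psi> m y = indicator (ball x r) y) sequentially"
    proof (cases "dist x y < r")
      case True
      then have "eventually (\<lambda>m. C / 2 ^ m < r - dist x y) sequentially"
        using order_tendstoD(2)[OF half_power_tendsto_0[of C]] by simp
      then show ?thesis
        by eventually_elim (use inside True in \<open>simp add: algebra_simps\<close>)
    next
      case False
      then have "dist x y > r" using elim by simp
      then have "eventually (\<lambda>m. C / 2 ^ m < dist x y - r) sequentially"
        using order_tendstoD(2)[OF half_power_tendsto_0[of C]] by simp
      then show ?thesis
        by eventually_elim (use outside False in \<open>simp add: algebra_simps\<close>)
    qed
    then show ?case by (intro tendsto_mult_left tendsto_eventually)
  qed
qed

section \<open>Sums of samples over lattice balls\<close>

definition lattice_ball :: "real^'n::finite \<Rightarrow> real \<Rightarrow> nat \<Rightarrow> ('n \<Rightarrow> int) set" where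
  "lattice_ball x r m = {z. dist x (lattice_point m z) < r}"

lemma lattice_ball_coordinate:
  assumes "z \<in> lattice_ball x r m"
  shows "\<bar>z l - 2 ^ m * x $ l\<bar> < r * 2 ^ m"
proof -
  have "\<bar>(x - lattice_point m z) $ l\<bar> < r"
    using component_le_norm_cart[of "x - lattice_point m z" l] assms
    by (simp add: lattice_ball_def dist_norm)
  then have "\<bar>x $ l - z l / 2 ^ m\<bar> * 2 ^ m < r * 2 ^ m"
    by (intro mult_strict_right_mono) (simp_all add: lattice_point_def)
  moreover have "\<bar>x $ l - z l / 2 ^ m\<bar> * 2 ^ m = \<bar>(x $ l - z l / 2 ^ m) * 2 ^ m\<bar>"
    by (simp add: abs_mult)
  ultimately show ?thesis by (simp add: field_simps abs_minus_commute)
qed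

lemma finite_lattice_ball: "finite (lattice_ball x r m)"
proof (rule finite_subset)
  let ?B = "PiE UNIV (\<lambda>l. {\<lfloor>2 ^ m * x $ l - r * 2 ^ m\<rfloor> .. \<lceil>2 ^ m * x $ l + r * 2 ^ m\<rceil>})"
  show "lattice_ball x r m \<subseteq> ?B"
  proof
    fix z assume z: "z \<in> lattice_ball x r m"
    have "\<lfloor>2 ^ m * x $ l - r * 2 ^ m\<rfloor> \<le> z l \<and> z l \<le> \<lceil>2 ^ m * x $ l + r * 2 ^ m\<rceil>" for l
    proof -
      have "2 ^ m * x $ l - r * 2 ^ m \<le> z l" "z l \<le> 2 ^ m * x $ l + r * 2 ^ m"
        using lattice_ball_coordinate[OF z, of l] by linarith+
      then show ?thesis by linarith
    qed
    then show "z \<in> ?B" by auto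
  qed
  show "finite ?B" by (intro finite_PiE) auto
qed

text \<open>An order-1 kernel has support of length 2 per coordinate, so only two integers per
  coordinate matter, and the sum over the box factors into one-dimensional partitions of
  unity.\<close>

lemma spline_product_sum_box:
  fixes y :: "real^'n::finite" and m :: nat
  defines "B \<equiv> PiE UNIV (\<lambda>l. {\<lfloor>2 ^ m * y $ l\<rfloor> - 1 .. \<lfloor>2 ^ m * y $ l\<rfloor>})"
  shows "finite B" "(\<Sum>z\<in>B. spline_product [] m z y) = 1"
    "spline_product [] m z y \<noteq> 0 \<Longrightarrow> z \<in> B"
proof -
  show "finite B" unfolding B_def by (intro finite_PiE) auto
  have "(\<Sum>z\<in>B. spline_product [] m z y) = (\<Sum>z\<in>B. \<Prod>l\<in>UNIV. spline 1 (2 ^ m * y $ l - z l))"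
    by (simp add: spline_product_def del: spline.simps)
  also have "\<dots> = (\<Prod>l\<in>UNIV. \<Sum>k\<in>{\<lfloor>2 ^ m * y $ l\<rfloor> - 1 .. \<lfloor>2 ^ m * y $ l\<rfloor>}. spline 1 (2 ^ m * y $ l - real_of_int k))"
    unfolding B_def by (rule prod_sum_PiE[symmetric]) auto
  also have "\<dots> = 1" by (intro prod.neutral ballI spline_partition) linarith+
  finally show "(\<Sum>z\<in>B. spline_product [] m z y) = 1" .
  assume nz: "spline_product [] m z y \<noteq> 0"
  have "z l \<in> {\<lfloor>2 ^ m * y $ l\<rfloor> - 1 .. \<lfloor>2 ^ m * y $ l\<rfloor>}" for l
    using spline_product_nonzero[OF nz, of l] by simp linarith
  then show "z \<in> B" unfolding B_def by auto
qed

lemma spline_product_sum_le_1: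
  assumes "finite Z"
  shows "(\<Sum>z\<in>Z. spline_product [] m z y) \<le> 1"
proof -
  let ?B = "PiE UNIV (\<lambda>l. {\<lfloor>2 ^ m * y $ l\<rfloor> - 1 .. \<lfloor>2 ^ m * y $ l\<rfloor>})"
  note B = spline_product_sum_box[where m = m and y = y]
  have "(\<Sum>z\<in>Z. spline_product [] m z y) \<le> (\<Sum>z\<in>Z \<union> ?B. spline_product [] m z y)"
    using assms B(1) by (intro sum_mono2) (auto simp: spline_product_nonneg)
  also have "\<dots> = (\<Sum>z\<in>?B. spline_product [] m z y)"
    using assms B(1,3) by (intro sum.mono_neutral_right) auto
  finally show ?thesis using B(2) by simp
qed

lemma spline_product_sum_eq_1:
  assumes "finite Z" "\<And>z. spline_product [] m z y \<noteq> 0 \<Longrightarrow> z \<in> Z"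
  shows "(\<Sum>z\<in>Z. spline_product [] m z y) = 1"
proof -
  let ?B = "PiE UNIV (\<lambda>l. {\<lfloor>2 ^ m * y $ l\<rfloor> - 1 .. \<lfloor>2 ^ m * y $ l\<rfloor>})"
  note B = spline_product_sum_box[where m = m and y = y]
  have "(\<Sum>z\<in>Z \<union> ?B. spline_product [] m z y) = (\<Sum>z\<in>Z. spline_product [] m z y)"
    using assms B(1) by (intro sum.mono_neutral_right) auto
  moreover have "(\<Sum>z\<in>Z \<union> ?B. spline_product [] m z y) = (\<Sum>z\<in>?B. spline_product [] m z y)"
    using assms B(1,3) by (intro sum.mono_neutral_right) auto
  ultimately show ?thesis using B(2) by simp
qed

text \<open>The sum of the samples is the integral of \<open>v\<close> against the sum of the
  kernels, which is a cutoff: at most 1 everywhere, equal to 1 well inside the ball and 0 well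
  outside.\<close>

lemma lattice_average_sum_tendsto:
  fixes v :: "real^'n::finite \<Rightarrow> real"
  assumes v: "integrable lebesgue v"
  shows "(\<lambda>m. (\<Sum>z\<in>lattice_ball x r m. lattice_average v m z) / 2 ^ (m * CARD('n)))
    \<longlonglongrightarrow> (LINT y|lebesgue. v y * indicator (ball x r) y)"
proof -
  let ?W = "\<lambda>m y. \<Sum>z\<in>lattice_ball x r m. spline_product [] m z y"
  have near: "dist y (lattice_point m z) \<le> 2 * real CARD('n) / 2 ^ m" if "spline_product [] m z y \<noteq> 0" for m z and y :: "real^'n"
  proof (rule dist_lattice_point_le)
    show "\<bar>2 ^ m * y $ l - z l\<bar> \<le> 2" for l
      using spline_product_nonzero[OF that, of l] by simp
  qed
  have "(\<lambda>m. LINT y|lebesgue. v y * ?W m y) \<longlonglongrightarrow> (LINT y|lebesgue. v y * indicator (ball x r) y)"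
  proof (rule integral_cutoff_tendsto[OF v, where C = "2 * real CARD('n)"])
    show "?W m \<in> borel_measurable lebesgue" for m
      by (intro borel_measurable_sum measurable_spline_product)
    show "0 \<le> ?W m y \<and> ?W m y \<le> 1" for m y
      using spline_product_sum_le_1[OF finite_lattice_ball] by (auto intro: sum_nonneg spline_product_nonneg)
    show "?W m y = 1" if inside: "dist x y + 2 * real CARD('n) / 2 ^ m < r" for m y
    proof (rule spline_product_sum_eq_1[OF finite_lattice_ball])
      fix z assume "spline_product [] m z y \<noteq> 0"
      then show "z \<in> lattice_ball x r m"
        using near[of m z y] inside dist_triangle[of x "lattice_point m z" y] by (simp add: lattice_ball_def)
    qed
    show "?W m y = 0" if outside: "dist x y > r + 2 * real CARD('n) / 2 ^ m" for m y
    proof (rule sum.neutral, intro ballI, rule ccontr)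
      fix z assume z: "z \<in> lattice_ball x r m" and "spline_product [] m z y \<noteq> 0"
      then show False
        using near[of m z y] outside dist_triangle2[of x y "lattice_point m z"] by (simp add: lattice_ball_def)
    qed
  qed
  moreover have "(LINT y|lebesgue. v y * ?W m y)
      = (\<Sum>z\<in>lattice_ball x r m. lattice_average v m z) / 2 ^ (m * CARD('n))" for m
    unfolding lattice_average_def sum_distrib_left sum_divide_distrib
    by (subst Bochner_Integration.integral_sum) (simp_all add: integrable_mult_spline_product v)
  ultimately show ?thesis by simp
qed

lemma dyadic_cell:
  fixes z :: "'n::finite \<Rightarrow> int"
  shows "{y. dyadic_index m y = z} \<in> sets lebesgue"
    and "emeasure lebesgue {y. dyadic_index m y = z} = ennreal (1 / 2 ^ (m * CARD('n)))"
proof -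
  let ?a = "(\<chi> l. real_of_int (z l) / 2 ^ m) :: real^'n"
    and ?b = "(\<chi> l. (real_of_int (z l) + 1) / 2 ^ m) :: real^'n"
  have eq: "{y. dyadic_index m y = z} = (\<Inter>l. {y. z l \<le> 2 ^ m * y $ l \<and> 2 ^ m * y $ l < z l + 1})"
    by (auto simp: dyadic_index_def fun_eq_iff floor_eq_iff)
  have "{y :: real^'n. z l \<le> 2 ^ m * y $ l \<and> 2 ^ m * y $ l < z l + 1} \<in> sets borel" for l
    by measurable
  then have "{y. dyadic_index m y = z} \<in> sets borel"
    unfolding eq by (intro sets.countable_INT'') auto
  then show S: "{y. dyadic_index m y = z} \<in> sets lebesgue" by simp
  have sub1: "box ?a ?b \<subseteq> {y. dyadic_index m y = z}"
    by (auto simp: eq mem_box_cart field_simps intro: less_imp_le)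
  have sub2: "{y. dyadic_index m y = z} \<subseteq> cbox ?a ?b"
  proof
    fix y assume y: "y \<in> {y. dyadic_index m y = z}"
    have "z l / 2 ^ m \<le> y $ l \<and> y $ l \<le> (z l + 1) / 2 ^ m" for l
    proof -
      have "z l \<le> 2 ^ m * y $ l" "2 ^ m * y $ l \<le> z l + 1"
        using y by (auto simp: eq intro: less_imp_le)
      then show ?thesis by (simp add: field_simps)
    qed
    then show "y \<in> cbox ?a ?b" by (simp add: mem_box_cart)
  qed
  have ne: "cbox ?a ?b \<noteq> {}" by (simp add: interval_ne_empty_cart divide_right_mono)
  have "measure lebesgue (cbox ?a ?b) = (\<Prod>l\<in>(UNIV::'n set). 1 / 2 ^ m)"
    using content_cbox_cart[OF ne] by (simp add: diff_divide_distrib[symmetric])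
  also have "\<dots> = 1 / 2 ^ (m * CARD('n))" by (simp add: power_one_over power_mult)
  finally have c: "measure lebesgue (cbox ?a ?b) = 1 / 2 ^ (m * CARD('n))" .
  have cb: "emeasure lebesgue (cbox ?a ?b) = ennreal (1 / 2 ^ (m * CARD('n)))"
  proof -
    have "emeasure lebesgue (cbox ?a ?b) = ennreal (measure lebesgue (cbox ?a ?b))"
      by (intro emeasure_eq_ennreal_measure) (simp add: emeasure_lborel_cbox_eq)
    then show ?thesis using c by simp
  qed
  have "emeasure lebesgue (box ?a ?b) = emeasure lebesgue (cbox ?a ?b)"
    by (simp add: emeasure_lborel_box_eq emeasure_lborel_cbox_eq)
  then show "emeasure lebesgue {y. dyadic_index m y = z} = ennreal (1 / 2 ^ (m * CARD('n)))"
    using emeasure_mono[OF sub1 S] emeasure_mono[OF sub2] cb by (metis antisym lmeasurable_cbox fmeasurableD)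
qed

lemma dist_dyadic_index:
  fixes y :: "real^'n::finite"
  shows "dist y (lattice_point m (dyadic_index m y)) \<le> 2 * real CARD('n) / 2 ^ m"
proof (rule dist_lattice_point_le)
  show "\<bar>2 ^ m * y $ l - dyadic_index m y l\<bar> \<le> 2" for l
    unfolding dyadic_index_def by linarith
qed

lemma card_lattice_ball_tendsto:
  fixes x :: "real^'n::finite"
  shows "(\<lambda>m. card (lattice_ball x r m) / 2 ^ (m * CARD('n))) \<longlonglongrightarrow> measure lebesgue (ball x r)"
proof -
  let ?U = "\<lambda>m. {y. dyadic_index m y \<in> lattice_ball x r m}"
  \<comment> \<open>The indicator of a fixed larger ball stands in for the constant 1, which is not
    integrable; it contains all the cells.\<close>
  let ?R = "r + 2 * real CARD('n)"
  have U: "?U m = (\<Union>z\<in>lattice_ball x r m. {y. dyadic_index m y = z})" for m by auto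
  have meas: "?U m \<in> sets lebesgue" for m
    unfolding U by (intro sets.finite_UN finite_lattice_ball dyadic_cell)
  have near: "2 * real CARD('n) / 2 ^ m \<le> (2 * real CARD('n) :: real)" for m
    by (simp add: field_simps)
  have sub: "?U m \<subseteq> ball x ?R" for m
  proof
    fix y assume "y \<in> ?U m"
    then have "dist x (lattice_point m (dyadic_index m y)) < r" by (simp add: lattice_ball_def)
    then show "y \<in> ball x ?R"
      using dist_dyadic_index[of y m] near[of m] dist_triangle2[of x y "lattice_point m (dyadic_index m y)"] by simp
  qed
  have "(\<lambda>m. LINT y|lebesgue. indicat_real (ball x ?R) y * indicat_real (?U m) y)
      \<longlonglongrightarrow> (LINT y|lebesgue. indicat_real (ball x ?R) y * indicator (ball x r) y)"
  proof (rule integral_cutoff_tendsto[where C = "2 * real CARD('n)"])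
    show "integrable lebesgue (indicat_real (ball x ?R))"
      using lmeasurable_ball lmeasurable_iff_integrable by blast
    show "indicat_real (?U m) \<in> borel_measurable lebesgue" for m using meas by simp
    show "indicat_real (?U m) y = 1" if "dist x y + 2 * real CARD('n) / 2 ^ m < r" for m y
      using that dist_dyadic_index[of y m] dist_triangle[of x "lattice_point m (dyadic_index m y)" y]
      by (simp add: lattice_ball_def)
    show "indicat_real (?U m) y = 0" if "dist x y > r + 2 * real CARD('n) / 2 ^ m" for m y
      using that dist_dyadic_index[of y m] dist_triangle2[of x y "lattice_point m (dyadic_index m y)"]
      by (simp add: lattice_ball_def)
  qed simp
  moreover have "(LINT y|lebesgue. indicat_real (ball x ?R) y * indicat_real (?U m) y)
      = card (lattice_ball x r m) / 2 ^ (m * CARD('n))" for m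
  proof -
    have "(\<lambda>y. indicat_real (ball x ?R) y * indicat_real (?U m) y) = indicat_real (?U m)"
      using sub[of m] by (auto simp: indicator_def fun_eq_iff)
    then have "(LINT y|lebesgue. indicat_real (ball x ?R) y * indicat_real (?U m) y) = measure lebesgue (?U m)"
      using meas by simp
    also have "\<dots> = (\<Sum>z\<in>lattice_ball x r m. measure lebesgue {y. dyadic_index m y = z})"
      unfolding U using finite_lattice_ball
      by (intro measure_finite_Union) (auto simp: disjoint_family_on_def dyadic_cell)
    also have "\<dots> = card (lattice_ball x r m) / 2 ^ (m * CARD('n))"
      by (simp add: measure_def dyadic_cell(2))
    finally show ?thesis .
  qed
  moreover have "(LINT y|lebesgue. indicat_real (ball x ?R) y * indicator (ball x r) y) = measure lebesgue (ball x r)"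
  proof -
    have "(\<lambda>y. indicat_real (ball x ?R) y * indicat_real (ball x r) y) = indicat_real (ball x r)"
      by (auto simp: indicator_def fun_eq_iff)
    then show ?thesis by simp
  qed
  ultimately show ?thesis by simp
qed

text \<open>For fixed \<open>r\<close> the ball average is the limit of averages of samples over the
  lattice ball, and equicontinuity keeps each of these samples within \<epsilon>/2 of the one at
  \<open>x\<close>. The threshold for \<open>m\<close> may depend on \<open>r\<close>, but \<rho>
  depends only on \<epsilon>.\<close>

lemma ball_average_close:
  fixes v :: "real^'n::finite \<Rightarrow> real"
  assumes v: "v \<in> sobolev_W1 CARD('n)" and "\<epsilon> > 0"
  shows "\<exists>\<rho>>0. \<forall>r. 0 < r \<longrightarrow> r \<le> \<rho> \<longrightarrow>
    eventually (\<lambda>m. \<bar>ball_average v x r - lattice_average v m (dyadic_index m x)\<bar> \<le> \<epsilon>) sequentially"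
proof -
  let ?f = "lattice_average v"
  interpret lattice_family ?f by (rule lattice_average_family[OF v])
  have int: "integrable lebesgue v" using v by (simp add: sobolev_W1_def)
  have "\<epsilon> / 2 > 0" using \<open>\<epsilon> > 0\<close> by simp
  then obtain \<delta> where \<delta>: "\<delta> > 0"
    "\<And>m a b. (\<forall>i. \<bar>real_of_int (a i - b i)\<bar> \<le> \<delta> * 2 ^ m) \<Longrightarrow> \<bar>?f m a - ?f m b\<bar> \<le> \<epsilon> / 2"
    using equicontinuous[of "\<epsilon> / 2"] by blast
  show ?thesis
  \<comment> \<open>Half of \<delta> is kept for rounding \<open>x\<close> to a lattice point, an
    error of at most one mesh step, which is below (\<delta>/2) * 2^m steps for large
    \<open>m\<close>.\<close>
  proof (intro exI[of _ "\<delta> / 2"] conjI allI impI)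
    show "\<delta> / 2 > 0" using \<delta> by simp
    fix r assume r: "0 < r" "r \<le> \<delta> / 2"
    let ?Z = "lattice_ball x r" and ?c = "\<lambda>m. ?f m (dyadic_index m x)" and ?V = "measure lebesgue (ball x r)"
    have V: "?V > 0" using r by simp
    let ?avg = "\<lambda>m. ((\<Sum>z\<in>?Z m. ?f m z) / 2 ^ (m * CARD('n))) / (card (?Z m) / 2 ^ (m * CARD('n)))"
    have "?avg \<longlonglongrightarrow> (LINT y|lebesgue. v y * indicator (ball x r) y) / ?V"
      using V by (intro tendsto_divide lattice_average_sum_tendsto int card_lattice_ball_tendsto) auto
    also have "(LINT y|lebesgue. v y * indicator (ball x r) y) / ?V = ball_average v x r"
      by (simp add: ball_average_def set_lebesgue_integral_def mult.commute)
    finally have "eventually (\<lambda>m. dist (?avg m) (ball_average v x r) < \<epsilon> / 2) sequentially"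
      using \<open>\<epsilon> / 2 > 0\<close> by (rule tendstoD)
    moreover have "eventually (\<lambda>m. card (?Z m) / 2 ^ (m * CARD('n)) > 0) sequentially"
      using order_tendstoD(1)[OF card_lattice_ball_tendsto V] .
    moreover have "eventually (\<lambda>m. 1 / 2 ^ m < \<delta> / 2) sequentially"
      by (rule order_tendstoD(2)[OF half_power_tendsto_0]) (use \<delta> in simp)
    ultimately show "eventually (\<lambda>m. \<bar>ball_average v x r - ?c m\<bar> \<le> \<epsilon>) sequentially"
    proof eventually_elim
      case (elim m)
      have n: "0 < real (card (?Z m))" using elim(2) by (simp add: zero_less_divide_iff)
      have one: "1 \<le> \<delta> / 2 * 2 ^ m" using elim(3) by (simp add: field_simps)
      have close: "\<bar>?f m z - ?c m\<bar> \<le> \<epsilon> / 2" if "z \<in> ?Z m" for z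
      proof (rule \<delta>(2), intro allI)
        fix i
        have "r * 2 ^ m \<le> \<delta> / 2 * 2 ^ m" by (intro mult_right_mono r) simp
        then have "\<bar>z i - 2 ^ m * x $ i\<bar> \<le> \<delta> / 2 * 2 ^ m"
          using lattice_ball_coordinate[OF that, of i] by linarith
        moreover have "\<bar>2 ^ m * x $ i - dyadic_index m x i\<bar> \<le> 1"
          unfolding dyadic_index_def by linarith
        ultimately show "\<bar>real_of_int (z i - dyadic_index m x i)\<bar> \<le> \<delta> * 2 ^ m"
          using one unfolding of_int_diff by linarith
      qed
      have "\<bar>(\<Sum>z\<in>?Z m. ?f m z) - card (?Z m) * ?c m\<bar> = \<bar>\<Sum>z\<in>?Z m. (?f m z - ?c m)\<bar>"
        by (simp add: sum_subtractf)
      also have "\<dots> \<le> (\<Sum>z\<in>?Z m. \<epsilon> / 2)"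
        by (intro order_trans[OF sum_abs] sum_mono close)
      finally have "\<bar>(\<Sum>z\<in>?Z m. ?f m z) - card (?Z m) * ?c m\<bar> \<le> card (?Z m) * (\<epsilon> / 2)" by simp
      then have "\<bar>(\<Sum>z\<in>?Z m. ?f m z) / card (?Z m) - ?c m\<bar> \<le> \<epsilon> / 2"
        using n by (simp add: field_simps abs_le_iff)
      moreover have "\<bar>(\<Sum>z\<in>?Z m. ?f m z) / card (?Z m) - ball_average v x r\<bar> < \<epsilon> / 2"
        using elim(1) by (simp add: dist_real_def)
      ultimately show ?case by linarith
    qed
  qed
qed

text \<open>One ball average serves as pivot for the Cauchy property. Letting \<open>m\<close> grow
  then shows that the ball averages converge to the same limit, so the default value 0 in
  \<open>precise_rep\<close> never intervenes here.\<close>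

lemma lattice_average_tendsto_precise_rep:
  fixes v :: "real^'n::finite \<Rightarrow> real"
  assumes v: "v \<in> sobolev_W1 CARD('n)"
  shows "(\<lambda>m. lattice_average v m (dyadic_index m x)) \<longlonglongrightarrow> precise_rep v x"
proof -
  let ?c = "\<lambda>m. lattice_average v m (dyadic_index m x)"
  have "Cauchy ?c"
  proof (rule metric_CauchyI)
    fix e :: real assume "e > 0"
    then obtain \<rho> where "\<rho> > 0" and
      "\<forall>r. 0 < r \<longrightarrow> r \<le> \<rho> \<longrightarrow> eventually (\<lambda>m. \<bar>ball_average v x r - ?c m\<bar> \<le> e / 3) sequentially"
      using ball_average_close[OF v, of "e / 3" x] by auto
    then have "eventually (\<lambda>m. \<bar>ball_average v x \<rho> - ?c m\<bar> \<le> e / 3) sequentially" by auto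
    then obtain M where M: "\<And>m. m \<ge> M \<Longrightarrow> \<bar>ball_average v x \<rho> - ?c m\<bar> \<le> e / 3"
      unfolding eventually_sequentially by blast
    show "\<exists>M. \<forall>m\<ge>M. \<forall>n\<ge>M. dist (?c m) (?c n) < e"
    proof (intro exI[of _ M] allI impI)
      fix m n assume "M \<le> m" "M \<le> n"
      then show "dist (?c m) (?c n) < e"
        using M[of m] M[of n] \<open>e > 0\<close> unfolding dist_real_def by linarith
    qed
  qed
  then obtain L where L: "?c \<longlonglongrightarrow> L" using Cauchy_convergent convergent_def by blast
  have "(ball_average v x \<longlongrightarrow> L) (at_right 0)"
  proof (rule tendstoI)
    fix e :: real assume "e > 0"
    then obtain \<rho> where "\<rho> > 0" and
      \<rho>: "\<forall>r. 0 < r \<longrightarrow> r \<le> \<rho> \<longrightarrow> eventually (\<lambda>m. \<bar>ball_average v x r - ?c m\<bar> \<le> e / 2) sequentially"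
      using ball_average_close[OF v, of "e / 2" x] by auto
    have "dist (ball_average v x r) L < e" if r: "0 < r" "r < \<rho>" for r
    proof -
      have "(\<lambda>m. \<bar>ball_average v x r - ?c m\<bar>) \<longlonglongrightarrow> \<bar>ball_average v x r - L\<bar>"
        by (intro tendsto_intros L)
      moreover have "eventually (\<lambda>m. \<bar>ball_average v x r - ?c m\<bar> \<le> e / 2) sequentially"
        using \<rho> r by auto
      ultimately have "\<bar>ball_average v x r - L\<bar> \<le> e / 2"
        by (rule tendsto_upperbound) simp
      then show ?thesis using \<open>e > 0\<close> by (simp add: dist_real_def)
    qed
    then show "eventually (\<lambda>r. dist (ball_average v x r) L < e) (at_right 0)"
      unfolding eventually_at_right_field using \<open>\<rho> > 0\<close> by blast
  qed
  then have "precise_rep v x = L"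
    unfolding precise_rep_def using tendsto_Lim[OF trivial_limit_at_right_real] by auto
  then show ?thesis using L by simp
qed

subsection \<open>Coverings by dyadic cubes\<close>

lemma dyadic_index_coarsen:
  assumes "j \<le> m"
  shows "dyadic_index j x l = dyadic_index m x l div 2 ^ (m - j)"
proof -
  have "2 ^ m = (2 ^ j * 2 ^ (m - j) :: real)"
    using assms by (simp add: power_add[symmetric])
  then have "2 ^ j * x $ l = (2 ^ m * x $ l) / real_of_int (2 ^ (m - j))" by simp
  then show ?thesis
    unfolding dyadic_index_def by (simp only: floor_divide_real_eq_div[OF zero_le_power[OF zero_le_numeral]])
qed

lemma dyadic_index_eq_mono:
  "dyadic_index m x = dyadic_index m y \<Longrightarrow> j \<le> m \<Longrightarrow> dyadic_index j x = dyadic_index j y"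
  by (rule ext) (simp add: dyadic_index_coarsen)

text \<open>Two opposite numberings meet: generation \<open>j\<close> means side 2^-j, which on the
  mesh 2^-m is a lattice cube of level \<open>m - j\<close>.\<close>

lemma dyadic_index_cube_iff:
  assumes "j \<le> m"
  shows "dyadic_index m y \<in> cube (m - j) (dyadic_index m x) \<longleftrightarrow> dyadic_index j y = dyadic_index j x"
  using assms by (simp add: cube_def block_def fun_eq_iff dyadic_index_coarsen[of j m])

text \<open>Once the mesh resolves all cubes of the finite family, they form a
  \<open>regular_family\<close> of lattice cubes, and the bound for the samples does not depend on
  \<open>m\<close>; hence it survives the limit.\<close>

lemma dyadic_oscillation_sum:
  fixes v :: "real^'n::finite \<Rightarrow> real" and R :: real
  assumes v: "v \<in> sobolev_W1 CARD('n)" and "\<epsilon> > 0" "R \<ge> 1"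
  shows "\<exists>\<delta>>0. \<forall>(I :: (nat \<times> ('n \<Rightarrow> int)) set) x y. finite I \<longrightarrow>
    (\<forall>p\<in>I. dyadic_index (fst p) (x p) = snd p \<and> dyadic_index (fst p) (y p) = snd p) \<longrightarrow>
    (\<forall>p\<in>I. \<forall>q\<in>I. p \<noteq> q \<longrightarrow> fst p \<le> fst q \<longrightarrow> dyadic_index (fst p) (x q) \<noteq> snd p) \<longrightarrow>
    (\<forall>j k. (\<Sum>p | p \<in> I \<and> j \<le> fst p \<and> dyadic_index j (x p) = k. 1 / 2 ^ fst p) \<le> R / 2 ^ j) \<longrightarrow>
    (\<Sum>p\<in>I. 1 / 2 ^ fst p) \<le> (\<delta> :: real) \<longrightarrow>
    (\<Sum>p\<in>I. \<bar>precise_rep v (x p) - precise_rep v (y p)\<bar>) \<le> \<epsilon>"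
proof -
  interpret lattice_family "lattice_average v" by (rule lattice_average_family[OF v])
  obtain \<delta> where "\<delta> > 0" and \<delta>: "\<And>m (I :: (nat \<times> ('n \<Rightarrow> int)) set) lev a b. regular_family R m I lev a \<Longrightarrow>
    \<forall>p\<in>I. b p \<in> cube (lev p) (a p) \<Longrightarrow> (\<Sum>p\<in>I. 2 ^ lev p) \<le> (\<delta> * 2 ^ m :: real) \<Longrightarrow>
    (\<Sum>p\<in>I. \<bar>lattice_average v m (a p) - lattice_average v m (b p)\<bar>) \<le> \<epsilon>"
    using oscillation_sum[OF assms(2,3), where 'p = "nat \<times> ('n \<Rightarrow> int)"] by blast
  show ?thesis
  proof (intro exI[of _ \<delta>] conjI allI impI)
    fix I :: "(nat \<times> ('n \<Rightarrow> int)) set" and x y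
    assume I: "finite I"
      and xy: "\<forall>p\<in>I. dyadic_index (fst p) (x p) = snd p \<and> dyadic_index (fst p) (y p) = snd p"
      and disj: "\<forall>p\<in>I. \<forall>q\<in>I. p \<noteq> q \<longrightarrow> fst p \<le> fst q \<longrightarrow> dyadic_index (fst p) (x q) \<noteq> snd p"
      and regular: "\<forall>j k. (\<Sum>p | p \<in> I \<and> j \<le> fst p \<and> dyadic_index j (x p) = k. 1 / 2 ^ fst p) \<le> R / 2 ^ j"
      and total: "(\<Sum>p\<in>I. 1 / 2 ^ fst p) \<le> \<delta>"
    let ?c = "\<lambda>m x. lattice_average v m (dyadic_index m x)"
    have scale: "(\<Sum>p\<in>J. 2 ^ (m - fst p)) = 2 ^ m * (\<Sum>p\<in>J. 1 / 2 ^ fst p :: real)"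
      if "J \<subseteq> I" "\<forall>p\<in>I. fst p \<le> m" for m J
      unfolding sum_distrib_left
    proof (intro sum.cong refl)
      fix p assume "p \<in> J"
      then have "fst p \<le> m" using that by blast
      then show "2 ^ (m - fst p) = 2 ^ m * (1 / 2 ^ fst p :: real)" by (simp add: power_diff)
    qed
    have est: "(\<Sum>p\<in>I. \<bar>?c m (x p) - ?c m (y p)\<bar>) \<le> \<epsilon>" if m: "\<forall>p\<in>I. fst p \<le> m" for m
    proof (rule \<delta>[where lev = "\<lambda>p. m - fst p" and a = "\<lambda>p. dyadic_index m (x p)" and b = "\<lambda>p. dyadic_index m (y p)"])
      show "\<forall>p\<in>I. dyadic_index m (y p) \<in> cube (m - fst p) (dyadic_index m (x p))"
        using m xy by (simp add: dyadic_index_cube_iff)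
      have "(\<Sum>p\<in>I. 2 ^ (m - fst p)) \<le> 2 ^ m * \<delta>"
        unfolding scale[OF order_refl m] by (intro mult_left_mono total) simp
      then show "(\<Sum>p\<in>I. 2 ^ (m - fst p)) \<le> \<delta> * 2 ^ m" by (simp add: mult.commute)
      show "regular_family R m I (\<lambda>p. m - fst p) (\<lambda>p. dyadic_index m (x p))"
        unfolding regular_family_def
      proof (intro conjI I ballI impI allI)
        show "m - fst p \<le> m" for p by simp
      next
        have *: "cube (m - fst p) (dyadic_index m (x p)) \<inter> cube (m - fst q) (dyadic_index m (x q)) = {}"
          if pq: "p \<in> I" "q \<in> I" "p \<noteq> q" "fst p \<le> fst q" for p q
        proof (rule ccontr)
          assume "cube (m - fst p) (dyadic_index m (x p)) \<inter> cube (m - fst q) (dyadic_index m (x q)) \<noteq> {}"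
          then obtain z where z: "z \<in> cube (m - fst p) (dyadic_index m (x p))" "z \<in> cube (m - fst q) (dyadic_index m (x q))"
            by blast
          have "z \<in> cube (m - fst p) (dyadic_index m (x q))"
            using cube_mono[of "m - fst q" "m - fst p"] z(2) pq(4) by (meson diff_le_mono2 subsetD)
          then have "dyadic_index m (x q) \<in> cube (m - fst p) (dyadic_index m (x p))"
            using z(1) cube_cong cube_self by metis
          then have "dyadic_index (fst p) (x q) = dyadic_index (fst p) (x p)"
            using dyadic_index_cube_iff m pq(1) by blast
          then show False using disj pq xy by auto
        qed
        fix p q assume "p \<in> I" "q \<in> I" "p \<noteq> q"
        then show "cube (m - fst p) (dyadic_index m (x p)) \<inter> cube (m - fst q) (dyadic_index m (x q)) = {}"
          using *[of p q] *[of q p] by (cases "fst p \<le> fst q") auto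
      next
        fix j z assume j: "j \<le> m"
        \<comment> \<open>On the mesh 2^-m, a cube of level \<open>j\<close> is a dyadic cube of
          generation \<open>m - j\<close>, with index \<open>z div 2 ^ j\<close> in each
          coordinate.\<close>
        let ?J = "{p \<in> I. m - j \<le> fst p \<and> dyadic_index (m - j) (x p) = (\<lambda>l. z l div 2 ^ j)}"
        have "{p. p \<in> I \<and> m - fst p \<le> j \<and> dyadic_index m (x p) \<in> cube j z} = ?J"
          using j by (auto simp: cube_def block_def fun_eq_iff dyadic_index_coarsen[of "m - j" m])
        then have "(\<Sum>p | p \<in> I \<and> m - fst p \<le> j \<and> dyadic_index m (x p) \<in> cube j z. 2 ^ (m - fst p))
            = 2 ^ m * (\<Sum>p\<in>?J. 1 / 2 ^ fst p :: real)"
          using scale[of ?J m] m by simp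
        also have "\<dots> \<le> 2 ^ m * (R / 2 ^ (m - j))"
          using regular by (intro mult_left_mono) auto
        also have "\<dots> = R * 2 ^ j" using j by (simp add: power_diff)
        finally show "(\<Sum>p | p \<in> I \<and> m - fst p \<le> j \<and> dyadic_index m (x p) \<in> cube j z. 2 ^ (m - fst p)) \<le> R * 2 ^ j" .
      qed
    qed
    have "(\<lambda>m. \<Sum>p\<in>I. \<bar>?c m (x p) - ?c m (y p)\<bar>) \<longlonglongrightarrow> (\<Sum>p\<in>I. \<bar>precise_rep v (x p) - precise_rep v (y p)\<bar>)"
      by (intro tendsto_sum tendsto_rabs tendsto_diff lattice_average_tendsto_precise_rep[OF v])
    moreover have "eventually (\<lambda>m. (\<Sum>p\<in>I. \<bar>?c m (x p) - ?c m (y p)\<bar>) \<le> \<epsilon>) sequentially"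
      unfolding eventually_sequentially
    \<comment> \<open>From the largest generation on, every cube of the family is resolved; the
      inserted 0 makes \<open>Max\<close> meaningful for an empty family.\<close>
    proof (intro exI[of _ "Max (insert 0 (fst ` I))"] allI impI est ballI)
      fix m p assume "Max (insert 0 (fst ` I)) \<le> m" "p \<in> I"
      then show "fst p \<le> m" using I by simp
    qed
    ultimately show "(\<Sum>p\<in>I. \<bar>precise_rep v (x p) - precise_rep v (y p)\<bar>) \<le> \<epsilon>"
      by (rule tendsto_upperbound) simp
  qed (rule \<open>\<delta> > 0\<close>)
qed

lemma ennreal_3_power: "3 ^ k = ennreal (3 ^ k)"
  by (metis ennreal_numeral ennreal_power zero_le_numeral)

text \<open>A covering by sets \<open>A i\<close> of diameter at most \<open>2\<^sup>-\<^sup>J\<^sup>i\<close>. A dyadic cube is heavy if the sets meeting it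
  and not larger than it have total size at least its side length; the coarsest heavy cubes form a
  disjoint family in which the side lengths inside any other cube cannot accumulate.\<close>

locale small_covering =
  fixes A :: "nat \<Rightarrow> (real^'n::finite) set" and J :: "nat \<Rightarrow> nat"
  assumes spread: "x \<in> A i \<Longrightarrow> y \<in> A i \<Longrightarrow> \<bar>x $ l - y $ l\<bar> \<le> 1 / 2 ^ J i"
begin

definition meets :: "nat \<Rightarrow> ('n \<Rightarrow> int) \<Rightarrow> nat \<Rightarrow> bool" where
  "meets j k i \<longleftrightarrow> j \<le> J i \<and> (\<exists>x\<in>A i. dyadic_index j x = k)"

definition mass :: "nat \<Rightarrow> ('n \<Rightarrow> int) \<Rightarrow> ennreal" where
  "mass j k = (\<Sum>i. if meets j k i then ennreal (1 / 2 ^ J i) else 0)"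

definition heavy :: "nat \<Rightarrow> ('n \<Rightarrow> int) \<Rightarrow> bool" where
  "heavy j k \<longleftrightarrow> ennreal (1 / 2 ^ j) \<le> mass j k"

definition coarsest_heavy :: "(nat \<times> ('n \<Rightarrow> int)) set" where
  "coarsest_heavy = {(j, k). heavy j k \<and> (\<exists>x. dyadic_index j x = k) \<and>
     (\<forall>i<j. \<forall>x. dyadic_index j x = k \<longrightarrow> \<not> heavy i (dyadic_index i x))}"

lemma coarsest_heavyD:
  assumes "p \<in> coarsest_heavy"
  shows "heavy (fst p) (snd p)" "\<exists>x. dyadic_index (fst p) x = snd p"
    "i < fst p \<Longrightarrow> dyadic_index (fst p) x = snd p \<Longrightarrow> \<not> heavy i (dyadic_index i x)"
  using assms unfolding coarsest_heavy_def by auto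

text \<open>The cube of generation \<open>J i\<close> around \<open>x\<close> is heavy, since
  \<open>A i\<close> alone supplies its side length. The least heavy generation along
  \<open>x\<close> then gives the coarsest cube.\<close>

lemma coarsest_heavy_covers:
  assumes "x \<in> A i"
  shows "\<exists>p\<in>coarsest_heavy. dyadic_index (fst p) x = snd p"
proof -
  have "(\<Sum>l\<in>{i}. if meets (J i) (dyadic_index (J i) x) l then ennreal (1 / 2 ^ J l) else 0) \<le> mass (J i) (dyadic_index (J i) x)"
    unfolding mass_def by (intro sum_le_suminf summableI) auto
  moreover have "meets (J i) (dyadic_index (J i) x) i" using assms by (auto simp: meets_def)
  ultimately have h: "heavy (J i) (dyadic_index (J i) x)" by (simp add: heavy_def)
  define j where "j = (LEAST j. heavy j (dyadic_index j x))"
  have j: "heavy j (dyadic_index j x)" unfolding j_def by (rule LeastI[where P = "\<lambda>j. heavy j (dyadic_index j x)", OF h])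
  have light: "\<not> heavy i (dyadic_index i y)" if "i < j" "dyadic_index j y = dyadic_index j x" for i y
  proof -
    have "dyadic_index i y = dyadic_index i x" using that(1) by (intro dyadic_index_eq_mono[OF that(2)]) simp
    then show ?thesis using not_less_Least[of i "\<lambda>j. heavy j (dyadic_index j x)"] that(1) by (simp add: j_def)
  qed
  have "(j, dyadic_index j x) \<in> coarsest_heavy"
    unfolding coarsest_heavy_def mem_Collect_eq prod.case
    by (intro conjI allI impI exI[of _ x] j refl light)
  then show ?thesis by (rule bexI[rotated]) simp
qed

lemma coarsest_heavy_disjoint:
  assumes "p \<in> coarsest_heavy" "q \<in> coarsest_heavy" "p \<noteq> q" "fst p \<le> fst q" "dyadic_index (fst q) x = snd q"
  shows "dyadic_index (fst p) x \<noteq> snd p"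
proof
  assume *: "dyadic_index (fst p) x = snd p"
  show False
  proof (cases "fst p = fst q")
    case True
    then have "p = q" using * assms(5) by (simp add: prod_eq_iff)
    with assms(3) show False by simp
  next
    case False
    then have "\<not> heavy (fst p) (dyadic_index (fst p) x)"
      using coarsest_heavyD(3)[OF assms(2) _ assms(5)] assms(4) by simp
    then show False using coarsest_heavyD(1)[OF assms(1)] * by simp
  qed
qed

text \<open>The cubes that \<open>meets\<close> relates to \<open>A i\<close> have side at least
  2^-(J i) and are disjoint, so they contain different cells of generation \<open>J i\<close>
  touching \<open>A i\<close>. By \<open>spread\<close> these cells are neighbours of one fixed
  cell, three choices per coordinate.\<close>

lemma card_meets_le:
  assumes "finite I" "I \<subseteq> coarsest_heavy"
  shows "card {p \<in> I. meets (fst p) (snd p) i} \<le> 3 ^ CARD('n)"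
proof (cases "A i = {}")
  case True
  then show ?thesis by (simp add: meets_def)
next
  case False
  then obtain a where a: "a \<in> A i" by blast
  let ?S = "{p \<in> I. meets (fst p) (snd p) i}"
  let ?B = "PiE UNIV (\<lambda>l. {dyadic_index (J i) a l - 1 .. dyadic_index (J i) a l + 1})"
  have "\<forall>p\<in>?S. \<exists>x. x \<in> A i \<and> dyadic_index (fst p) x = snd p \<and> fst p \<le> J i" by (auto simp: meets_def)
  from bchoice[OF this]
  obtain x where x: "\<forall>p\<in>?S. x p \<in> A i \<and> dyadic_index (fst p) (x p) = snd p \<and> fst p \<le> J i" ..
  have inj: "inj_on (\<lambda>p. dyadic_index (J i) (x p)) ?S"
  proof (rule inj_onI)
    fix p q assume pq: "p \<in> ?S" "q \<in> ?S" "dyadic_index (J i) (x p) = dyadic_index (J i) (x q)"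
    have *: "p = q" if pq: "p \<in> ?S" "q \<in> ?S" "dyadic_index (J i) (x p) = dyadic_index (J i) (x q)" "fst p \<le> fst q" for p q
    proof (rule ccontr)
      assume "p \<noteq> q"
      moreover have "p \<in> coarsest_heavy" "q \<in> coarsest_heavy" using pq assms(2) by auto
      moreover have "dyadic_index (fst q) (x q) = snd q" using bspec[OF x pq(2)] by simp
      ultimately have "dyadic_index (fst p) (x q) \<noteq> snd p" using pq(4) by (intro coarsest_heavy_disjoint)
      moreover have "dyadic_index (fst p) (x p) = snd p \<and> fst p \<le> J i" using bspec[OF x pq(1)] by simp
      moreover from this have "dyadic_index (fst p) (x p) = dyadic_index (fst p) (x q)"
        by (intro dyadic_index_eq_mono[OF pq(3)]) simp
      ultimately show False by simp
    qed
    show "p = q"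
      using *[OF pq] *[OF pq(2,1) pq(3)[symmetric]] by (cases "fst p \<le> fst q") auto
  qed
  have "(\<lambda>p. dyadic_index (J i) (x p)) ` ?S \<subseteq> ?B"
  proof
    fix k assume "k \<in> (\<lambda>p. dyadic_index (J i) (x p)) ` ?S"
    then obtain p where p: "p \<in> ?S" "k = dyadic_index (J i) (x p)" by blast
    have "k l \<in> {dyadic_index (J i) a l - 1 .. dyadic_index (J i) a l + 1}" for l
    proof -
      have "\<bar>x p $ l - a $ l\<bar> \<le> 1 / 2 ^ J i" using bspec[OF x p(1)] by (intro spread[OF _ a]) simp
      then have "2 ^ J i * \<bar>x p $ l - a $ l\<bar> \<le> 2 ^ J i * (1 / 2 ^ J i)" by (intro mult_left_mono) auto
      then have "\<bar>2 ^ J i * x p $ l - 2 ^ J i * a $ l\<bar> \<le> 1"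
        by (simp add: abs_mult right_diff_distrib[symmetric])
      then show ?thesis unfolding p(2) dyadic_index_def by simp linarith
    qed
    then show "k \<in> ?B" by auto
  qed
  then have "card ((\<lambda>p. dyadic_index (J i) (x p)) ` ?S) \<le> card ?B"
    by (intro card_mono finite_PiE) auto
  then show ?thesis by (simp add: card_image[OF inj] card_PiE)
qed

text \<open>Each cube charges its side length to the sets that make it heavy, and each set is
  charged by at most 3^N cubes. \<open>B\<close> records which sets can be charged: those meeting a
  larger cube for the packing condition, all sets for the total.\<close>

lemma sum_coarsest_heavy_le:
  assumes "finite I" "I \<subseteq> coarsest_heavy" and B: "\<And>p i. p \<in> I \<Longrightarrow> meets (fst p) (snd p) i \<Longrightarrow> B i"
  shows "(\<Sum>p\<in>I. ennreal (1 / 2 ^ fst p)) \<le> 3 ^ CARD('n) * (\<Sum>i. if B i then ennreal (1 / 2 ^ J i) else 0)"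
proof -
  have "(\<Sum>p\<in>I. ennreal (1 / 2 ^ fst p)) \<le> (\<Sum>p\<in>I. mass (fst p) (snd p))"
    using assms(2) coarsest_heavyD(1) by (intro sum_mono) (auto simp: heavy_def)
  also have "\<dots> = (\<Sum>i. \<Sum>p\<in>I. if meets (fst p) (snd p) i then ennreal (1 / 2 ^ J i) else 0)"
    unfolding mass_def by (intro suminf_sum[symmetric] summableI)
  also have "\<dots> \<le> (\<Sum>i. 3 ^ CARD('n) * (if B i then ennreal (1 / 2 ^ J i) else 0))"
  proof (intro suminf_le summableI)
    fix i
    have "(\<Sum>p\<in>I. if meets (fst p) (snd p) i then ennreal (1 / 2 ^ J i) else 0)
        = of_nat (card {p \<in> I. meets (fst p) (snd p) i}) * ennreal (1 / 2 ^ J i)"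
      by (simp add: sum.inter_filter[OF assms(1), symmetric])
    also have "\<dots> \<le> 3 ^ CARD('n) * (if B i then ennreal (1 / 2 ^ J i) else 0)"
    proof (cases "B i")
      case True
      have "of_nat (card {p \<in> I. meets (fst p) (snd p) i}) \<le> (of_nat (3 ^ CARD('n)) :: ennreal)"
        using card_meets_le[OF assms(1,2), of i] by (simp only: of_nat_le_iff)
      then show ?thesis using True by (simp add: mult_right_mono)
    next
      case False
      then have e: "{p \<in> I. meets (fst p) (snd p) i} = {}" using B by blast
      show ?thesis unfolding e by simp
    qed
    finally show "(\<Sum>p\<in>I. if meets (fst p) (snd p) i then ennreal (1 / 2 ^ J i) else 0)
      \<le> 3 ^ CARD('n) * (if B i then ennreal (1 / 2 ^ J i) else 0)" .
  qed
  also have "\<dots> = 3 ^ CARD('n) * (\<Sum>i. if B i then ennreal (1 / 2 ^ J i) else 0)" by simp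
  finally show ?thesis .
qed

text \<open>If the test cube itself belongs to the subfamily, it is the only one counted. Otherwise
  it is a strict ancestor of a coarsest heavy cube, hence not heavy, and the cubes inside it charge
  only to its own mass.\<close>

lemma coarsest_heavy_regular:
  assumes I: "finite I" "I \<subseteq> coarsest_heavy" and x: "\<And>p. p \<in> I \<Longrightarrow> dyadic_index (fst p) (x p) = snd p"
  shows "(\<Sum>p | p \<in> I \<and> j \<le> fst p \<and> dyadic_index j (x p) = k. 1 / 2 ^ fst p) \<le> (3 ^ CARD('n) / 2 ^ j :: real)"
proof -
  let ?I = "{p. p \<in> I \<and> j \<le> fst p \<and> dyadic_index j (x p) = k}"
  have fin: "finite ?I" using I by simp
  show ?thesis
  proof (cases "\<exists>p\<in>?I. fst p = j")
    case True
    then obtain p where p: "p \<in> ?I" "fst p = j" by blast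
    have "?I = {p}"
    proof (intro equalityI subsetI, rule ccontr)
      fix q assume q: "q \<in> ?I" "q \<notin> {p}"
      then have "dyadic_index (fst p) (x q) \<noteq> snd p"
        using I p x by (intro coarsest_heavy_disjoint[of p q]) auto
      moreover have "dyadic_index (fst p) (x q) = dyadic_index (fst p) (x p)" using p q(1) by simp
      moreover have "dyadic_index (fst p) (x p) = snd p" using p(1) by (intro x) simp
      ultimately show False by simp
    qed (use p in auto)
    then have "(\<Sum>p\<in>?I. 1 / 2 ^ fst p) = (1 / 2 ^ j :: real)" using p(2) by simp
    also have "\<dots> \<le> 3 ^ CARD('n) / 2 ^ j" by (intro divide_right_mono) auto
    finally show ?thesis .
  next
    case False
    show ?thesis
    proof (cases "?I = {}")
      case True
      then show ?thesis by (simp only: sum.empty) simp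
    next
      case nonempty: False
      then obtain p where p: "p \<in> ?I" by blast
      then have "fst p \<noteq> j" "j \<le> fst p" using False by blast+
      then have "j < fst p" by simp
      then have "\<not> heavy j (dyadic_index j (x p))"
        using p x I by (intro coarsest_heavyD(3)[of p]) auto
      then have light: "mass j k \<le> ennreal (1 / 2 ^ j)" using p by (simp add: heavy_def)
      have "(\<Sum>p\<in>?I. ennreal (1 / 2 ^ fst p)) \<le> 3 ^ CARD('n) * (\<Sum>i. if meets j k i then ennreal (1 / 2 ^ J i) else 0)"
      proof (rule sum_coarsest_heavy_le[OF fin])
        show "?I \<subseteq> coarsest_heavy" using I by auto
        fix q i assume q: "q \<in> ?I" "meets (fst q) (snd q) i"
        then obtain a where a: "a \<in> A i" "dyadic_index (fst q) a = snd q" "fst q \<le> J i" by (auto simp: meets_def)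
        have "dyadic_index j a = dyadic_index j (x q)"
          by (rule dyadic_index_eq_mono[of "fst q"]) (use a(2) q x in auto)
        then show "meets j k i" using a q by (auto simp: meets_def)
      qed
      also have "\<dots> \<le> 3 ^ CARD('n) * ennreal (1 / 2 ^ j)"
        using light unfolding mass_def by (intro mult_left_mono) auto
      also have "\<dots> = ennreal (3 ^ CARD('n) / 2 ^ j)"
        unfolding ennreal_3_power by (subst ennreal_mult[symmetric]) auto
      finally show ?thesis by (simp add: sum_nonneg)
    qed
  qed
qed

end

subsection \<open>Hausdorff measure of the image\<close>

lemma ediam_ge_dist: "x \<in> S \<Longrightarrow> y \<in> S \<Longrightarrow> ennreal (dist x y) \<le> ediam S"
  unfolding ediam_def by (meson SUP_upper2 order_refl)

lemma ediam_interval_le: "ediam {a..b::real} \<le> ennreal (b - a)"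
  unfolding ediam_def by (intro SUP_least ennreal_leI) (auto simp: dist_real_def)

lemma ediam_empty [simp]: "ediam {} = 0"
  by (simp add: ediam_def bot_ennreal)

lemma interval_pieces:
  fixes a b :: real
  assumes "t \<in> {a..b}" "0 < K"
  shows "\<exists>s<K. t \<in> {a + real s * ((b - a) / K) .. a + real (Suc s) * ((b - a) / K)}"
proof -
  define h where "h = (b - a) / K"
  have Kh: "real K * h = b - a" using assms(2) by (simp add: h_def)
  show ?thesis
  proof (cases "h = 0")
    case True
    then have "t = a" using Kh assms(1) by simp
    then show ?thesis using True assms(2) by (intro exI[of _ 0]) (simp add: h_def)
  next
    case False
    moreover have "0 \<le> h" using assms(1) by (simp add: h_def)
    ultimately have "0 < h" by simp
    show ?thesis
    \<comment> \<open>At the right endpoint the rounding used below would produce the index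
      \<open>K\<close>, one too large.\<close>
    proof (cases "t = b")
      case True
      have "a + real (K - 1) * h \<le> b" "a + real (Suc (K - 1)) * h = b"
        using Kh assms(2) \<open>0 < h\<close> by (auto simp: algebra_simps of_nat_diff)
      then show ?thesis using True assms(2) unfolding h_def[symmetric] by (intro exI[of _ "K - 1"]) auto
    next
      case False
      define s where "s = nat \<lfloor>(t - a) / h\<rfloor>"
      have "0 \<le> (t - a) / h" using assms(1) \<open>0 < h\<close> by simp
      then have s: "real s \<le> (t - a) / h" "(t - a) / h < real (Suc s)"
        unfolding s_def by linarith+
      then have st: "real s * h \<le> t - a" "t - a \<le> real (Suc s) * h"
        using \<open>0 < h\<close> by (simp_all add: pos_le_divide_eq pos_divide_less_eq less_imp_le)
      have "real s * h < real K * h" unfolding Kh using st False assms(1) by simp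
      then have "s < K" using \<open>0 < h\<close> by simp
      then show ?thesis using st unfolding h_def[symmetric] by (intro exI[of _ s]) auto
    qed
  qed
qed

text \<open>Cutting an interval into equal pieces leaves the sum of diameters unchanged, so in
  dimension one a covering by intervals yields coverings of the same total size at every scale
  \<alpha>.\<close>

lemma hausdorff_measure_1_le:
  fixes F :: "real set"
  assumes ab: "\<And>n. a n \<le> b n" and cover: "F \<subseteq> (\<Union>n. {a n..b n})"
    and total: "(\<Sum>n. ennreal (b n - a n)) \<le> c"
  shows "hausdorff_measure 1 F \<le> c"
  unfolding hausdorff_measure_eq_SUP
proof (rule SUP_least)
  fix \<alpha> :: real assume "\<alpha> \<in> {0<..}"
  then have \<alpha>: "\<alpha> > 0" by simp
  \<comment> \<open>\<open>Suc\<close> keeps the number of pieces positive, also for degenerate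
    intervals; the ceiling makes each piece at most \<alpha> long.\<close>
  define K where "K n = Suc (nat \<lceil>(b n - a n) / \<alpha>\<rceil>)" for n
  define h where "h n = (b n - a n) / K n" for n
  have h: "0 \<le> h n" "h n \<le> \<alpha>" "K n * h n = b n - a n" for n
  proof -
    show "0 \<le> h n" using ab by (simp add: h_def)
    have "(b n - a n) / \<alpha> \<le> K n" unfolding K_def by linarith
    then show "h n \<le> \<alpha>" using \<alpha> by (simp add: h_def K_def field_simps)
    show "K n * h n = b n - a n" by (simp add: h_def K_def)
  qed
  \<comment> \<open>A double sequence padded with empty sets, which contribute 0 because the
    exponent is 1; \<open>prod_decode\<close> turns it into one sequence.\<close>
  define P where "P = (\<lambda>(n, s). if s < K n then {a n + real s * h n .. a n + real (Suc s) * h n} else {})"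
  have diam: "ediam (P (n, s)) \<le> (if s < K n then ennreal (h n) else 0)" for n s
  proof (cases "s < K n")
    case True
    have "ediam (P (n, s)) \<le> ennreal (a n + real (Suc s) * h n - (a n + real s * h n))"
      using True unfolding P_def by (simp only: prod.case if_True ediam_interval_le)
    also have "a n + real (Suc s) * h n - (a n + real s * h n) = h n" by (simp add: algebra_simps)
    finally show ?thesis using True by simp
  qed (simp add: P_def)
  have "hausdorff_pre 1 (ennreal \<alpha>) F \<le> (\<Sum>i. ediam (P (prod_decode i)) ^ 1)"
    unfolding hausdorff_pre_def
  proof (rule INF_lower, intro CollectI conjI allI)
    show "ediam (P (prod_decode i)) \<le> ennreal \<alpha>" for i
    proof -
      obtain n s where ns: "prod_decode i = (n, s)" by fastforce
      have "(if s < K n then ennreal (h n) else 0) \<le> ennreal \<alpha>" using h by (auto intro: ennreal_leI)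
      then show ?thesis using diam[of n s] unfolding ns by (rule order_trans[rotated])
    qed
    show "F \<subseteq> (\<Union>i. P (prod_decode i))"
    proof
      fix t assume "t \<in> F"
      then obtain n where n: "t \<in> {a n..b n}" using cover by blast
      obtain s where "s < K n" "t \<in> {a n + real s * h n .. a n + real (Suc s) * h n}"
        using interval_pieces[OF n, of "K n"] unfolding h_def by (auto simp: K_def)
      then have "t \<in> P (prod_decode (prod_encode (n, s)))" by (simp add: P_def)
      then show "t \<in> (\<Union>i. P (prod_decode i))" by blast
    qed
  qed
  also have "\<dots> = (\<Sum>n. \<Sum>s. ediam (P (n, s)))"
    using suminf_ennreal_2dimen[of "\<lambda>n. \<Sum>s. ediam (P (n, s))" "\<lambda>q. ediam (P q)"] by (simp add: comp_def)
  also have "\<dots> \<le> (\<Sum>n. ennreal (b n - a n))"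
  proof (intro suminf_le summableI)
    fix n
    have "(\<Sum>s. ediam (P (n, s))) \<le> (\<Sum>s. if s < K n then ennreal (h n) else 0)"
      by (intro suminf_le summableI diam)
    also have "\<dots> = (\<Sum>s\<in>{..<K n}. if s < K n then ennreal (h n) else 0)"
      by (rule suminf_finite) auto
    also have "\<dots> = ennreal (K n * h n)"
      by (simp add: ennreal_mult h(1) ennreal_of_nat_eq_real_of_nat)
    finally show "(\<Sum>s. ediam (P (n, s))) \<le> ennreal (b n - a n)" unfolding h(3) .
  qed
  finally show "hausdorff_pre 1 (ennreal \<alpha>) F \<le> c" using total by (rule order_trans)
qed

text \<open>Suprema and infima need not be attained, so near-extremal points are chosen in all sets
  simultaneously, with an error whose total over the finite family is at most
  \<open>e\<close>.\<close>

lemma sum_Sup_minus_Inf_le: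
  fixes D :: "'a \<Rightarrow> real set"
  assumes I: "finite I" and ne: "\<And>p. p \<in> I \<Longrightarrow> D p \<noteq> {}"
    and le: "\<And>s t. (\<And>p. p \<in> I \<Longrightarrow> s p \<in> D p \<and> t p \<in> D p) \<Longrightarrow> (\<Sum>p\<in>I. \<bar>s p - t p\<bar>) \<le> \<epsilon>"
  shows "(\<Sum>p\<in>I. Sup (D p) - Inf (D p)) \<le> \<epsilon>"
proof (rule field_le_epsilon)
  fix e :: real assume "e > 0"
  define \<eta> where "\<eta> = e / (2 * (card I + 1))"
  have \<eta>: "\<eta> > 0" using \<open>e > 0\<close> by (simp add: \<eta>_def)
  have "\<exists>s. s \<in> D p \<and> Sup (D p) - \<eta> < s" if "p \<in> I" for p
    using less_cSupD[OF ne[OF that], of "Sup (D p) - \<eta>"] \<eta> by auto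
  then obtain s where s: "\<And>p. p \<in> I \<Longrightarrow> s p \<in> D p \<and> Sup (D p) - \<eta> < s p" by metis
  have "\<exists>t. t \<in> D p \<and> t < Inf (D p) + \<eta>" if "p \<in> I" for p
    using cInf_lessD[OF ne[OF that], of "Inf (D p) + \<eta>"] \<eta> by auto
  then obtain t where t: "\<And>p. p \<in> I \<Longrightarrow> t p \<in> D p \<and> t p < Inf (D p) + \<eta>" by metis
  have "(\<Sum>p\<in>I. Sup (D p) - Inf (D p)) \<le> (\<Sum>p\<in>I. \<bar>s p - t p\<bar> + 2 * \<eta>)"
  proof (intro sum_mono)
    fix p assume "p \<in> I"
    then show "Sup (D p) - Inf (D p) \<le> \<bar>s p - t p\<bar> + 2 * \<eta>" using s[of p] t[of p] by linarith
  qed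
  also have "\<dots> \<le> \<epsilon> + card I * (2 * \<eta>)" using le[of s t] s t by (simp add: sum.distrib)
  also have "card I * (2 * \<eta>) \<le> e" using \<open>e > 0\<close> by (simp add: \<eta>_def field_simps)
  finally show "(\<Sum>p\<in>I. Sup (D p) - Inf (D p)) \<le> \<epsilon> + e" by simp
qed

section \<open>From small content to a covering with dyadic sizes\<close>

lemma dyadic_scale:
  assumes "0 < d" "d \<le> (1::real)"
  shows "\<exists>j. d \<le> 1 / 2 ^ j \<and> 1 / 2 ^ j \<le> 2 * d"
proof -
  let ?P = "\<lambda>k. 1 / 2 ^ k < d"
  obtain k where "(1/2) ^ k < d" using real_arch_pow_inv[of d "1/2"] assms by auto
  then have ex: "?P k" by (simp add: power_one_over)
  define k where "k = (LEAST k. ?P k)"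
  have k: "?P k" unfolding k_def by (rule LeastI[of ?P, OF ex])
  then obtain j where j: "k = Suc j" using assms(2) by (cases k) auto
  have "\<not> ?P j" using not_less_Least[of j ?P] by (simp add: k_def[symmetric] j)
  then show ?thesis using k by (intro exI[of _ j]) (simp add: j)
qed

text \<open>A covering set may be a single point and then has no dyadic scale. The slack
  \<open>\<delta> - suminf r\<close> is therefore distributed geometrically over the diameters,
  which makes them positive with sum exactly \<delta>; rounding up to powers of 2 at most doubles
  them. \<open>\<delta> \<le> 1\<close> keeps the diameters at most 1, so that the
  \<open>J i\<close> are natural numbers.\<close>

lemma hausdorff_content_covering:
  fixes E :: "(real^'n::finite) set"
  assumes "hausdorff_content 1 E < ennreal \<delta>" "\<delta> \<le> 1"
  obtains A J where "small_covering A J" "E \<subseteq> (\<Union>i. A i)" "(\<Sum>i. ennreal (1 / 2 ^ J i)) \<le> ennreal (2 * \<delta>)"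
proof -
  obtain A :: "nat \<Rightarrow> (real^'n) set" where A: "E \<subseteq> (\<Union>i. A i)" "(\<Sum>i. ediam (A i) ^ 1) < ennreal \<delta>"
    using assms(1) unfolding hausdorff_content_def hausdorff_pre_def INF_less_iff by blast
  have lt: "(\<Sum>i. ediam (A i)) < ennreal \<delta>" using A(2) by simp
  have fin: "ediam (A i) < top" for i
    using ennreal_suminf_lessD[OF lt, of i] by (rule order_less_trans) simp
  define r where "r i = enn2real (ediam (A i))" for i
  have r: "ediam (A i) = ennreal (r i)" "0 \<le> r i" for i
    using fin[of i] by (auto simp: r_def)
  have lt': "(\<Sum>i. ennreal (r i)) < ennreal \<delta>" using lt by (simp add: r(1))
  then have "(\<Sum>i. ennreal (r i)) \<noteq> top" by auto
  then have sm: "summable r" using r(2) by (rule summable_suminf_not_top[rotated])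
  have S: "suminf r < \<delta>" using lt' suminf_ennreal2[OF r(2) sm] suminf_nonneg[OF sm r(2)] by (simp add: ennreal_less_iff)
  define d where "d i = r i + (\<delta> - suminf r) * (1/2) ^ Suc i" for i
  have "(\<lambda>i. (\<delta> - suminf r) * (1/2) ^ Suc i) sums ((\<delta> - suminf r) * 1)"
    by (intro sums_mult power_half_series)
  then have dsum: "d sums \<delta>" unfolding d_def using sums_add[OF summable_sums[OF sm]] by fastforce
  have dpos: "0 < d i" "r i \<le> d i" for i
    using S r(2)[of i] by (auto simp: d_def intro: add_nonneg_pos)
  have "d i \<le> \<delta>" for i
    using sum_le_suminf[of d "{i}"] dsum dpos(1) by (auto simp: sums_iff less_imp_le)
  then have "d i \<le> 1" for i using assms(2) by (meson order_trans)
  then have "\<forall>i. \<exists>j. d i \<le> 1 / 2 ^ j \<and> 1 / 2 ^ j \<le> 2 * d i" using dyadic_scale dpos(1) by blast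
  from choice[OF this] obtain J where J: "\<And>i. d i \<le> 1 / 2 ^ J i" "\<And>i. 1 / 2 ^ J i \<le> 2 * d i" by blast
  show ?thesis
  proof (rule that[OF _ A(1)])
    show "small_covering A J"
    proof
      fix x y i l assume "x \<in> A i" "y \<in> A i"
      then have "ennreal (dist x y) \<le> ennreal (r i)" using ediam_ge_dist r(1) by metis
      then have "dist x y \<le> r i" using r(2) by (simp add: ennreal_le_iff)
      moreover have "\<bar>x $ l - y $ l\<bar> \<le> dist x y"
        using component_le_norm_cart[of "x - y" l] by (simp add: dist_norm)
      ultimately show "\<bar>x $ l - y $ l\<bar> \<le> 1 / 2 ^ J i" using dpos(2)[of i] J(1)[of i] by linarith
    qed
    have "(\<Sum>i. ennreal (1 / 2 ^ J i)) \<le> (\<Sum>i. ennreal (2 * d i))"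
      by (intro suminf_le summableI ennreal_leI J)
    also have "\<dots> = ennreal (2 * \<delta>)"
      using dpos(1) by (intro suminf_ennreal_eq sums_mult dsum) (simp add: less_imp_le)
    finally show "(\<Sum>i. ennreal (1 / 2 ^ J i)) \<le> ennreal (2 * \<delta>)" .
  qed
qed

section \<open>Covering the image by oscillation intervals\<close>

text \<open>The coarsest heavy cubes cover \<open>E\<close>, so their oscillation intervals cover
  the image. The oscillation estimate speaks of finite subfamilies, but its bound is the same for
  all of them and passes to the infinite sum of lengths.\<close>

lemma hausdorff_measure_precise_rep_image_le:
  fixes v :: "real^'n::finite \<Rightarrow> real"
  assumes v: "v \<in> sobolev_W1 CARD('n)" and "\<epsilon> > 0"
  shows "\<exists>\<delta>>0. \<forall>E :: (real^'n) set. hausdorff_content 1 E < ennreal \<delta> \<longrightarrow>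
    hausdorff_measure 1 (precise_rep v ` E) \<le> ennreal \<epsilon>"
proof -
  let ?R = "3 ^ CARD('n) :: real"
  have "?R \<ge> 1" by simp
  from dyadic_oscillation_sum[OF v \<open>\<epsilon> > 0\<close> this]
  obtain d where "d > 0" and d: "\<And>(I :: (nat \<times> ('n \<Rightarrow> int)) set) x y. finite I \<Longrightarrow>
    \<forall>p\<in>I. dyadic_index (fst p) (x p) = snd p \<and> dyadic_index (fst p) (y p) = snd p \<Longrightarrow>
    \<forall>p\<in>I. \<forall>q\<in>I. p \<noteq> q \<longrightarrow> fst p \<le> fst q \<longrightarrow> dyadic_index (fst p) (x q) \<noteq> snd p \<Longrightarrow>
    \<forall>j k. (\<Sum>p | p \<in> I \<and> j \<le> fst p \<and> dyadic_index j (x p) = k. 1 / 2 ^ fst p) \<le> ?R / 2 ^ j \<Longrightarrow>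
    (\<Sum>p\<in>I. 1 / 2 ^ fst p) \<le> (d :: real) \<Longrightarrow>
    (\<Sum>p\<in>I. \<bar>precise_rep v (x p) - precise_rep v (y p)\<bar>) \<le> \<epsilon>"
    by blast
  \<comment> \<open>The covering has total size at most 2 * \<delta> and each set is charged by at
    most 3^N cubes, so the side lengths of the cubes add up to at most \<open>d\<close>.\<close>
  define \<delta> where "\<delta> = min 1 (d / (2 * ?R))"
  have \<delta>: "\<delta> > 0" "\<delta> \<le> 1" using \<open>d > 0\<close> by (auto simp: \<delta>_def)
  have \<delta>d: "?R * (2 * \<delta>) \<le> d"
  proof -
    have "\<delta> \<le> d / (2 * ?R)" by (simp add: \<delta>_def)
    then show ?thesis by (simp add: field_simps)
  qed
  show ?thesis
  proof (intro exI[of _ \<delta>] conjI allI impI \<delta>(1))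
    fix E :: "(real^'n) set" assume "hausdorff_content 1 E < ennreal \<delta>"
    then obtain A J where AJ: "small_covering A J" and EA: "E \<subseteq> (\<Union>i. A i)"
      and size: "(\<Sum>i. ennreal (1 / 2 ^ J i)) \<le> ennreal (2 * \<delta>)"
      using hausdorff_content_covering[OF _ \<delta>(2)] by blast
    interpret small_covering A J by (rule AJ)
    let ?H = "coarsest_heavy"
    let ?D = "\<lambda>p. precise_rep v ` {x. dyadic_index (fst p) x = snd p}"
    have osc: "(\<Sum>p\<in>I. \<bar>s p - t p\<bar>) \<le> \<epsilon>"
      if I: "finite I" "I \<subseteq> ?H" and st: "\<And>p. p \<in> I \<Longrightarrow> s p \<in> ?D p \<and> t p \<in> ?D p" for I s t
    proof -
      have "\<forall>p\<in>I. \<exists>x. dyadic_index (fst p) x = snd p \<and> s p = precise_rep v x" using st by blast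
      from bchoice[OF this] obtain x where x: "\<forall>p\<in>I. dyadic_index (fst p) (x p) = snd p \<and> s p = precise_rep v (x p)" ..
      have "\<forall>p\<in>I. \<exists>y. dyadic_index (fst p) y = snd p \<and> t p = precise_rep v y" using st by blast
      from bchoice[OF this] obtain y where y: "\<forall>p\<in>I. dyadic_index (fst p) (y p) = snd p \<and> t p = precise_rep v (y p)" ..
      have "(\<Sum>p\<in>I. \<bar>s p - t p\<bar>) = (\<Sum>p\<in>I. \<bar>precise_rep v (x p) - precise_rep v (y p)\<bar>)"
        by (intro sum.cong refl) (simp add: bspec[OF x] bspec[OF y])
      also have "\<dots> \<le> \<epsilon>"
      proof (rule d[OF I(1)])
        show "\<forall>p\<in>I. dyadic_index (fst p) (x p) = snd p \<and> dyadic_index (fst p) (y p) = snd p"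
          by (intro ballI conjI) (simp_all add: bspec[OF x] bspec[OF y])
        show "\<forall>p\<in>I. \<forall>q\<in>I. p \<noteq> q \<longrightarrow> fst p \<le> fst q \<longrightarrow> dyadic_index (fst p) (x q) \<noteq> snd p"
        proof (intro ballI impI)
          fix p q assume pq: "p \<in> I" "q \<in> I" "p \<noteq> q" "fst p \<le> fst q"
          show "dyadic_index (fst p) (x q) \<noteq> snd p"
            by (rule coarsest_heavy_disjoint[of p q]) (use pq I(2) bspec[OF x pq(2)] in auto)
        qed
        show "\<forall>j k. (\<Sum>p | p \<in> I \<and> j \<le> fst p \<and> dyadic_index j (x p) = k. 1 / 2 ^ fst p) \<le> ?R / 2 ^ j"
          by (intro allI coarsest_heavy_regular I) (simp add: bspec[OF x])
        have "(\<Sum>p\<in>I. ennreal (1 / 2 ^ fst p)) \<le> 3 ^ CARD('n) * (\<Sum>i. if True then ennreal (1 / 2 ^ J i) else 0)"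
          by (rule sum_coarsest_heavy_le[OF I]) simp
        also have "\<dots> \<le> 3 ^ CARD('n) * ennreal (2 * \<delta>)" using size by (simp add: mult_left_mono)
        also have "\<dots> = ennreal (?R * (2 * \<delta>))"
          unfolding ennreal_3_power using \<delta>(1) by (subst ennreal_mult[symmetric]) auto
        also have "\<dots> \<le> ennreal d" by (rule ennreal_leI[OF \<delta>d])
        finally have "ennreal (\<Sum>p\<in>I. 1 / 2 ^ fst p) \<le> ennreal d" by simp
        then show "(\<Sum>p\<in>I. 1 / 2 ^ fst p) \<le> d" using \<open>d > 0\<close> by (simp add: ennreal_le_iff)
      qed
      finally show ?thesis .
    qed
    have ne: "?D p \<noteq> {}" if "p \<in> ?H" for p using coarsest_heavyD(2)[OF that] by blast
    \<comment> \<open>Singleton families show that the image of each cube is bounded, without which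
      its real \<open>Sup\<close> and \<open>Inf\<close> would carry no information.\<close>
    have close: "\<bar>s - t\<bar> \<le> \<epsilon>" if "p \<in> ?H" "s \<in> ?D p" "t \<in> ?D p" for p s t
      using osc[of "{p}" "\<lambda>_. s" "\<lambda>_. t"] that by simp
    have bdd: "bdd_above (?D p)" "bdd_below (?D p)" if p: "p \<in> ?H" for p
    proof -
      obtain t where t: "t \<in> ?D p" using ne[OF p] by blast
      have st: "s \<le> t + \<epsilon> \<and> t - \<epsilon> \<le> s" if "s \<in> ?D p" for s using close[OF p that t] by linarith
      show "bdd_above (?D p)" by (rule bdd_aboveI[of _ "t + \<epsilon>"]) (use st in blast)
      show "bdd_below (?D p)" by (rule bdd_belowI[of _ "t - \<epsilon>"]) (use st in blast)
    qed
    \<comment> \<open>Cubes are enumerated by \<open>to_nat\<close>; numbers that encode no chosen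
      cube get the interval from 0 to 0, of length 0.\<close>
    define a where "a n = (if n \<in> to_nat ` ?H then Inf (?D (from_nat n)) else 0)" for n
    define b where "b n = (if n \<in> to_nat ` ?H then Sup (?D (from_nat n)) else 0)" for n
    have ab: "a n \<le> b n" for n
    proof (cases "n \<in> to_nat ` ?H")
      case True
      then obtain p where p: "p \<in> ?H" "from_nat n = p" by auto
      then show ?thesis using True cInf_le_cSup[OF ne bdd, of p] by (simp add: a_def b_def)
    qed (simp add: a_def b_def)
    show "hausdorff_measure 1 (precise_rep v ` E) \<le> ennreal \<epsilon>"
    proof (rule hausdorff_measure_1_le[OF ab])
      show "precise_rep v ` E \<subseteq> (\<Union>n. {a n..b n})"
      proof
        fix t assume "t \<in> precise_rep v ` E"
        then obtain x i where x: "t = precise_rep v x" "x \<in> A i" using EA by blast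
        obtain p where p: "p \<in> ?H" "dyadic_index (fst p) x = snd p" using coarsest_heavy_covers[OF x(2)] by blast
        then have tD: "t \<in> ?D p" using x(1) by blast
        have "to_nat p \<in> to_nat ` ?H" using p(1) by blast
        then have "a (to_nat p) \<le> t" "t \<le> b (to_nat p)"
          using cInf_lower[OF tD bdd(2)[OF p(1)]] cSup_upper[OF tD bdd(1)[OF p(1)]] by (simp_all only: a_def b_def if_True from_nat_to_nat)
        then show "t \<in> (\<Union>n. {a n..b n})" by auto
      qed
      show "(\<Sum>n. ennreal (b n - a n)) \<le> ennreal \<epsilon>"
      proof (rule suminf_le_const[OF summableI])
        fix M
        let ?S = "{n \<in> {..<M}. n \<in> to_nat ` ?H}"
        let ?I = "from_nat ` ?S :: (nat \<times> ('n \<Rightarrow> int)) set"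
        have I: "finite ?I" "?I \<subseteq> ?H" by auto
        have inj: "inj_on (from_nat :: nat \<Rightarrow> nat \<times> ('n \<Rightarrow> int)) ?S"
          by (rule inj_onI) auto
        have "(\<Sum>n<M. b n - a n) = (\<Sum>n\<in>{..<M}. if n \<in> to_nat ` ?H then Sup (?D (from_nat n)) - Inf (?D (from_nat n)) else 0)"
          by (intro sum.cong) (auto simp: a_def b_def)
        also have "\<dots> = (\<Sum>n\<in>?S. Sup (?D (from_nat n)) - Inf (?D (from_nat n)))"
          by (rule sum.inter_filter[symmetric]) simp
        also have "\<dots> = (\<Sum>p\<in>?I. Sup (?D p) - Inf (?D p))"
          by (subst sum.reindex[OF inj]) simp
        also have "\<dots> \<le> \<epsilon>"
        proof (rule sum_Sup_minus_Inf_le[OF I(1)])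
          show "(\<Sum>p\<in>?I. \<bar>s p - t p\<bar>) \<le> \<epsilon>" if "\<And>p. p \<in> ?I \<Longrightarrow> s p \<in> ?D p \<and> t p \<in> ?D p" for s t
            by (rule osc[OF I that])
          fix p assume "p \<in> ?I"
          then have "p \<in> ?H" using I(2) by blast
          then show "?D p \<noteq> {}" by (rule ne)
        qed
        finally have "(\<Sum>n<M. b n - a n) \<le> \<epsilon>" .
        moreover have "(\<Sum>n<M. ennreal (b n - a n)) = ennreal (\<Sum>n<M. b n - a n)"
          using ab by (intro sum_ennreal) simp
        ultimately show "(\<Sum>n<M. ennreal (b n - a n)) \<le> ennreal \<epsilon>" by (simp add: ennreal_leI)
      qed
    qed
  qed
qed

lemma hausdorff_content_le_measure: "hausdorff_content k E \<le> hausdorff_measure k E"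
proof -
  have "hausdorff_content k E \<le> hausdorff_pre k (ennreal 1) E"
    unfolding hausdorff_content_def by (rule hausdorff_pre_antimono) simp
  also have "\<dots> \<le> hausdorff_measure k E"
    unfolding hausdorff_measure_eq_SUP by (rule SUP_upper) simp
  finally show ?thesis .
qed

theorem theorem2p1:
  fixes v :: "real^'n \<Rightarrow> real"
  assumes "v \<in> sobolev_W1 CARD('n)"
  shows "(\<forall>\<epsilon>::real. \<epsilon> > 0 \<longrightarrow> (\<exists>\<delta>::real. \<delta> > 0 \<and>
            (\<forall>E :: (real^'n) set. hausdorff_content 1 E < ennreal \<delta> \<longrightarrow>
               hausdorff_measure 1 (precise_rep v ` E) < ennreal \<epsilon>)))
       \<and> (\<forall>E :: (real^'n) set. hausdorff_measure 1 E = 0 \<longrightarrow>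
            hausdorff_measure 1 (precise_rep v ` E) = 0)"
proof -
  have *: "\<exists>\<delta>::real. \<delta> > 0 \<and> (\<forall>E :: (real^'n) set. hausdorff_content 1 E < ennreal \<delta> \<longrightarrow>
      hausdorff_measure 1 (precise_rep v ` E) < ennreal \<epsilon>)" if "\<epsilon> > 0" for \<epsilon> :: real
  proof -
    \<comment> \<open>Passing to \<epsilon>/2 turns the non-strict bound into a strict one.\<close>
    obtain \<delta> where \<delta>: "\<delta> > 0" "\<And>E :: (real^'n) set. hausdorff_content 1 E < ennreal \<delta> \<Longrightarrow>
      hausdorff_measure 1 (precise_rep v ` E) \<le> ennreal (\<epsilon> / 2)"
      using hausdorff_measure_precise_rep_image_le[OF assms, of "\<epsilon> / 2"] \<open>\<epsilon> > 0\<close> by auto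
    have "ennreal (\<epsilon> / 2) < ennreal \<epsilon>" using \<open>\<epsilon> > 0\<close> by (simp add: ennreal_less_iff)
    then show ?thesis using \<delta> order_le_less_trans by blast
  qed
  moreover have "hausdorff_measure 1 (precise_rep v ` E) = 0" if E: "hausdorff_measure 1 E = 0" for E :: "(real^'n) set"
  proof (rule ccontr)
    assume "hausdorff_measure 1 (precise_rep v ` E) \<noteq> 0"
    then have "0 < hausdorff_measure 1 (precise_rep v ` E)" by (simp add: zero_less_iff_neq_zero)
    \<comment> \<open>The measure of the image could be infinite, so the contradiction is derived at
      a finite positive value \<open>u\<close> below it.\<close>
    then obtain u where u: "0 < u" "u < hausdorff_measure 1 (precise_rep v ` E)"
      using dense by blast
    then have "u < top" using order_less_le_trans[OF u(2) top_greatest] by simp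
    then obtain \<epsilon> where \<epsilon>: "u = ennreal \<epsilon>" "0 \<le> \<epsilon>" by (auto simp: less_top_ennreal)
    then have "\<epsilon> > 0" using u(1) by simp
    then obtain \<delta> where \<delta>: "\<delta> > 0" "\<forall>E :: (real^'n) set. hausdorff_content 1 E < ennreal \<delta> \<longrightarrow>
      hausdorff_measure 1 (precise_rep v ` E) < ennreal \<epsilon>" using * by blast
    have "hausdorff_content 1 E < ennreal \<delta>"
      using hausdorff_content_le_measure[of 1 E] E \<delta>(1) by simp
    then have "hausdorff_measure 1 (precise_rep v ` E) < u" using \<delta>(2) \<epsilon>(1) by simp
    then show False using u(2) by simp
  qed
  ultimately show ?thesis by blast
qed

end
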